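(* Let $\gamma\in(0,\infty)$ and let $(f_n)_{n\in\mathbb N}\subset L^{1,+}_{\rm loc}(\mathbb R_+)$ be a sequence of functions satisfying $$\lim_{n\to\infty}(I^1f_n)(x)=\gamma\qquad\text{for all }x>0 .$$ Let $\eta_n:=\eta_{f_n}$, $n\in\mathbb N$, be the Poisson point processes with densities $f_n$ and let $\eta^\gamma$ be a homogeneous Poisson point process in $\mathbb R^d$ with intensity $\gamma$. Then there exist point processes $\widetilde\eta^\gamma$ and $(\widetilde\eta_n)_{n\in\mathbb N}$ defined on a common probability space, with $\widetilde\eta^\gamma\overset d=\eta^\gamma$ and $\widetilde\eta_n\overset d=\eta_n$ for all $n\in\mathbb N$, such that (i) $\mathrm{skel}(\mathcal L^*(\widetilde\eta_n))$ converges locally with high probability to $\mathrm{skel}(\mathcal L^*(\widetilde\eta^\gamma))$ as $n\to\infty$; (ii) $\mathrm{skel}(\mathcal L(\widetilde\eta_n))$ converges in probability to $\mathrm{skel}(\mathcal L(\widetilde\eta^\gamma))$ as $n\to\infty$.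
   Context: Let $d\ge2$. Points of $\mathbb R^d\times\mathbb R$ are written $(v,h)$. Put $\mathrm{pow}(w,(v,h))=\|w-v\|^2+h$. For a countable set $A\subset\mathbb R^d\times\mathbb R$ and $(v,h)\in A$ the Laguerre cell is $C((v,h),A)=\{w\in\mathbb R^d:\mathrm{pow}(w,(v,h))\le \mathrm{pow}(w,(v',h'))\ \forall (v',h')\in A\}$, and the Laguerre diagram $\mathcal L(A)$ is the collection of all Laguerre cells with non-empty interior. A tessellation in $\mathbb R^d$ is a locally finite system of convex polytopes (cells) with non-empty, pairwise disjoint interiors covering $\mathbb R^d$, such that the intersection of two distinct cells is empty or a face of both. It is normal if each $k$-dimensional face is contained in precisely $d+1-k$ cells, $0\le k\le d-1$. If $\mathcal L(A)$ is a normal tessellation, its dual $\mathcal L^*(A)$ is the collection of simplices $\mathrm{conv}(v_1,\dots,v_{d+1})$ over distinct $(v_1,h_1),\dots,(v_{d+1},h_{d+1})\in A$ with $\bigcap_{i=1}^{d+1}C((v_i,h_i),A)\ne\varnothing$. The skeleton is $\mathrm{skel}(X)=\bigcup_{c\in X}\mathrm{bd}\,c$. $L^{1,+}_{\rm loc}(\mathbb R_+)$, $\mathbb R_+=[0,\infty)$, is the set of functions $f:(0,\infty)\to[0,\infty)$ with $\int_K f\,dx<\infty$ for all compact $K\subset[0,\infty)$; such $f$ is regarded as $0$ on $(-\infty,0)$. $(I^1f)(x)=\int_{-\infty}^xf(t)\,dt$. $\eta_f$ is the Poisson point process in $\mathbb R^d\times\mathbb R_+$ with intensity measure $\Lambda_f(\cdot)=\int_{\mathbb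 R^d}\int_0^\infty f(h)\mathbf 1((v,h)\in\cdot)\,dh\,dv$, assumed non-trivial; then $\mathcal L(\eta_f)$ is almost surely a normal random tessellation. A point process in $\mathbb R^d$ (such as $\eta^\gamma$) is viewed as a point process in $\mathbb R^d\times\mathbb R$ by identifying $v$ with $(v,0)$; thus $\mathcal L(\eta^\gamma)$ is the Poisson-Voronoi tessellation and $\mathcal L^*(\eta^\gamma)$ the Poisson-Delaunay tessellation. Let $(Z_n)_{n\in\mathbb N}$, $Z$ be random closed sets on a common probability space. $Z_n$ converges to $Z$ locally with high probability if $\lim_{n\to\infty}\mathbb P(Z_n\cap B_R\neq Z\cap B_R)=0$ for every $R>0$, where $B_R$ is the closed centered ball of radius $R$. $Z_n$ converges to $Z$ in probability if for every $\varepsilon>0$ and every compact $C\subset\mathbb R^d$, $\lim_{n\to\infty}\mathbb P\big([(Z_n\setminus Z^{\varepsilon-})\cup(Z\setminus Z_n^{\varepsilon-})]\cap C\ne\varnothing\big)=0$, where $F^{\varepsilon-}=\{z\in\mathbb R^d:\inf_{x\in F}\|z-x\|<\varepsilon\}$. *)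

theory Defs
  imports "HOL-Probability.Probability"
begin

section \<open>Laguerre diagrams\<close>

text \<open>
  Throughout, \<^typ>\<open>'a::euclidean_space\<close> plays the role of $R^d$ with $d = $ \<open>DIM('a)\<close>, and
  a weighted point $(v,h)$ is an element of \<^typ>\<open>'a \<times> real\<close>.
\<close>

definition lpow :: "'a::euclidean_space \<Rightarrow> 'a \<times> real \<Rightarrow> real" where
  "lpow w p = (norm (w - fst p))\<^sup>2 + snd p"

definition laguerre_cell :: "'a::euclidean_space \<times> real \<Rightarrow> ('a \<times> real) set \<Rightarrow> 'a set" where
  "laguerre_cell p A = {w. \<forall>q\<in>A. lpow w p \<le> lpow w q}"

definition laguerre :: "('a::euclidean_space \<times> real) set \<Rightarrow> 'a set set" where
  "laguerre A = {laguerre_cell p A | p. p \<in> A \<and> interior (laguerre_cell p A) \<noteq> {}}"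

text \<open>
  The dual is of interest only if \<^term>\<open>laguerre A\<close> is a normal tessellation, which is almost
  surely the case for the processes considered; the same formula is used for all other \<open>A\<close>.
  A set \<open>S\<close> with \<open>card S = d + 1\<close> is a choice of \<open>d + 1\<close> distinct weighted points.
\<close>

definition laguerre_dual :: "('a::euclidean_space \<times> real) set \<Rightarrow> 'a set set" where
  "laguerre_dual A = {convex hull (fst ` S) | S.
     S \<subseteq> A \<and> card S = DIM('a) + 1 \<and> (\<Inter>p\<in>S. laguerre_cell p A) \<noteq> {}}"

definition skel :: "'a::euclidean_space set set \<Rightarrow> 'a set" where
  "skel X = (\<Union>c\<in>X. frontier c)"

definition at_height_0 :: "'a set \<Rightarrow> ('a \<times> real) set" where
  "at_height_0 A = (\<lambda>v. (v, 0)) ` A"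


section \<open>Point processes\<close>

text \<open>
  All processes below have diffuse intensity measures, hence are simple, so configurations are
  locally finite sets. The \<open>\<sigma>\<close>-algebra is the usual one generated by the counting maps.
\<close>

definition locally_finite_set :: "'e::euclidean_space set \<Rightarrow> bool" where
  "locally_finite_set A \<longleftrightarrow> (\<forall>B. bounded B \<longrightarrow> finite (A \<inter> B))"

definition config_space :: "'e::euclidean_space set measure" where
  "config_space = sigma {A. locally_finite_set A}
     {{A. locally_finite_set A \<and> card (A \<inter> B) = k} | B k. B \<in> sets borel \<and> bounded B}"

definition point_process :: "'w measure \<Rightarrow> ('w \<Rightarrow> 'e::euclidean_space set) \<Rightarrow> bool" where
  "point_process M \<eta> \<longleftrightarrow> prob_space M \<and> \<eta> \<in> measurable M config_space"

text \<open>
  The intensity measure \<open>\<Lambda>\<close> is meant to be locally finite; restricting the two defining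
  conditions to bounded Borel sets keeps all counts and all parameters finite.
\<close>

definition poisson_process ::
    "'w measure \<Rightarrow> 'e::euclidean_space measure \<Rightarrow> ('w \<Rightarrow> 'e set) \<Rightarrow> bool" where
  "poisson_process M \<Lambda> \<eta> \<longleftrightarrow> point_process M \<eta> \<and>
     (\<forall>B\<in>sets borel. bounded B \<longrightarrow>
        (\<forall>k::nat. measure M {\<omega>\<in>space M. card (\<eta> \<omega> \<inter> B) = k}
           = measure \<Lambda> B ^ k / fact k * exp (- measure \<Lambda> B))) \<and>
     (\<forall>(m::nat) B. (\<forall>i<m. B i \<in> sets borel \<and> bounded (B i)) \<and> disjoint_family_on B {..<m} \<longrightarrow>
        prob_space.indep_vars M (\<lambda>_. count_space UNIV) (\<lambda>i \<omega>. card (\<eta> \<omega> \<inter> B i)) {..<m})"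

definition homogeneous_intensity :: "real \<Rightarrow> 'a::euclidean_space measure" where
  "homogeneous_intensity \<gamma> = density lborel (\<lambda>_. ennreal \<gamma>)"


section \<open>Densities\<close>

text \<open>
  A function on \<open>(0,\<infinity>)\<close> is a total function whose values outside \<open>(0,\<infinity>)\<close> are ignored:
  it only enters through its extension by zero.
\<close>

definition zero_ext :: "(real \<Rightarrow> real) \<Rightarrow> real \<Rightarrow> real" where
  "zero_ext f x = (if 0 < x then f x else 0)"

definition L1loc_plus :: "(real \<Rightarrow> real) set" where
  "L1loc_plus = {f. (\<forall>x>0. 0 \<le> f x) \<and>
     (\<forall>K. compact K \<and> K \<subseteq> {0..} \<longrightarrow> set_integrable lebesgue K (zero_ext f))}"

definition I1 :: "(real \<Rightarrow> real) \<Rightarrow> real \<Rightarrow> real" where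
  "I1 f x = (LINT t:{..x}|lebesgue. zero_ext f t)"

text \<open>
  The push-forward along the identity restricts the product measure to the Borel sets; it is
  needed because \<open>f\<close> is only assumed Lebesgue measurable.
\<close>

definition height_intensity :: "(real \<Rightarrow> real) \<Rightarrow> ('a::euclidean_space \<times> real) measure" where
  "height_intensity f =
     distr (lborel \<Otimes>\<^sub>M density lebesgue (\<lambda>h. ennreal (zero_ext f h))) borel (\<lambda>p. p)"

lemma emeasure_height_intensity:
  fixes B :: "('a::euclidean_space \<times> real) set"
  assumes f: "f \<in> L1loc_plus" and B: "B \<in> sets borel"
  shows "emeasure (height_intensity f) B =
    (\<integral>\<^sup>+v. (\<integral>\<^sup>+h\<in>{0<..}. ennreal (f h) * indicator B (v, h) \<partial>lebesgue) \<partial>lborel)"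
proof -
  have meas: "zero_ext f \<in> borel_measurable lebesgue"
  proof (rule borel_measurable_LIMSEQ_real)
    fix n :: nat
    have "set_integrable lebesgue {0..real n} (zero_ext f)"
      using f by (auto simp: L1loc_plus_def)
    then show "(\<lambda>x. indicator {0..real n} x *\<^sub>R zero_ext f x) \<in> borel_measurable lebesgue"
      unfolding set_integrable_def by (rule borel_measurable_integrable)
  next
    fix x :: real
    have "eventually (\<lambda>n. indicator {0..real n} x *\<^sub>R zero_ext f x = zero_ext f x) sequentially"
      using eventually_ge_at_top[of "nat \<lceil>x\<rceil>"]
      by eventually_elim (auto simp: zero_ext_def indicator_def; linarith)
    then show "(\<lambda>n. indicator {0..real n} x *\<^sub>R zero_ext f x) \<longlonglongrightarrow> zero_ext f x"
      by (rule tendsto_eventually)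
  qed
  define D where "D = density lebesgue (\<lambda>h. ennreal (zero_ext f h))"
  have "sigma_finite_measure (lebesgue :: real measure)"
  proof (intro sigma_finite_measure.intro exI[of _ "range (\<lambda>n::nat. cball (0::real) (real n))"] conjI)
    show "\<Union> (range (\<lambda>n. cball (0::real) (real n))) = space lebesgue"
      by (auto simp: real_arch_simple)
    show "\<forall>a\<in>range (\<lambda>n. cball (0::real) (real n)). emeasure lebesgue a \<noteq> \<infinity>"
      using emeasure_lborel_cball_finite by (auto simp: less_top[symmetric] top_unique)
  qed auto
  then have "sigma_finite_measure D"
    unfolding D_def using meas
    by (subst sigma_finite_measure.sigma_finite_iff_density_finite) auto
  then interpret sigma_finite_measure D .
  have idm: "(\<lambda>p. p) \<in> measurable (lborel \<Otimes>\<^sub>M D) (borel :: ('a \<times> real) measure)"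
  proof -
    have "(\<lambda>h. h) \<in> measurable D borel"
      unfolding D_def by (simp add: measurable_completion)
    then have "(\<lambda>p. (fst p, snd p)) \<in> measurable (lborel \<Otimes>\<^sub>M D) (borel \<Otimes>\<^sub>M (borel::real measure))"
      by (intro measurable_Pair measurable_compose[OF measurable_snd]
            measurable_compose[OF measurable_fst]) auto
    then show ?thesis by (simp add: borel_prod)
  qed
  have B': "B \<in> sets (lborel \<Otimes>\<^sub>M D)"
    using measurable_sets[OF idm B] by (simp add: space_pair_measure D_def)
  have "emeasure (height_intensity f) B = emeasure (lborel \<Otimes>\<^sub>M D) B"
    unfolding height_intensity_def using idm B B'
    by (simp add: D_def[symmetric] emeasure_distr space_pair_measure) (simp add: D_def)
  also have "\<dots> = (\<integral>\<^sup>+v. \<integral>\<^sup>+h. indicator B (v, h) \<partial>D \<partial>lborel)"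
    using B' by (rule emeasure_pair_measure)
  also have "\<dots> = (\<integral>\<^sup>+v. (\<integral>\<^sup>+h\<in>{0<..}. ennreal (f h) * indicator B (v, h) \<partial>lebesgue) \<partial>lborel)"
  proof (rule nn_integral_cong)
    fix v :: 'a
    have "(\<lambda>h. indicator B (v, h) :: ennreal) \<in> borel_measurable D"
      by (rule measurable_compose[OF measurable_Pair1'[of v lborel] borel_measurable_indicator[OF B']]) simp
    then have "(\<integral>\<^sup>+h. indicator B (v, h) \<partial>D)
        = (\<integral>\<^sup>+h. ennreal (zero_ext f h) * indicator B (v, h) \<partial>lebesgue)"
      unfolding D_def using meas by (subst nn_integral_density) auto
    also have "\<dots> = (\<integral>\<^sup>+h\<in>{0<..}. ennreal (f h) * indicator B (v, h) \<partial>lebesgue)"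
      by (rule nn_integral_cong) (auto simp: zero_ext_def indicator_def)
    finally show "(\<integral>\<^sup>+h. indicator B (v, h) \<partial>D)
        = (\<integral>\<^sup>+h\<in>{0<..}. ennreal (f h) * indicator B (v, h) \<partial>lebesgue)" .
  qed
  finally show ?thesis .
qed


section \<open>Random closed sets\<close>

definition random_closed_set :: "'w measure \<Rightarrow> ('w \<Rightarrow> 'a::euclidean_space set) \<Rightarrow> bool" where
  "random_closed_set M Z \<longleftrightarrow> (\<forall>\<omega>\<in>space M. closed (Z \<omega>)) \<and>
     (\<forall>K. compact K \<longrightarrow> {\<omega>\<in>space M. Z \<omega> \<inter> K \<noteq> {}} \<in> sets M)"

definition converges_locally_whp ::
    "'w measure \<Rightarrow> (nat \<Rightarrow> 'w \<Rightarrow> 'a::euclidean_space set) \<Rightarrow> ('w \<Rightarrow> 'a set) \<Rightarrow> bool" where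
  "converges_locally_whp M Zn Z \<longleftrightarrow>
     (\<forall>n. random_closed_set M (Zn n)) \<and> random_closed_set M Z \<and>
     (\<forall>R>0. (\<lambda>n. measure M {\<omega>\<in>space M. Zn n \<omega> \<inter> cball 0 R \<noteq> Z \<omega> \<inter> cball 0 R}) \<longlonglongrightarrow> 0)"

text \<open>
  The condition that the infimum of \<open>norm (z - x)\<close> over \<open>x \<in> F\<close> is less than \<open>\<epsilon>\<close> is spelled out with a witness, so that the neighbourhood of the
  empty set is empty (\<^const>\<open>infdist\<close> would give distance 0 there).
\<close>

definition open_nbhd :: "real \<Rightarrow> 'a::euclidean_space set \<Rightarrow> 'a set" where
  "open_nbhd \<epsilon> F = {z. \<exists>x\<in>F. norm (z - x) < \<epsilon>}"

definition converges_in_prob ::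
    "'w measure \<Rightarrow> (nat \<Rightarrow> 'w \<Rightarrow> 'a::euclidean_space set) \<Rightarrow> ('w \<Rightarrow> 'a set) \<Rightarrow> bool" where
  "converges_in_prob M Zn Z \<longleftrightarrow>
     (\<forall>n. random_closed_set M (Zn n)) \<and> random_closed_set M Z \<and>
     (\<forall>\<epsilon>>0. \<forall>C. compact C \<longrightarrow>
        (\<lambda>n. measure M {\<omega>\<in>space M.
           ((Zn n \<omega> - open_nbhd \<epsilon> (Z \<omega>)) \<union> (Z \<omega> - open_nbhd \<epsilon> (Zn n \<omega>))) \<inter> C \<noteq> {}}) \<longlonglongrightarrow> 0)"

end

theory Submission
  imports Defs "HOL-Combinatorics.Multiset_Permutations"
begin

text \<open>
  All processes are built from one Poisson process \<open>\<xi>\<close> of unit intensity on points \<open>(v, u)\<close> with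
  \<open>u > 0\<close>. Its points with \<open>u < \<gamma>\<close>, projected to \<open>v\<close>, form a Poisson process of intensity \<open>\<gamma>\<close>;
  replacing \<open>u\<close> by the generalised inverse of \<open>I1 (f n)\<close> at \<open>u\<close> (and dropping the points for which it
  is infinite) gives a Poisson process with density \<open>f n\<close>. Since \<open>I1 (f n)\<close> tends to \<open>\<gamma>\<close> on the
  positive reals, the heights of the points with \<open>u < \<gamma>\<close> tend to 0 and those of the points with
  \<open>u > \<gamma>\<close> tend to infinity, for almost every realisation of \<open>\<xi>\<close>. The rest is deterministic: the points of
  the Poisson-Voronoi process are spread in all directions, so only finitely many of them matter in a
  bounded window; a simplex of the perturbed diagram has a limiting circumcentre, and conversely a
  Delaunay simplex survives small perturbations because the points are in general position.
\<close>

section \<open>Poisson processes through their joint counts\<close>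

text \<open>The two modes of convergence differ because a dual simplex depends only on the sites of
  its points: once the simplices near a window agree combinatorially their boundaries coincide,
  whereas cell walls move with the heights. \<open>random_closed_set\<close> demands closedness for
  every outcome, so almost sure properties are not enough. The exceptional null set is therefore
  redirected to one good sample; from then on all arguments concern a single outcome, and
  convergence of probabilities follows from statements that eventually hold at each outcome. The
  given processes live on arbitrary spaces. Joint counts determine their laws, so any construction
  with the right counts may replace them, and the coupling can be chosen freely. The hypothesis
  controls \<open>I1 (f n)\<close> at single arguments and says nothing about \<open>f n\<close>
  itself; quantiles express the heights through \<open>I1 (f n)\<close> alone. The level \<gamma> is
  critical: a point there could sink, escape or oscillate, so it has to be avoided.\<close>

text \<open>Unlike \<^const>\<open>poisson_pmf\<close>, the rate may vanish.\<close>

definition pois :: "real \<Rightarrow> nat pmf" where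
  "pois a = (if a > 0 then poisson_pmf a else return_pmf 0)"

lemma pmf_pois:
  assumes "0 \<le> a"
  shows "pmf (pois a) k = a ^ k / fact k * exp (- a)"
  using assms by (cases "a = 0") (auto simp: pois_def pmf_return indicator_def power_0_left)

text \<open>A finite product of countable discrete spaces is again countable and discrete, so a law
  on it is determined by its singletons, where the hypothesis already has product form.\<close>

lemma (in prob_space) distr_eq_PiM_pmf:
  fixes X :: "'i \<Rightarrow> 'a \<Rightarrow> 'b::countable" and p :: "'i \<Rightarrow> 'b pmf"
  assumes fin: "finite I"
    and X: "\<And>i. i \<in> I \<Longrightarrow> X i \<in> measurable M (count_space UNIV)"
    and joint: "\<And>k. k \<in> PiE I (\<lambda>_. UNIV) \<Longrightarrow>
       prob {x\<in>space M. \<forall>i\<in>I. X i x = k i} = (\<Prod>i\<in>I. pmf (p i) (k i))"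
  shows "distr M (PiM I (\<lambda>_. count_space UNIV)) (\<lambda>x. \<lambda>i\<in>I. X i x) = PiM I (\<lambda>i. measure_pmf (p i))"
    (is "?L = ?R")
proof (rule measure_eqI_countable')
  have sets_eq: "sets (PiM I (\<lambda>i. measure_pmf (p i))) = sets (PiM I (\<lambda>_. count_space UNIV))"
    by (rule sets_PiM_cong) auto
  have cs: "PiM I (\<lambda>_. count_space UNIV) = (count_space (PiE I (\<lambda>_. UNIV)) :: ('i \<Rightarrow> 'b) measure)"
    by (rule count_space_PiM_finite) (use fin in auto)
  show "space ?L = PiE I (\<lambda>_. UNIV)" by (simp add: space_PiM)
  show "space ?R = PiE I (\<lambda>_. UNIV)" by (simp add: space_PiM)
  show "countable (PiE I (\<lambda>_. UNIV) :: ('i \<Rightarrow> 'b) set)" by (rule countable_PiE) (use fin in auto)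
  fix k :: "'i \<Rightarrow> 'b" assume k: "k \<in> PiE I (\<lambda>_. UNIV)"
  show "{k} \<in> sets ?L" using k by (simp add: cs)
  show "{k} \<in> sets ?R" using k by (simp add: sets_eq cs)
  have m: "(\<lambda>x. \<lambda>i\<in>I. X i x) \<in> measurable M (PiM I (\<lambda>_. count_space UNIV))"
    using X by (intro measurable_restrict)
  have "emeasure ?L {k} = emeasure M ((\<lambda>x. \<lambda>i\<in>I. X i x) -` {k} \<inter> space M)"
    using m k by (intro emeasure_distr) (auto simp: cs)
  also have "(\<lambda>x. \<lambda>i\<in>I. X i x) -` {k} \<inter> space M = {x\<in>space M. \<forall>i\<in>I. X i x = k i}"
    using k by (fastforce simp: PiE_def extensional_def restrict_def fun_eq_iff)
  also have "emeasure M \<dots> = ennreal (\<Prod>i\<in>I. pmf (p i) (k i))"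
    by (simp add: emeasure_eq_measure joint[OF k])
  also have "\<dots> = (\<Prod>i\<in>I. emeasure (measure_pmf (p i)) {k i})"
    by (simp add: emeasure_pmf_single prod_ennreal)
  also have "\<dots> = emeasure ?R (PiE I (\<lambda>i. {k i}))"
  proof -
    interpret product_prob_space "\<lambda>i. measure_pmf (p i)" I
      by (intro product_prob_spaceI measure_pmf.prob_space_axioms)
    show ?thesis using fin by (subst emeasure_PiM) auto
  qed
  also have "PiE I (\<lambda>i. {k i}) = {k}" using k by (intro PiE_singleton) (auto simp: PiE_def)
  finally show "emeasure ?L {k} = emeasure ?R {k}" .
qed

text \<open>The \<open>p i\<close> are not assumed to be the marginal laws. They turn out to be,
  because projecting the product measure to one coordinate integrates out the other factors, each of
  total mass 1.\<close>

lemma (in prob_space) indep_vars_of_joint_pmf: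
  fixes X :: "'i \<Rightarrow> 'a \<Rightarrow> 'b::countable" and p :: "'i \<Rightarrow> 'b pmf"
  assumes fin: "finite I"
    and X: "\<And>i. i \<in> I \<Longrightarrow> X i \<in> measurable M (count_space UNIV)"
    and joint: "\<And>k. k \<in> PiE I (\<lambda>_. UNIV) \<Longrightarrow>
       prob {x\<in>space M. \<forall>i\<in>I. X i x = k i} = (\<Prod>i\<in>I. pmf (p i) (k i))"
  shows "indep_vars (\<lambda>_. count_space UNIV) X I"
    and "\<And>i. i \<in> I \<Longrightarrow> distr M (count_space UNIV) (X i) = measure_pmf (p i)"
proof -
  note eq = distr_eq_PiM_pmf[OF fin X joint]
  have m: "(\<lambda>x. \<lambda>i\<in>I. X i x) \<in> measurable M (PiM I (\<lambda>_. count_space UNIV))"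
    using X by (intro measurable_restrict)
  show marg: "distr M (count_space UNIV) (X i) = measure_pmf (p i)" if i: "i \<in> I" for i
  proof -
    have "distr M (count_space UNIV) (X i) =
        distr (distr M (PiM I (\<lambda>_. count_space UNIV)) (\<lambda>x. \<lambda>i\<in>I. X i x)) (count_space UNIV) (\<lambda>f. f i)"
      using i m by (subst distr_distr) (auto simp: o_def)
    also have "\<dots> = distr (PiM I (\<lambda>i. measure_pmf (p i))) (measure_pmf (p i)) (\<lambda>f. f i)"
      by (rule distr_cong) (auto simp: eq)
    also have "\<dots> = measure_pmf (p i)" using i
      by (intro product_prob_space.PiM_component product_prob_spaceI measure_pmf.prob_space_axioms)
    finally show ?thesis .
  qed
  show "indep_vars (\<lambda>_. count_space UNIV) X I"
  proof (cases "I = {}")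
    case True then show ?thesis by (simp add: indep_vars_def indep_sets_def)
  next
    case False
    have "PiM I (\<lambda>i. distr M (count_space UNIV) (X i)) = PiM I (\<lambda>i. measure_pmf (p i))"
      by (rule PiM_cong) (auto simp: marg)
    then show ?thesis
      using eq X by (subst indep_vars_iff_distr_eq_PiM'[OF False]) auto
  qed
qed

section \<open>Laws of random configurations\<close>

lemma card_measurable_config_space:
  assumes "B \<in> sets borel" "bounded B"
  shows "(\<lambda>A. card (A \<inter> B)) \<in> measurable config_space (count_space UNIV)"
proof (rule measurable_count_space_eq2_countable[THEN iffD2], intro conjI ballI)
  have sub: "{{A. locally_finite_set A \<and> card (A \<inter> B) = k} | B k. B \<in> sets borel \<and> bounded B}
    \<subseteq> Pow {A. locally_finite_set A}" by auto
  fix k :: nat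
  have "(\<lambda>A. card (A \<inter> B)) -` {k} \<inter> space config_space = {A. locally_finite_set A \<and> card (A \<inter> B) = k}"
    using sub by (auto simp: config_space_def space_measure_of_conv)
  then show "(\<lambda>A. card (A \<inter> B)) -` {k} \<inter> space config_space \<in> sets config_space"
    using assms sub by (auto simp: config_space_def)
qed auto

lemma space_config_space: "space config_space = {A. locally_finite_set A}"
  by (auto simp: config_space_def space_measure_of_conv)

lemma measurable_config_spaceI:
  fixes \<eta> :: "'w \<Rightarrow> 'e::euclidean_space set"
  assumes "\<And>x. x \<in> space M \<Longrightarrow> locally_finite_set (\<eta> x)"
    and "\<And>B. B \<in> sets borel \<Longrightarrow> bounded B \<Longrightarrow> (\<lambda>x. card (\<eta> x \<inter> B)) \<in> measurable M (count_space UNIV)"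
  shows "\<eta> \<in> measurable M config_space"
  unfolding config_space_def
proof (rule measurable_measure_of)
  show "{{A. locally_finite_set A \<and> card (A \<inter> B) = k} | B k. B \<in> sets borel \<and> bounded B}
    \<subseteq> Pow {A :: 'e set. locally_finite_set A}" by auto
  show "\<eta> \<in> space M \<rightarrow> {A. locally_finite_set A}" using assms by auto
  fix y assume "y \<in> {{A :: 'e set. locally_finite_set A \<and> card (A \<inter> B) = k} | B k. B \<in> sets borel \<and> bounded B}"
  then obtain B k where y: "y = {A. locally_finite_set A \<and> card (A \<inter> B) = k}" "B \<in> sets borel" "bounded B"
    by auto
  have "\<eta> -` y \<inter> space M = (\<lambda>x. card (\<eta> x \<inter> B)) -` {k} \<inter> space M" using assms(1) y by auto
  then show "\<eta> -` y \<inter> space M \<in> sets M" using assms(2)[OF y(2,3)] by (simp add: measurable_sets)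
qed

text \<open>A single formula for joint counts carries both defining conditions: taking one set gives
  the Poisson marginals, and the factorisation gives independence.\<close>

lemma poisson_processI:
  assumes M: "prob_space M"
    and lf: "\<And>x. x \<in> space M \<Longrightarrow> locally_finite_set (\<eta> x)"
    and cm: "\<And>B. B \<in> sets borel \<Longrightarrow> bounded B \<Longrightarrow> (\<lambda>x. card (\<eta> x \<inter> B)) \<in> measurable M (count_space UNIV)"
    and joint: "\<And>(m::nat) B k. (\<And>i. i < m \<Longrightarrow> B i \<in> sets borel \<and> bounded (B i)) \<Longrightarrow> disjoint_family_on B {..<m} \<Longrightarrow>
      measure M {x\<in>space M. \<forall>i<m. card (\<eta> x \<inter> B i) = k i} = (\<Prod>i<m. pmf (pois (measure \<Lambda> (B i))) (k i))"
  shows "poisson_process M \<Lambda> \<eta>"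
  unfolding poisson_process_def point_process_def
proof (intro conjI M measurable_config_spaceI lf cm ballI allI impI; (elim conjE)?)
  interpret prob_space M by fact
  fix B :: "'b set" and k :: nat assume "B \<in> sets borel" "bounded B"
  then show "measure M {\<omega> \<in> space M. card (\<eta> \<omega> \<inter> B) = k} = measure \<Lambda> B ^ k / fact k * exp (- measure \<Lambda> B)"
    using joint[of 1 "\<lambda>_. B" "\<lambda>_. k"] by (simp add: pmf_pois disjoint_family_on_def)
next
  interpret prob_space M by fact
  fix m :: nat and B :: "nat \<Rightarrow> 'b set" assume B: "\<forall>i<m. B i \<in> sets borel \<and> bounded (B i)" "disjoint_family_on B {..<m}"
  show "indep_vars (\<lambda>_. count_space UNIV) (\<lambda>i \<omega>. card (\<eta> \<omega> \<inter> B i)) {..<m}"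
    by (rule indep_vars_of_joint_pmf(1)[where p="\<lambda>i. pois (measure \<Lambda> (B i))"])
      (use joint[of m B] B cm in \<open>auto simp: Ball_def\<close>)
qed

lemma poisson_processD:
  assumes "poisson_process M \<Lambda> \<eta>"
  shows "prob_space M" "\<eta> \<in> measurable M config_space" "x \<in> space M \<Longrightarrow> locally_finite_set (\<eta> x)"
    "B \<in> sets borel \<Longrightarrow> bounded B \<Longrightarrow> (\<lambda>x. card (\<eta> x \<inter> B)) \<in> measurable M (count_space UNIV)"
proof -
  show *: "prob_space M" "\<eta> \<in> measurable M config_space"
    using assms by (auto simp: poisson_process_def point_process_def)
  show "x \<in> space M \<Longrightarrow> locally_finite_set (\<eta> x)"
    using measurable_space[OF *(2)] by (auto simp: space_config_space)
  show "B \<in> sets borel \<Longrightarrow> bounded B \<Longrightarrow> (\<lambda>x. card (\<eta> x \<inter> B)) \<in> measurable M (count_space UNIV)"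
    by (rule measurable_compose[OF *(2) card_measurable_config_space])
qed

lemma poisson_process_joint:
  assumes \<eta>: "poisson_process M \<Lambda> \<eta>"
    and B: "\<And>i. i < m \<Longrightarrow> B i \<in> sets borel \<and> bounded (B i)" "disjoint_family_on B {..<m::nat}"
  shows "measure M {x\<in>space M. \<forall>i<m. card (\<eta> x \<inter> B i) = k i} = (\<Prod>i<m. pmf (pois (measure \<Lambda> (B i))) (k i))"
proof -
  interpret prob_space M using \<eta> by (rule poisson_processD)
  show ?thesis
  proof (cases "m = 0")
    case True then show ?thesis by (simp add: prob_space)
  next
    case False
    have ind: "indep_vars (\<lambda>_. count_space UNIV) (\<lambda>i \<omega>. card (\<eta> \<omega> \<inter> B i)) {..<m}"
      using \<eta> B unfolding poisson_process_def by blast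
    have "prob (\<Inter>i\<in>{..<m}. (\<lambda>\<omega>. card (\<eta> \<omega> \<inter> B i)) -` {k i} \<inter> space M)
        = (\<Prod>i<m. prob ((\<lambda>\<omega>. card (\<eta> \<omega> \<inter> B i)) -` {k i} \<inter> space M))"
      by (rule indep_varsD_finite[OF ind]) (use False in auto)
    also have "(\<Inter>i\<in>{..<m}. (\<lambda>\<omega>. card (\<eta> \<omega> \<inter> B i)) -` {k i} \<inter> space M)
        = {x\<in>space M. \<forall>i<m. card (\<eta> x \<inter> B i) = k i}" using False by auto
    also have "(\<Prod>i<m. prob ((\<lambda>\<omega>. card (\<eta> \<omega> \<inter> B i)) -` {k i} \<inter> space M))
        = (\<Prod>i<m. pmf (pois (measure \<Lambda> (B i))) (k i))"
    proof (rule prod.cong[OF refl])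
      fix i assume i: "i \<in> {..<m}"
      have "(\<lambda>\<omega>. card (\<eta> \<omega> \<inter> B i)) -` {k i} \<inter> space M = {\<omega>\<in>space M. card (\<eta> \<omega> \<inter> B i) = k i}" by auto
      then show "prob ((\<lambda>\<omega>. card (\<eta> \<omega> \<inter> B i)) -` {k i} \<inter> space M) = pmf (pois (measure \<Lambda> (B i))) (k i)"
        using \<eta> B(1) i unfolding poisson_process_def by (simp add: pmf_pois)
    qed
    finally show ?thesis .
  qed
qed

text \<open>Indexing by the sets themselves suits \<open>ex_disjoint_refinement\<close>, which
  delivers parts without an enumeration.\<close>

lemma poisson_process_joint_set:
  assumes \<eta>: "poisson_process M \<Lambda> \<eta>"
    and C: "finite \<C>" "disjoint \<C>" "\<And>C. C \<in> \<C> \<Longrightarrow> C \<in> sets borel \<and> bounded C"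
  shows "measure M {x\<in>space M. \<forall>C\<in>\<C>. card (\<eta> x \<inter> C) = k C} = (\<Prod>C\<in>\<C>. pmf (pois (measure \<Lambda> C)) (k C))"
proof -
  obtain B where B: "bij_betw B {..<card \<C>} \<C>"
    using ex_bij_betw_nat_finite[OF C(1)] by (auto simp: atLeast0LessThan)
  have im: "B ` {..<card \<C>} = \<C>" using B by (simp add: bij_betw_def)
  have "disjoint_family_on B {..<card \<C>}"
    unfolding disjoint_family_on_def
  proof (intro ballI impI)
    fix i j assume ij: "i \<in> {..<card \<C>}" "j \<in> {..<card \<C>}" "i \<noteq> j"
    then have "B i \<noteq> B j" using B by (auto simp: bij_betw_def dest: inj_onD)
    then show "B i \<inter> B j = {}" using ij(1,2) im by (intro disjointD[OF C(2)]) auto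
  qed
  then have "measure M {x\<in>space M. \<forall>i<card \<C>. card (\<eta> x \<inter> B i) = k (B i)}
      = (\<Prod>i<card \<C>. pmf (pois (measure \<Lambda> (B i))) (k (B i)))"
    using C(3) im by (intro poisson_process_joint[OF \<eta>]) auto
  also have "\<dots> = (\<Prod>C\<in>\<C>. pmf (pois (measure \<Lambda> C)) (k C))"
    by (rule prod.reindex_bij_betw[OF B])
  also have "{x\<in>space M. \<forall>i<card \<C>. card (\<eta> x \<inter> B i) = k (B i)} = {x\<in>space M. \<forall>C\<in>\<C>. card (\<eta> x \<inter> C) = k C}"
    by (subst im[symmetric]) auto
  finally show ?thesis .
qed

text \<open>The parts are the atoms of the finite algebra generated by \<B>: the points lying in
  exactly the members of \<open>s\<close>. The choice \<open>s = {}\<close> is excluded, so that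
  each atom lies inside some member and inherits its boundedness.\<close>

lemma ex_disjoint_refinement:
  assumes "finite \<B>" "\<And>B. B \<in> \<B> \<Longrightarrow> B \<in> sets borel \<and> bounded B"
  obtains \<C> :: "'e::euclidean_space set set" where "finite \<C>" "disjoint \<C>" "\<And>C. C \<in> \<C> \<Longrightarrow> C \<in> sets borel \<and> bounded C"
    "\<And>B. B \<in> \<B> \<Longrightarrow> B = \<Union>{C\<in>\<C>. C \<subseteq> B}"
proof
  define atom where "atom s = \<Inter>s - \<Union>(\<B> - s)" for s :: "'e set set"
  let ?C = "atom ` (Pow \<B> - {{}})"
  show "finite ?C" using assms(1) by simp
  have "atom s \<inter> atom t = {}" if st: "s \<subseteq> \<B>" "t \<subseteq> \<B>" "s \<noteq> t" for s t
  proof -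
    obtain B where "B \<in> s \<and> B \<in> \<B> - t \<or> B \<in> t \<and> B \<in> \<B> - s" using st by blast
    then show ?thesis by (auto simp: atom_def)
  qed
  note dis = this
  show "disjoint ?C"
    unfolding disjoint_def
  proof (intro ballI impI)
    fix C D assume "C \<in> ?C" "D \<in> ?C" "C \<noteq> D"
    then obtain s t where "s \<subseteq> \<B>" "t \<subseteq> \<B>" "C = atom s" "D = atom t" by auto
    then show "C \<inter> D = {}" using dis[of s t] \<open>C \<noteq> D\<close> by auto
  qed
  fix C assume "C \<in> ?C"
  then obtain s where s: "s \<subseteq> \<B>" "s \<noteq> {}" "C = atom s" by auto
  then obtain B where "B \<in> s" by auto
  have fs: "finite s" using s(1) assms(1) by (rule finite_subset)
  have "(\<Inter>B\<in>s. B) \<in> sets borel" using fs s assms(2) by (intro sets.finite_INT) auto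
  then have "\<Inter>s \<in> sets borel" by simp
  moreover have "\<Union>(\<B> - s) \<in> sets borel" using assms by (intro sets.finite_Union) auto
  ultimately have "C \<in> sets borel" unfolding s(3) atom_def by (rule sets.Diff)
  moreover have "C \<subseteq> B" using \<open>B \<in> s\<close> unfolding s(3) atom_def by auto
  then have "bounded C" using assms(2)[of B] \<open>B \<in> s\<close> s(1) bounded_subset by blast
  ultimately show "C \<in> sets borel \<and> bounded C" by blast
next
  define atom where "atom s = \<Inter>s - \<Union>(\<B> - s)" for s :: "'e set set"
  fix B assume B: "B \<in> \<B>"
  have "x \<in> \<Union>{C \<in> atom ` (Pow \<B> - {{}}). C \<subseteq> B}" if "x \<in> B" for x
  proof -
    have "x \<in> atom {B\<in>\<B>. x \<in> B}" by (auto simp: atom_def)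
    moreover have "atom {B\<in>\<B>. x \<in> B} \<subseteq> B" "{B\<in>\<B>. x \<in> B} \<in> Pow \<B> - {{}}"
      using B that by (auto simp: atom_def)
    ultimately show ?thesis by blast
  qed
  then show "B = \<Union>{C \<in> (\<lambda>s. \<Inter>s - \<Union>(\<B> - s)) ` (Pow \<B> - {{}}). C \<subseteq> B}"
    unfolding atom_def by blast
qed

text \<open>Events fixing one count generate the \<sigma>-algebra but are not stable under
  intersection; the events \<open>ev J\<close>, which fix finitely many counts, are. The sets in
  \<open>J\<close> may overlap, so their joint law is read off from the independent counts on the
  atoms of a refinement.\<close>

theorem poisson_process_unique:
  fixes \<eta> :: "'w \<Rightarrow> 'e::euclidean_space set" and \<eta>' :: "'v \<Rightarrow> 'e set"
  assumes 1: "poisson_process M \<Lambda> \<eta>" and 2: "poisson_process N \<Lambda> \<eta>'"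
  shows "distr M config_space \<eta> = distr N config_space \<eta>'"
proof -
  define ev :: "('e set \<times> nat) set \<Rightarrow> 'e set set"
    where "ev J = {A. locally_finite_set A \<and> (\<forall>p\<in>J. card (A \<inter> fst p) = snd p)}" for J
  define ok :: "('e set \<times> nat) set \<Rightarrow> bool"
    where "ok J \<longleftrightarrow> finite J \<and> (\<forall>p\<in>J. fst p \<in> sets borel \<and> bounded (fst p))" for J
  define E where "E = {ev J | J. ok J}"
  let ?\<Omega> = "{A :: 'e set. locally_finite_set A}"
  let ?G = "{{A::'e set. locally_finite_set A \<and> card (A \<inter> B) = k} | B k. B \<in> sets borel \<and> bounded B}"
  have subG: "?G \<subseteq> Pow ?\<Omega>" by auto
  have GE: "?G \<subseteq> E"
  proof
    fix X assume "X \<in> ?G"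
    then obtain B k where "X = {A. locally_finite_set A \<and> card (A \<inter> B) = k}" "B \<in> sets borel" "bounded B"
      by auto
    then have "X = ev {(B, k)}" "ok {(B, k)}" by (auto simp: ev_def ok_def)
    then show "X \<in> E" by (auto simp: E_def)
  qed
  have ev_eq: "ev J = {A\<in>space config_space. \<forall>p\<in>J. card (A \<inter> fst p) = snd p}" for J
    by (auto simp: ev_def space_config_space)
  have ev_sets: "ev J \<in> sets config_space" if "ok J" for J
  proof -
    have "(\<lambda>A. card (A \<inter> fst p)) -` {snd p} \<inter> space config_space \<in> sets config_space" if "p \<in> J" for p
      using that \<open>ok J\<close> by (intro measurable_sets[OF card_measurable_config_space]) (auto simp: ok_def)
    then have "{A\<in>space config_space. card (A \<inter> fst p) = snd p} \<in> sets config_space" if "p \<in> J" for p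
      using that by (simp add: vimage_def Int_def conj_commute)
    then show ?thesis unfolding ev_eq using \<open>ok J\<close>
      by (intro sets.sets_Collect_finite_All) (auto simp: ok_def)
  qed
  have sets_eq: "sets config_space = sigma_sets ?\<Omega> E"
  proof (rule antisym)
    show "sets config_space \<subseteq> sigma_sets ?\<Omega> E"
      unfolding config_space_def using subG GE by (simp add: sigma_sets_mono')
    show "sigma_sets ?\<Omega> E \<subseteq> sets config_space"
      unfolding space_config_space[symmetric]
      by (rule sets.sigma_sets_subset) (auto simp: E_def ev_sets)
  qed
  \<comment> \<open>The same \<C> and \<open>K\<close> must serve both processes. As
    \<open>M\<close> and \<eta> are bound below these existential quantifiers, their types are fixed
    there, so each sample-space type gets its own conjunct.\<close>
  have law: "\<exists>\<C> K. finite \<C> \<and> K \<in> sets (PiM \<C> (\<lambda>_. count_space UNIV)) \<and>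
     (\<forall>(M::'w measure) \<eta>. poisson_process M \<Lambda> \<eta> \<longrightarrow>
       emeasure (distr M config_space \<eta>) (ev J) = emeasure (PiM \<C> (\<lambda>C. measure_pmf (pois (measure \<Lambda> C)))) K) \<and>
     (\<forall>(M::'v measure) \<eta>. poisson_process M \<Lambda> \<eta> \<longrightarrow>
       emeasure (distr M config_space \<eta>) (ev J) = emeasure (PiM \<C> (\<lambda>C. measure_pmf (pois (measure \<Lambda> C)))) K)"
    if J: "ok J" for J
  proof -
    obtain \<C> :: "'e set set" where C: "finite \<C>" "disjoint \<C>" "\<And>C. C \<in> \<C> \<Longrightarrow> C \<in> sets borel \<and> bounded C"
      "\<And>B. B \<in> fst ` J \<Longrightarrow> B = \<Union>{C\<in>\<C>. C \<subseteq> B}"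
      by (rule ex_disjoint_refinement[of "fst ` J"]) (use J in \<open>auto simp: ok_def\<close>)
    define K where "K = {c \<in> PiE \<C> (\<lambda>_. UNIV). \<forall>p\<in>J. (\<Sum>C\<in>{C\<in>\<C>. C \<subseteq> fst p}. c C) = snd p}"
    have cs: "PiM \<C> (\<lambda>_. count_space UNIV) = (count_space (PiE \<C> (\<lambda>_. UNIV)) :: ('e set \<Rightarrow> nat) measure)"
      by (rule count_space_PiM_finite) (use C(1) in auto)
    have K: "K \<in> sets (PiM \<C> (\<lambda>_. count_space UNIV))" by (auto simp: cs K_def)
    have "emeasure (distr M config_space \<eta>) (ev J) = emeasure (PiM \<C> (\<lambda>C. measure_pmf (pois (measure \<Lambda> C)))) K"
      if \<eta>: "poisson_process M \<Lambda> \<eta>" for M :: "'z measure" and \<eta>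
    proof -
      interpret prob_space M using \<eta> by (rule poisson_processD)
      let ?X = "\<lambda>x. \<lambda>C\<in>\<C>. card (\<eta> x \<inter> C)"
      have m: "?X \<in> measurable M (PiM \<C> (\<lambda>_. count_space UNIV))"
        using C(3) by (intro measurable_restrict poisson_processD(4)[OF \<eta>]) auto
      have "emeasure (distr M config_space \<eta>) (ev J) = emeasure M (\<eta> -` ev J \<inter> space M)"
        by (rule emeasure_distr[OF poisson_processD(2)[OF \<eta>] ev_sets[OF J]])
      also have "\<eta> -` ev J \<inter> space M = ?X -` K \<inter> space M"
      proof -
        have "card (\<eta> x \<inter> B) = (\<Sum>C\<in>{C\<in>\<C>. C \<subseteq> B}. card (\<eta> x \<inter> C))" if x: "x \<in> space M" and "B \<in> fst ` J" for x B
        proof -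
          have "B = \<Union>{C\<in>\<C>. C \<subseteq> B}" using C(4)[of B] that by blast
          then have "\<eta> x \<inter> B = (\<Union>C\<in>{C\<in>\<C>. C \<subseteq> B}. \<eta> x \<inter> C)" by blast
          also have "card \<dots> = (\<Sum>C\<in>{C\<in>\<C>. C \<subseteq> B}. card (\<eta> x \<inter> C))"
            using C(1,2,3) poisson_processD(3)[OF \<eta> x]
            by (intro card_UN_disjoint) (auto simp: disjoint_def locally_finite_set_def)
          finally show ?thesis .
        qed
        then have *: "card (\<eta> x \<inter> fst p) = (\<Sum>C\<in>{C\<in>\<C>. C \<subseteq> fst p}. card (\<eta> x \<inter> C))" if "x \<in> space M" "p \<in> J" for x p
          using that by blast
        have "\<eta> x \<in> ev J \<longleftrightarrow> ?X x \<in> K" if x: "x \<in> space M" for x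
        proof -
          have "(\<Sum>C\<in>{C\<in>\<C>. C \<subseteq> fst p}. ?X x C) = card (\<eta> x \<inter> fst p)" if "p \<in> J" for p
            unfolding *[OF x that] by (rule sum.cong) auto
          moreover have "?X x \<in> PiE \<C> (\<lambda>_. UNIV)" by simp
          ultimately show ?thesis
            using poisson_processD(3)[OF \<eta> x]
            unfolding ev_def K_def mem_Collect_eq by (simp only: simp_thms cong: ball_cong)
        qed
        then show ?thesis by auto
      qed
      also have "emeasure M (?X -` K \<inter> space M) = emeasure (distr M (PiM \<C> (\<lambda>_. count_space UNIV)) ?X) K"
        using m K by (simp add: emeasure_distr)
      also have "distr M (PiM \<C> (\<lambda>_. count_space UNIV)) ?X = PiM \<C> (\<lambda>C. measure_pmf (pois (measure \<Lambda> C)))"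
        using C(3) poisson_process_joint_set[OF \<eta> C(1-3)]
        by (intro distr_eq_PiM_pmf C(1) poisson_processD(4)[OF \<eta>]) auto
      finally show ?thesis .
    qed
    note res = this
    show ?thesis by (intro exI[of _ \<C>] exI[of _ K] conjI allI impI C(1) K res)
  qed
  show ?thesis
  proof (rule measure_eqI_generator_eq[of E ?\<Omega> _ _ "\<lambda>_. ?\<Omega>"])
    have "ev J \<inter> ev J' = ev (J \<union> J')" for J J'
      unfolding ev_def ball_Un by blast
    moreover have "ok J \<Longrightarrow> ok J' \<Longrightarrow> ok (J \<union> J')" for J J'
      unfolding ok_def ball_Un by blast
    ultimately show "Int_stable E" unfolding Int_stable_def E_def by blast
    show "E \<subseteq> Pow ?\<Omega>" by (auto simp: E_def ev_def)
    show "range (\<lambda>_. ?\<Omega>) \<subseteq> E"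
    proof -
      have "?\<Omega> = ev {}" "ok {}" by (auto simp: ev_def ok_def)
      then show ?thesis unfolding E_def by blast
    qed
    interpret M: prob_space M using 1 by (rule poisson_processD)
    interpret D: prob_space "distr M config_space \<eta>"
      by (rule M.prob_space_distr[OF poisson_processD(2)[OF 1]])
    show "emeasure (distr M config_space \<eta>) ?\<Omega> \<noteq> \<infinity>" by simp
    fix X assume "X \<in> E"
    then obtain J where "X = ev J" "ok J" by (auto simp: E_def)
    then show "emeasure (distr M config_space \<eta>) X = emeasure (distr N config_space \<eta>') X"
      using law 1 2 by metis
  qed (auto simp: sets_eq)
qed

text \<open>Counts of the image are counts of \<xi> on preimages as long as no two points of one
  realisation are identified. Injectivity is asked of realisations only, because a projection such
  as \<open>fst\<close> is far from injective on \<open>D\<close>.\<close>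

lemma poisson_process_map:
  fixes T :: "'e::euclidean_space \<Rightarrow> 'f::euclidean_space"
  assumes \<xi>: "poisson_process M \<Lambda> \<xi>"
    and D: "\<And>B. B \<in> sets borel \<Longrightarrow> bounded B \<Longrightarrow>
      D \<inter> T -` B \<in> sets borel \<and> bounded (D \<inter> T -` B) \<and> measure \<Lambda>' B = measure \<Lambda> (D \<inter> T -` B)"
    and inj: "\<And>x. x \<in> space M \<Longrightarrow> inj_on T (\<xi> x \<inter> D)"
  shows "poisson_process M \<Lambda>' (\<lambda>x. T ` (\<xi> x \<inter> D))"
proof -
  have eq: "T ` (\<xi> x \<inter> D) \<inter> B = T ` (\<xi> x \<inter> (D \<inter> T -` B))" for x B by auto
  have card: "card (T ` (\<xi> x \<inter> D) \<inter> B) = card (\<xi> x \<inter> (D \<inter> T -` B))" if "x \<in> space M" for x B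
    unfolding eq by (rule card_image, rule inj_on_subset[OF inj[OF that]]) auto
  show ?thesis
  proof (rule poisson_processI)
    show "prob_space M" using \<xi> by (rule poisson_processD)
    show "locally_finite_set (T ` (\<xi> x \<inter> D))" if "x \<in> space M" for x
      unfolding locally_finite_set_def
    proof (intro allI impI)
      fix B :: "'f set" assume "bounded B"
      \<comment> \<open>The preimage hypothesis speaks of Borel sets, so an arbitrary bounded set is
        first enlarged to a ball.\<close>
      then obtain r where r: "B \<subseteq> cball 0 r" using bounded_subset_ballD[of B 0] ball_subset_cball by blast
      have "finite (\<xi> x \<inter> (D \<inter> T -` cball 0 r))"
        using poisson_processD(3)[OF \<xi> that] D[of "cball 0 r"] by (auto simp: locally_finite_set_def)
      then have "finite (T ` (\<xi> x \<inter> D) \<inter> cball 0 r)" unfolding eq by (rule finite_imageI)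
      then show "finite (T ` (\<xi> x \<inter> D) \<inter> B)" by (rule rev_finite_subset) (use r in auto)
    qed
    fix B :: "'f set" assume "B \<in> sets borel" "bounded B"
    then have "(\<lambda>x. card (\<xi> x \<inter> (D \<inter> T -` B))) \<in> measurable M (count_space UNIV)"
      using D by (intro poisson_processD(4)[OF \<xi>]) auto
    then show "(\<lambda>x. card (T ` (\<xi> x \<inter> D) \<inter> B)) \<in> measurable M (count_space UNIV)"
      by (subst measurable_cong[OF card])
  next
    fix m :: nat and B :: "nat \<Rightarrow> 'f set" and k
    assume B: "\<And>i. i < m \<Longrightarrow> B i \<in> sets borel \<and> bounded (B i)" "disjoint_family_on B {..<m}"
    have "measure M {x \<in> space M. \<forall>i<m. card (\<xi> x \<inter> (D \<inter> T -` B i)) = k i}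
        = (\<Prod>i<m. pmf (pois (measure \<Lambda> (D \<inter> T -` B i))) (k i))"
      using B D by (intro poisson_process_joint[OF \<xi>]) (auto simp: disjoint_family_on_def)
    also have "\<dots> = (\<Prod>i<m. pmf (pois (measure \<Lambda>' (B i))) (k i))"
      using B D by (intro prod.cong) auto
    also have "{x \<in> space M. \<forall>i<m. card (\<xi> x \<inter> (D \<inter> T -` B i)) = k i}
        = {x \<in> space M. \<forall>i<m. card (T ` (\<xi> x \<inter> D) \<inter> B i) = k i}"
      by (rule Collect_cong, rule conj_cong[OF refl], simp only: card)
    finally show "measure M {x \<in> space M. \<forall>i<m. card (T ` (\<xi> x \<inter> D) \<inter> B i) = k i}
        = (\<Prod>i<m. pmf (pois (measure \<Lambda>' (B i))) (k i))" .
  qed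
qed

section \<open>Thinning and superposition\<close>

text \<open>The convolution sum is a binomial expansion. With \<open>pois\<close>, summands of rate
  0, which arise when a set misses a shell, obey the same formula.\<close>

lemma (in prob_space) prob_sum_pois:
  fixes X :: "'i \<Rightarrow> 'a \<Rightarrow> nat"
  assumes "finite I" "indep_vars (\<lambda>_. count_space UNIV) X I"
    and "\<And>i. i \<in> I \<Longrightarrow> 0 \<le> a i"
    and "\<And>i k. i \<in> I \<Longrightarrow> prob {x\<in>space M. X i x = k} = pmf (pois (a i)) k"
  shows "prob {x\<in>space M. (\<Sum>i\<in>I. X i x) = k} = pmf (pois (\<Sum>i\<in>I. a i)) k"
  using assms
proof (induction I arbitrary: k)
  case empty
  then show ?case by (cases "k = 0") (auto simp: pois_def prob_space)
next
  case (insert i I)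
  let ?S = "\<lambda>x. \<Sum>i\<in>I. X i x"
  have IH: "prob {x\<in>space M. ?S x = k} = pmf (pois (\<Sum>i\<in>I. a i)) k" for k
    using insert.IH indep_vars_subset[OF insert.prems(1)] insert.prems by auto
  have Xm: "X j \<in> measurable M (count_space UNIV)" if "j \<in> insert i I" for j
    using insert.prems(1) that by (auto simp: indep_vars_def)
  have cs: "sets (PiM J (\<lambda>_. count_space UNIV)) = sets (count_space (PiE J (\<lambda>_. UNIV)) :: ('i \<Rightarrow> nat) measure)"
    if "finite J" for J
    by (subst count_space_PiM_finite) (use that in auto)
  have "indep_var (PiM {i} (\<lambda>_. count_space UNIV)) (\<lambda>\<omega>. restrict (\<lambda>j. X j \<omega>) {i})
      (PiM I (\<lambda>_. count_space UNIV)) (\<lambda>\<omega>. restrict (\<lambda>j. X j \<omega>) I)"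
    using insert by (intro indep_var_restrict[OF insert.prems(1)]) auto
  then have ind: "indep_var (count_space UNIV) ((\<lambda>f. f i) \<circ> (\<lambda>\<omega>. restrict (\<lambda>j. X j \<omega>) {i}))
      (count_space UNIV) ((\<lambda>f. \<Sum>j\<in>I. f j) \<circ> (\<lambda>\<omega>. restrict (\<lambda>j. X j \<omega>) I))"
  proof (rule indep_var_compose)
    show "(\<lambda>f. f i) \<in> measurable (PiM {i} (\<lambda>_. count_space UNIV)) (count_space (UNIV :: nat set))"
      by simp
    show "(\<lambda>f. \<Sum>j\<in>I. f j) \<in> measurable (PiM I (\<lambda>_. count_space UNIV)) (count_space (UNIV :: nat set))"
      by (subst measurable_cong_sets[OF cs[OF insert.hyps(1)] refl]) simp
  qed
  have prod: "prob {x\<in>space M. X i x = l \<and> ?S x = s} = pmf (pois (a i)) l * pmf (pois (\<Sum>i\<in>I. a i)) s" for l s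
  proof -
    have "prob ((\<lambda>x. (X i x, ?S x)) -` {(l, s)} \<inter> space M)
        = prob (X i -` {l} \<inter> space M) * prob (?S -` {s} \<inter> space M)"
      using indep_varD[OF ind, of "{l}" "{s}"] by (simp add: o_def cong: sum.cong)
    moreover have "(\<lambda>x. (X i x, ?S x)) -` {(l, s)} \<inter> space M = {x\<in>space M. X i x = l \<and> ?S x = s}"
      "X i -` {l} \<inter> space M = {x\<in>space M. X i x = l}" "?S -` {s} \<inter> space M = {x\<in>space M. ?S x = s}"
      by auto
    ultimately show ?thesis using IH insert.prems(3) by simp
  qed
  have ev: "{x\<in>space M. X i x = l \<and> ?S x = s} \<in> sets M" for l s
  proof -
    have "?S \<in> measurable M (count_space UNIV)"
      using indep_var_rv2[OF ind] by (simp add: o_def cong: sum.cong)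
    then show ?thesis using Xm[of i] by simp
  qed
  define b where "b = (\<Sum>i\<in>I. a i)"
  have b: "0 \<le> b" "0 \<le> a i" using insert.prems(2) by (auto simp: b_def sum_nonneg)
  have "{x\<in>space M. (\<Sum>j\<in>insert i I. X j x) = k} = (\<Union>l\<in>{..k}. {x\<in>space M. X i x = l \<and> ?S x = k - l})"
    using insert.hyps by auto
  also have "prob \<dots> = (\<Sum>l\<le>k. prob {x\<in>space M. X i x = l \<and> ?S x = k - l})"
    using ev by (intro finite_measure_finite_Union) (auto simp: disjoint_family_on_def)
  also have "\<dots> = (\<Sum>l\<le>k. (a i) ^ l / fact l * exp (- a i) * (b ^ (k - l) / fact (k - l) * exp (- b)))"
    using b by (simp add: prod pmf_pois b_def)
  also have "\<dots> = (\<Sum>l\<le>k. of_nat (k choose l) * (a i) ^ l * b ^ (k - l)) / fact k * (exp (- a i) * exp (- b))"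
    unfolding sum_divide_distrib sum_distrib_right
  proof (rule sum.cong[OF refl])
    fix l assume "l \<in> {..k}"
    then have "real (k choose l) = fact k / (fact l * fact (k - l))"
      by (intro binomial_fact) auto
    then show "(a i) ^ l / fact l * exp (- a i) * (b ^ (k - l) / fact (k - l) * exp (- b)) =
        of_nat (k choose l) * (a i) ^ l * b ^ (k - l) / fact k * (exp (- a i) * exp (- b))"
      by simp
  qed
  also have "\<dots> = (a i + b) ^ k / fact k * exp (- (a i + b))"
    by (simp add: binomial_ring exp_add[symmetric])
  finally show ?case using b insert.hyps by (simp add: pmf_pois b_def)
qed

text \<open>The labels of a Poisson number of independent points: the labelled sequences realising
  prescribed counts are the permutations of a multiset.\<close>

lemma prob_label_counts:
  fixes U :: "'e measure" and lab :: "'e \<Rightarrow> nat"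
  assumes U: "prob_space U" and lab: "lab \<in> measurable U (count_space UNIV)"
    and le: "\<And>x. lab x \<le> m" and a: "0 \<le> a"
  defines "u \<equiv> \<lambda>i. measure U (lab -` {i} \<inter> space U)"
  shows "measure (measure_pmf (pois a) \<Otimes>\<^sub>M PiM UNIV (\<lambda>_::nat. U))
     {\<omega>\<in>space (measure_pmf (pois a) \<Otimes>\<^sub>M PiM UNIV (\<lambda>_::nat. U)).
        \<forall>i\<le>m. card {t. t < fst \<omega> \<and> lab (snd \<omega> t) = i} = k i} = (\<Prod>i\<le>m. pmf (pois (a * u i)) (k i))"
proof -
  interpret U: prob_space U by fact
  interpret UU: product_prob_space "\<lambda>_. U" "UNIV :: nat set"
    by (intro product_prob_spaceI U)
  let ?UU = "PiM UNIV (\<lambda>_::nat. U)"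
  define K where "K = (\<Sum>i\<le>m. k i)"
  define A where "A = (\<Sum>i\<le>m. replicate_mset (k i) i)"
  have countA: "count A i = (if i \<le> m then k i else 0)" for i
    by (simp add: A_def count_sum)
  have "size (\<Sum>i\<in>I. replicate_mset (k i) i) = (\<Sum>i\<in>I. k i)" if "finite I" for I
    using that by induction auto
  then have sizeA: "size A = K" by (simp add: A_def K_def)
  define cyl where "cyl xs = {x\<in>space ?UU. \<forall>t<K. lab (x t) = xs ! t}" for xs
  have cnt: "card {t. t < n \<and> f t = i} = count (mset (map f [0..<n])) i" for n f and i :: nat
  proof -
    have "count (mset (map f ts)) i = length (filter (\<lambda>t. f t = i) ts)" for ts
      by (induction ts) auto
    then have "count (mset (map f [0..<n])) i = length (filter (\<lambda>t. f t = i) [0..<n])" .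
    also have "\<dots> = card {t. t < n \<and> f t = i}"
      unfolding length_filter_conv_card by (intro arg_cong[where f=card]) auto
    finally show ?thesis by simp
  qed
  have iff: "(\<forall>i\<le>m. card {t. t < n \<and> lab (x t) = i} = k i) \<longleftrightarrow> mset (map (\<lambda>t. lab (x t)) [0..<n]) = A" for n x
  proof -
    have "count (mset (map (\<lambda>t. lab (x t)) [0..<n])) i = 0" if "\<not> i \<le> m" for i
      using le that by (auto simp: count_eq_zero_iff)
    then show ?thesis unfolding cnt multiset_eq_iff countA by auto
  qed
  \<comment> \<open>The counts add up to \<open>K\<close>, so they force exactly \<open>K\<close>
    points, whose labels form an arrangement of the multiset \<open>A\<close>. Hence the event is a
    product of an event for the number and a finite disjoint union of cylinders.\<close>
  have ev: "{\<omega>\<in>space (measure_pmf (pois a) \<Otimes>\<^sub>M ?UU). \<forall>i\<le>m. card {t. t < fst \<omega> \<and> lab (snd \<omega> t) = i} = k i}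
     = {K} \<times> (\<Union>xs\<in>permutations_of_multiset A. cyl xs)" (is "?E = _")
  proof (intro equalityI subsetI)
    fix \<omega> assume "\<omega> \<in> ?E"
    then have w: "snd \<omega> \<in> space ?UU" "mset (map (\<lambda>t. lab (snd \<omega> t)) [0..<fst \<omega>]) = A"
      by (auto simp: space_pair_measure iff)
    then have "fst \<omega> = K" using sizeA by (metis length_map length_upt minus_nat.diff_0 size_mset)
    moreover have "snd \<omega> \<in> cyl (map (\<lambda>t. lab (snd \<omega> t)) [0..<K])"
      using w by (simp add: cyl_def)
    moreover have "map (\<lambda>t. lab (snd \<omega> t)) [0..<K] \<in> permutations_of_multiset A"
      using w(2) unfolding \<open>fst \<omega> = K\<close> permutations_of_multiset_def by blast
    ultimately show "\<omega> \<in> {K} \<times> (\<Union>xs\<in>permutations_of_multiset A. cyl xs)"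
      unfolding mem_Times_iff by blast
  next
    fix \<omega> assume "\<omega> \<in> {K} \<times> (\<Union>xs\<in>permutations_of_multiset A. cyl xs)"
    then obtain xs where w: "fst \<omega> = K" "mset xs = A" "snd \<omega> \<in> cyl xs"
      by (auto simp: permutations_of_multiset_def)
    then have "length xs = K" using sizeA by (metis size_mset)
    then have "map (\<lambda>t. lab (snd \<omega> t)) [0..<K] = xs"
      using w(3) by (auto simp: cyl_def intro: nth_equalityI)
    then show "\<omega> \<in> ?E" using w by (cases \<omega>) (auto simp: space_pair_measure iff cyl_def)
  qed
  have u_sets: "lab -` {i} \<inter> space U \<in> sets U" for i
    using lab by (rule measurable_sets) auto
  have cyl: "cyl xs \<in> sets ?UU" "measure ?UU (cyl xs) = (\<Prod>i\<le>m. u i ^ k i)"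
    if xs: "xs \<in> permutations_of_multiset A" for xs
  proof -
    have mxs: "mset xs = A" using xs by (simp add: permutations_of_multiset_def)
    have len: "length xs = K" using mxs sizeA by (metis size_mset)
    let ?B = "\<lambda>t. lab -` {xs ! t} \<inter> space U"
    have eq: "cyl xs = prod_emb UNIV (\<lambda>_. U) {..<K} (PiE {..<K} ?B)"
      by (auto simp: cyl_def prod_emb_def space_PiM PiE_iff)
    show "cyl xs \<in> sets ?UU" unfolding eq using u_sets by (intro sets_PiM_I) auto
    have "emeasure ?UU (cyl xs) = (\<Prod>t<K. emeasure U (?B t))"
      unfolding eq using u_sets by (intro emeasure_PiM_emb U) auto
    also have "\<dots> = ennreal (\<Prod>t<K. u (xs ! t))"
      by (simp add: u_def U.emeasure_eq_measure prod_ennreal)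
    finally have "measure ?UU (cyl xs) = (\<Prod>t<K. u (xs ! t))"
      by (simp add: measure_def prod_nonneg u_def)
    also have "\<dots> = (\<Prod>i\<le>m. \<Prod>t\<in>{t\<in>{..<K}. xs ! t = i}. u (xs ! t))"
    proof (rule prod.group[symmetric])
      show "(!) xs ` {..<K} \<subseteq> {..m}"
      proof clarsimp
        fix t assume "t < K"
        then have "xs ! t \<in># A" using len by (metis mxs nth_mem set_mset_mset)
        then have "count A (xs ! t) \<noteq> 0" by simp
        then show "xs ! t \<le> m" unfolding countA by (simp split: if_splits)
      qed
    qed auto
    also have "\<dots> = (\<Prod>i\<le>m. u i ^ k i)"
    proof (rule prod.cong[OF refl])
      fix i assume i: "i \<in> {..m}"
      have "map ((!) xs) [0..<K] = xs" using map_nth[of xs] len by simp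
      then have "card {t\<in>{..<K}. xs ! t = i} = count A i"
        using cnt[of K "(!) xs" i] by (simp only: mxs lessThan_iff)
      then show "(\<Prod>t\<in>{t\<in>{..<K}. xs ! t = i}. u (xs ! t)) = u i ^ k i"
        using i by (simp add: countA)
    qed
    finally show "measure ?UU (cyl xs) = (\<Prod>i\<le>m. u i ^ k i)" .
  qed
  have disj: "disjoint_family_on cyl (permutations_of_multiset A)"
    unfolding disjoint_family_on_def
  proof (intro ballI impI)
    fix xs ys assume *: "xs \<in> permutations_of_multiset A" "ys \<in> permutations_of_multiset A" "xs \<noteq> ys"
    then have "mset xs = A" "mset ys = A" by (auto simp: permutations_of_multiset_def)
    then have "length xs = K" "length ys = K" using sizeA size_mset by metis+
    then obtain t where "t < K" "xs ! t \<noteq> ys ! t" using *(3) nth_equalityI by metis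
    then show "cyl xs \<inter> cyl ys = {}" by (auto simp: cyl_def)
  qed
  have "measure (measure_pmf (pois a) \<Otimes>\<^sub>M ?UU) ({K} \<times> (\<Union>xs\<in>permutations_of_multiset A. cyl xs))
     = pmf (pois a) K * measure ?UU (\<Union>xs\<in>permutations_of_multiset A. cyl xs)"
  proof -
    have "(\<Union>xs\<in>permutations_of_multiset A. cyl xs) \<in> sets ?UU"
      using cyl(1) by (intro sets.finite_UN) auto
    then have "emeasure (measure_pmf (pois a) \<Otimes>\<^sub>M ?UU) ({K} \<times> (\<Union>xs\<in>permutations_of_multiset A. cyl xs))
      = emeasure (measure_pmf (pois a)) {K} * emeasure ?UU (\<Union>xs\<in>permutations_of_multiset A. cyl xs)"
      by (intro UU.P.emeasure_pair_measure_Times) auto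
    then show ?thesis
      by (simp add: emeasure_pmf_single measure_def enn2real_mult)
  qed
  also have "measure ?UU (\<Union>xs\<in>permutations_of_multiset A. cyl xs)
      = (\<Sum>xs\<in>permutations_of_multiset A. measure ?UU (cyl xs))"
    using cyl(1) disj by (intro UU.P.finite_measure_finite_Union) auto
  also have "\<dots> = real (card (permutations_of_multiset A)) * (\<Prod>i\<le>m. u i ^ k i)"
    by (simp add: cyl(2))
  \<comment> \<open>This is the multinomial coefficient; its numerator cancels the factorial in the
    Poisson weight at \<open>K\<close>.\<close>
  also have "real (card (permutations_of_multiset A)) = fact K / (\<Prod>i\<le>m. fact (k i))"
  proof -
    have "(\<Prod>x\<in>set_mset A. fact (count A x)) = (\<Prod>i\<le>m. fact (count A i) :: nat)"
    proof (rule prod.mono_neutral_left)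
      show "set_mset A \<subseteq> {..m}"
      proof
        fix x assume "x \<in># A"
        then have "count A x \<noteq> 0" by simp
        then show "x \<in> {..m}" unfolding countA by (simp split: if_splits)
      qed
    qed (auto simp: not_in_iff)
    also have "\<dots> = (\<Prod>i\<le>m. fact (k i))" by (intro prod.cong) (auto simp: countA)
    finally have "card (permutations_of_multiset A) * (\<Prod>i\<le>m. fact (k i)) = (fact K :: nat)"
      using card_permutations_of_multiset_aux[of A] by (simp add: sizeA)
    then have "real (card (permutations_of_multiset A) * (\<Prod>i\<le>m. fact (k i))) = real (fact K)"
      by (rule arg_cong)
    then show ?thesis by (simp add: field_simps prod_zero_iff)
  qed
  also have "pmf (pois a) K * (fact K / (\<Prod>i\<le>m. fact (k i)) * (\<Prod>i\<le>m. u i ^ k i))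
     = a ^ K * exp (- a) * (\<Prod>i\<le>m. u i ^ k i) / (\<Prod>i\<le>m. fact (k i))"
    using a by (simp add: pmf_pois)
  also have "a ^ K = (\<Prod>i\<le>m. a ^ k i)" by (simp add: K_def power_sum)
  \<comment> \<open>Every point has a label up to \<open>m\<close>, so the \<open>u i\<close> sum to
    1 and the normalising factor splits among the labels.\<close>
  also have "exp (- a) = (\<Prod>i\<le>m. exp (- (a * u i)))"
  proof -
    have "(\<Sum>i\<le>m. u i) = measure U (\<Union>i\<le>m. lab -` {i} \<inter> space U)"
      unfolding u_def using u_sets
      by (intro U.finite_measure_finite_Union[symmetric]) (auto simp: disjoint_family_on_def)
    also have "(\<Union>i\<le>m. lab -` {i} \<inter> space U) = space U" using le by auto
    finally have "(\<Sum>i\<le>m. u i) = 1" by (simp add: U.prob_space)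
    then show ?thesis by (simp add: exp_sum[symmetric] sum_negf sum_distrib_left[symmetric])
  qed
  also have "(\<Prod>i\<le>m. a ^ k i) * (\<Prod>i\<le>m. exp (- (a * u i))) * (\<Prod>i\<le>m. u i ^ k i) / (\<Prod>i\<le>m. fact (k i))
      = (\<Prod>i\<le>m. pmf (pois (a * u i)) (k i))"
    using a by (simp add: pmf_pois u_def prod.distrib prod_dividef power_mult_distrib)
  finally show ?thesis unfolding ev .
qed

section \<open>Geometry of weighted configurations\<close>

text \<open>Nonnegative heights turn an upper bound on the power into bounds on site and height, to
  which local finiteness applies. Distinct sites make the locus of equal power of two points a
  hyperplane.\<close>

definition weighted_config :: "('a::euclidean_space \<times> real) set \<Rightarrow> bool" where
  "weighted_config A \<longleftrightarrow> locally_finite_set A \<and> (\<forall>p\<in>A. 0 \<le> snd p) \<and> inj_on fst A"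

lemma weighted_configD:
  assumes "weighted_config A"
  shows "locally_finite_set A" "\<And>p. p \<in> A \<Longrightarrow> 0 \<le> snd p" "inj_on fst A"
  using assms by (auto simp: weighted_config_def)

lemma weighted_config_at_height_0:
  assumes "locally_finite_set A"
  shows "weighted_config (at_height_0 A)"
proof -
  have "finite (at_height_0 A \<inter> B)" if "bounded B" for B
  proof -
    have "at_height_0 A \<inter> B \<subseteq> (\<lambda>v. (v, 0)) ` (A \<inter> fst ` B)"
      by (force simp: at_height_0_def)
    moreover have "finite (A \<inter> fst ` B)"
      using assms bounded_fst[OF that] by (auto simp: locally_finite_set_def)
    ultimately show ?thesis
      by (meson finite_imageI finite_subset)
  qed
  then show ?thesis
    by (auto simp: weighted_config_def locally_finite_set_def at_height_0_def inj_on_def)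
qed

section \<open>Cells meeting a bounded window\<close>

lemma continuous_on_lpow [continuous_intros]: "continuous_on S (\<lambda>w. lpow w p)"
  unfolding lpow_def by (intro continuous_intros)

lemma closed_laguerre_cell: "closed (laguerre_cell p A)"
proof -
  have "laguerre_cell p A = (\<Inter>q\<in>A. {w. lpow w p \<le> lpow w q})"
    by (auto simp: laguerre_cell_def)
  then show ?thesis
    by (auto intro!: closed_Collect_le continuous_intros)
qed

lemma norm_le_of_power2_le:
  fixes x T :: real
  assumes "x\<^sup>2 \<le> T"
  shows "x \<le> 1 + T"
proof -
  have "0 \<le> (x - 1/2)\<^sup>2" by simp
  then show ?thesis using assms by (simp add: power2_eq_square algebra_simps)
qed

lemma lpow_mono_radius:
  assumes "norm w \<le> R"
  shows "lpow w p \<le> (R + norm (fst p))\<^sup>2 + snd p"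
proof -
  have "norm (w - fst p) \<le> R + norm (fst p)"
    using assms norm_triangle_ineq4[of w "fst p"] by linarith
  then show ?thesis by (simp add: lpow_def power_mono)
qed

lemma lpow_le_imp_bounds:
  assumes "lpow w p \<le> T" "0 \<le> snd p" "norm w \<le> R"
  shows "norm (fst p) \<le> R + 1 + T" "snd p \<le> T"
proof -
  have "(norm (w - fst p))\<^sup>2 \<le> T" using assms by (simp add: lpow_def)
  then have "norm (w - fst p) \<le> 1 + T" by (rule norm_le_of_power2_le)
  then show "norm (fst p) \<le> R + 1 + T"
    using assms(3) norm_triangle_ineq2[of "fst p" w] by (simp add: norm_minus_commute)
  show "snd p \<le> T" using assms(1) by (simp add: lpow_def) (smt (verit) zero_le_power2)
qed

lemma finite_low_power:
  assumes "weighted_config A"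
  shows "finite {p\<in>A. \<exists>w\<in>cball 0 R. lpow w p \<le> T}"
proof -
  have "{p\<in>A. \<exists>w\<in>cball 0 R. lpow w p \<le> T} \<subseteq> A \<inter> (cball 0 (R + 1 + T) \<times> {0..T})"
    using lpow_le_imp_bounds weighted_configD[OF assms] by fastforce
  moreover have "bounded (cball (0::'a) (R + 1 + T) \<times> {0..T})"
    by (intro bounded_Times) auto
  ultimately show ?thesis
    using weighted_configD(1)[OF assms] unfolding locally_finite_set_def
    by (meson finite_subset)
qed

text \<open>Any fixed point \<open>a\<close> of the configuration is a competitor: its power is
  bounded on the window, and the owner of a cell meeting the window must do at least as well
  there.\<close>

lemma finite_relevant:
  assumes "weighted_config A"
  shows "finite {p\<in>A. laguerre_cell p A \<inter> cball 0 R \<noteq> {}}"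
proof (cases "A = {}")
  case False
  then obtain a where "a \<in> A" by auto
  have "{p\<in>A. laguerre_cell p A \<inter> cball 0 R \<noteq> {}}
      \<subseteq> {p\<in>A. \<exists>w\<in>cball 0 R. lpow w p \<le> (R + norm (fst a))\<^sup>2 + snd a}"
    using \<open>a \<in> A\<close> lpow_mono_radius[of _ R a]
    by (fastforce simp: laguerre_cell_def intro: order_trans)
  then show ?thesis using finite_low_power[OF assms] by (rule finite_subset)
qed auto

text \<open>Only finitely many points do at least as well at \<open>w\<close> as a given one, so the
  minimal power is attained although \<open>A\<close> may be infinite.\<close>

lemma ex_laguerre_cell:
  assumes "weighted_config A" "A \<noteq> {}"
  shows "\<exists>p\<in>A. w \<in> laguerre_cell p A"
proof -
  obtain a where a: "a \<in> A" using assms by auto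
  let ?Q = "{p\<in>A. lpow w p \<le> lpow w a}"
  have "?Q \<subseteq> {p\<in>A. \<exists>w'\<in>cball 0 (norm w). lpow w' p \<le> lpow w a}" by auto
  then have fin: "finite ?Q" using finite_low_power[OF assms(1)] by (rule finite_subset)
  have "a \<in> ?Q" using a by simp
  then have ne: "?Q \<noteq> {}" by blast
  define p where "p = arg_min_on (lpow w) ?Q"
  have p: "p \<in> ?Q" unfolding p_def using fin ne by (rule arg_min_if_finite)
  have p_min: "\<not> (\<exists>q\<in>?Q. lpow w q < lpow w p)"
    unfolding p_def by (rule arg_min_if_finite(2)[OF fin ne])
  have "lpow w p \<le> lpow w q" if "q \<in> A" for q
  proof (cases "q \<in> ?Q")
    case True then show ?thesis using p_min by (meson linorder_not_le)
  next
    case False then show ?thesis using p that by auto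
  qed
  then have "w \<in> laguerre_cell p A" by (simp add: laguerre_cell_def)
  then show ?thesis using p by blast
qed

text \<open>The power difference of two points is affine, with gradient along the difference of
  their sites. Where \<open>s\<close> is at least as good as \<open>r\<close>, an arbitrarily small
  step in direction \<open>fst s - fst r\<close> makes \<open>s\<close> strictly better.\<close>

lemma not_interior_laguerre_cell:
  assumes "r \<in> A" "s \<in> A" "fst r \<noteq> fst s" "w \<in> laguerre_cell s A"
  shows "w \<notin> interior (laguerre_cell r A)"
proof
  assume "w \<in> interior (laguerre_cell r A)"
  then obtain e where e: "e > 0" "ball w e \<subseteq> laguerre_cell r A"
    by (meson mem_interior)
  define u where "u = fst s - fst r"
  have u: "norm u > 0" using assms by (simp add: u_def)
  define t where "t = e / (2 * norm u)"
  have t: "t > 0" using e u by (simp add: t_def)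
  have "dist w (w + t *\<^sub>R u) = e / 2" using u e by (simp add: dist_norm t_def)
  then have "w + t *\<^sub>R u \<in> laguerre_cell r A" using e by auto
  then have 1: "lpow (w + t *\<^sub>R u) r \<le> lpow (w + t *\<^sub>R u) s"
    using assms by (simp add: laguerre_cell_def)
  have "lpow (w + t *\<^sub>R u) r - lpow (w + t *\<^sub>R u) s = lpow w r - lpow w s + 2 * t * (u \<bullet> u)"
    by (simp add: lpow_def u_def power2_norm_eq_inner algebra_simps inner_commute)
  moreover have "lpow w s \<le> lpow w r" using assms by (simp add: laguerre_cell_def)
  moreover have "t * (u \<bullet> u) > 0" using t u by simp
  ultimately show False using 1 by linarith
qed

lemma interior_Union_empty:
  fixes F :: "'a::euclidean_space set set"
  assumes "finite F" "\<And>C. C \<in> F \<Longrightarrow> closed C \<and> interior C = {}"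
  shows "interior (\<Union>F) = {}"
  using assms
proof (induction F)
  case (insert C F)
  then have "interior (\<Union>F \<union> C) = interior (\<Union>F)"
    by (intro interior_closed_Un_empty_interior closed_Union) auto
  with insert show ?case by (simp add: Un_commute)
qed auto

text \<open>\<open>laguerre\<close> keeps only cells with non-empty interior, while the right-hand
  side admits all cells. If \<open>w\<close> lies in two cells, the finitely many cells through
  \<open>w\<close> cover a neighbourhood of it; closed sets with empty interior could not do so.
  Hence one of them has interior points, and another cell through \<open>w\<close> keeps
  \<open>w\<close> itself out of that interior.\<close>

lemma skel_laguerre_eq:
  assumes A: "weighted_config A"
  shows "skel (laguerre A) =
    {w. \<exists>p\<in>A. \<exists>q\<in>A. p \<noteq> q \<and> w \<in> laguerre_cell p A \<and> w \<in> laguerre_cell q A}"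
proof (intro equalityI subsetI)
  have fin: "finite {p\<in>A. laguerre_cell p A \<inter> cball 0 R \<noteq> {}}" for R
    by (rule finite_relevant[OF A])
  fix w assume "w \<in> skel (laguerre A)"
  then obtain p where p: "p \<in> A" "w \<in> frontier (laguerre_cell p A)"
    by (auto simp: skel_def laguerre_def)
  then have w: "w \<in> laguerre_cell p A" "w \<notin> interior (laguerre_cell p A)"
    using closed_laguerre_cell[of p A] by (auto simp: frontier_def)
  have "\<exists>p\<in>A. \<exists>q\<in>A. p \<noteq> q \<and> w \<in> laguerre_cell p A \<and> w \<in> laguerre_cell q A"
  proof (rule ccontr)
    assume "\<not> ?thesis"
    then have *: "w \<notin> laguerre_cell q A" if "q \<in> A" "q \<noteq> p" for q
      using that p w by auto
    define Q where "Q = {r\<in>A. laguerre_cell r A \<inter> cball 0 (norm w + 1) \<noteq> {}} - {p}"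
    define U where "U = ball w 1 - (\<Union>r\<in>Q. laguerre_cell r A)"
    have "open U"
      unfolding U_def using fin[of "norm w + 1"] closed_laguerre_cell
      by (intro open_Diff closed_UN) (auto simp: Q_def)
    moreover have "w \<in> U" using * by (auto simp: U_def Q_def)
    moreover have "U \<subseteq> laguerre_cell p A"
    proof
      fix x assume x: "x \<in> U"
      obtain r where r: "r \<in> A" "x \<in> laguerre_cell r A"
        using ex_laguerre_cell[OF A] p by blast
      have "norm x \<le> norm w + 1"
        using x norm_triangle_ineq2[of x w] by (simp add: U_def dist_norm norm_minus_commute)
      then have "laguerre_cell r A \<inter> cball 0 (norm w + 1) \<noteq> {}" using r by force
      then show "x \<in> laguerre_cell p A"
        using r x by (auto simp: U_def Q_def)
    qed
    ultimately show False using w(2) by (meson interiorI)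
  qed
  then show "w \<in> {w. \<exists>p\<in>A. \<exists>q\<in>A. p \<noteq> q \<and> w \<in> laguerre_cell p A \<and> w \<in> laguerre_cell q A}"
    by simp
next
  have fin: "finite {p\<in>A. laguerre_cell p A \<inter> cball 0 R \<noteq> {}}" for R
    by (rule finite_relevant[OF A])
  fix w assume "w \<in> {w. \<exists>p\<in>A. \<exists>q\<in>A. p \<noteq> q \<and> w \<in> laguerre_cell p A \<and> w \<in> laguerre_cell q A}"
  then obtain p q where pq: "p \<in> A" "q \<in> A" "p \<noteq> q" "w \<in> laguerre_cell p A" "w \<in> laguerre_cell q A" by blast
  define Q where "Q = {r\<in>A. laguerre_cell r A \<inter> cball 0 (norm w + 1) \<noteq> {}}"
  have finQ: "finite Q" using fin by (simp add: Q_def)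
  \<comment> \<open>Removing the finitely many nearby cells that miss \<open>w\<close> leaves a
    neighbourhood in which every point belongs to a cell through \<open>w\<close>.\<close>
  define U where "U = ball w 1 - (\<Union>r\<in>{r\<in>Q. w \<notin> laguerre_cell r A}. laguerre_cell r A)"
  have U: "open U" "w \<in> U"
    unfolding U_def using finQ closed_laguerre_cell
    by (intro open_Diff closed_UN, auto)
  have cover: "U \<subseteq> (\<Union>r\<in>{r\<in>Q. w \<in> laguerre_cell r A}. laguerre_cell r A)"
  proof
    fix x assume x: "x \<in> U"
    obtain r where r: "r \<in> A" "x \<in> laguerre_cell r A"
      using ex_laguerre_cell[OF A] pq by blast
    have "norm x \<le> norm w + 1"
      using x norm_triangle_ineq2[of x w] by (simp add: U_def dist_norm norm_minus_commute)
    with r have "r \<in> Q" by (auto simp: Q_def)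
    moreover have "w \<in> laguerre_cell r A" using x r \<open>r \<in> Q\<close> unfolding U_def by blast
    ultimately show "x \<in> (\<Union>r\<in>{r\<in>Q. w \<in> laguerre_cell r A}. laguerre_cell r A)"
      using r by blast
  qed
  have "\<exists>r\<in>Q. w \<in> laguerre_cell r A \<and> interior (laguerre_cell r A) \<noteq> {}"
  proof (rule ccontr)
    assume "\<not> ?thesis"
    then have "interior (\<Union>((\<lambda>r. laguerre_cell r A) ` {r\<in>Q. w \<in> laguerre_cell r A})) = {}"
      using finQ closed_laguerre_cell by (intro interior_Union_empty) auto
    then show False using interior_maximal[OF cover U(1)] U(2) by auto
  qed
  then obtain r where r: "r \<in> A" "w \<in> laguerre_cell r A" "interior (laguerre_cell r A) \<noteq> {}"
    by (auto simp: Q_def)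
  obtain s where s: "s \<in> A" "w \<in> laguerre_cell s A" "s \<noteq> r" using pq by metis
  then have "fst r \<noteq> fst s"
    using weighted_configD(3)[OF A] r by (auto dest: inj_onD)
  then have "w \<notin> interior (laguerre_cell r A)"
    using not_interior_laguerre_cell r s by blast
  then have "w \<in> frontier (laguerre_cell r A)"
    using r(2) closed_laguerre_cell[of r A] by (simp add: frontier_def)
  moreover have "laguerre_cell r A \<in> laguerre A" using r unfolding laguerre_def by blast
  ultimately show "w \<in> skel (laguerre A)" unfolding skel_def by blast
qed

section \<open>Closedness of the skeletons\<close>

lemma closed_if_closed_Int_cball:
  fixes Z :: "'a::euclidean_space set"
  assumes "\<And>R. closed (Z \<inter> cball 0 R)"
  shows "closed Z"
  unfolding closed_sequential_limits
proof safe
  fix x l assume x: "\<forall>n. x n \<in> Z" "x \<longlonglongrightarrow> l"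
  then obtain K where "\<And>n. norm (x n) \<le> K"
    by (meson BseqE Bseq_def convergentI convergent_imp_Bseq)
  then have "x n \<in> Z \<inter> cball 0 K" for n using x by auto
  then show "l \<in> Z" using assms[of K] x(2) by (meson IntD1 closed_sequentially)
qed

lemma closed_skel_laguerre:
  assumes A: "weighted_config A"
  shows "closed (skel (laguerre A))"
proof (rule closed_if_closed_Int_cball)
  fix R
  let ?Q = "{r\<in>A. laguerre_cell r A \<inter> cball 0 R \<noteq> {}}"
  have "skel (laguerre A) \<inter> cball 0 R =
     (\<Union>(p, q)\<in>{(p, q). p \<in> ?Q \<and> q \<in> ?Q \<and> p \<noteq> q}. laguerre_cell p A \<inter> laguerre_cell q A \<inter> cball 0 R)"
    unfolding skel_laguerre_eq[OF A] by blast
  moreover have "finite {(p, q). p \<in> ?Q \<and> q \<in> ?Q \<and> p \<noteq> q}"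
    by (rule finite_subset[of _ "?Q \<times> ?Q"]) (use finite_relevant[OF A] in auto)
  ultimately show "closed (skel (laguerre A) \<inter> cball 0 R)"
    by (auto intro!: closed_UN closed_Int closed_laguerre_cell)
qed

text \<open>Read through support functions: for positive \<open>R\<close>, the convex hull of
  \<open>F\<close> contains the ball of radius \<open>R\<close>. Thus \<open>spread X\<close> means
  that the convex hull of \<open>X\<close> is the whole space, in a form where finitely many points
  serve all directions.\<close>

definition spread :: "'a::euclidean_space set \<Rightarrow> bool" where
  "spread X \<longleftrightarrow> (\<forall>R. \<exists>F\<subseteq>X. finite F \<and> (\<forall>e. norm e = 1 \<longrightarrow> (\<exists>v\<in>F. R \<le> v \<bullet> e)))"

lemma spread_nonempty:
  assumes "spread X"
  shows "X \<noteq> {}"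
proof -
  obtain e :: 'a where "norm e = 1" using norm_Basis nonempty_Basis by blast
  then show ?thesis using assms by (fastforce simp: spread_def)
qed

text \<open>A distant centre \<open>w\<close> would have a large power \<open>t\<close>, since the
  ball of radius \<open>sqrt t\<close> around \<open>w\<close> contains the simplex, which reaches
  into the window. Yet some \<open>v\<close> in \<open>F\<close> lies in the direction of
  \<open>w\<close> and caps \<open>t\<close>. The terms quadratic in \<open>w\<close> cancel, and
  the excess of \<open>R + 1\<close> over \<open>R\<close> leaves a linear bound on
  \<open>norm w\<close>.\<close>

lemma dual_center_bound:
  assumes A: "\<And>p. p \<in> A \<Longrightarrow> 0 \<le> snd p"
    and F: "\<And>v. v \<in> F \<Longrightarrow> \<exists>h\<le>H. (v, h) \<in> A"
    and Fe: "\<And>e. norm e = 1 \<Longrightarrow> \<exists>v\<in>F. R + 1 \<le> v \<bullet> e"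
    and "0 \<le> R" and S: "S \<subseteq> A" "w \<in> (\<Inter>p\<in>S. laguerre_cell p A)"
    and x: "x \<in> convex hull (fst ` S)" "norm x \<le> R"
  shows "norm w \<le> R \<or> (\<exists>v\<in>F. 2 * norm w \<le> (norm v)\<^sup>2 + H)"
proof (cases "norm w \<le> R")
  case False
  then have w: "norm w > R" "norm w > 0" using \<open>0 \<le> R\<close> by auto
  have "norm (w /\<^sub>R norm w) = 1" using w by simp
  then obtain v where v: "v \<in> F" "R + 1 \<le> v \<bullet> (w /\<^sub>R norm w)" using Fe by blast
  then have vw: "(R + 1) * norm w \<le> v \<bullet> w" using w by (simp add: field_simps)
  obtain h where h: "h \<le> H" "(v, h) \<in> A" using F v by blast
  have "S \<noteq> {}" using x by auto
  then obtain s where s: "s \<in> S" by auto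
  define t where "t = lpow w s"
  have t: "t \<le> (norm (w - v))\<^sup>2 + H"
    using S s h by (fastforce simp: t_def laguerre_cell_def lpow_def)
  have "fst ` S \<subseteq> cball w (sqrt t)"
  proof clarify
    fix v h assume vh: "(v, h) \<in> S"
    then have "lpow w (v, h) \<le> t"
      using S s by (force simp: t_def laguerre_cell_def)
    then have "(norm (w - v))\<^sup>2 \<le> t" using A[of "(v, h)"] vh S by (auto simp: lpow_def)
    then show "fst (v, h) \<in> cball w (sqrt t)" by (simp add: dist_norm real_le_rsqrt)
  qed
  then have "convex hull (fst ` S) \<subseteq> cball w (sqrt t)" by (intro hull_minimal) auto
  then have "norm (w - x) \<le> sqrt t" using x by (auto simp: dist_norm)
  then have "norm w - R \<le> sqrt t" using x norm_triangle_ineq2[of w x] by linarith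
  then have "(norm w - R)\<^sup>2 \<le> (sqrt t)\<^sup>2" using w by (intro power_mono) auto
  moreover have "0 \<le> t" using A[of s] s S by (auto simp: t_def lpow_def)
  ultimately have "(norm w - R)\<^sup>2 \<le> (norm (w - v))\<^sup>2 + H" using t by simp
  moreover have "(norm (w - v))\<^sup>2 = (norm w)\<^sup>2 - 2 * (v \<bullet> w) + (norm v)\<^sup>2"
    by (simp add: power2_norm_eq_inner algebra_simps inner_commute)
  moreover have "(norm w - R)\<^sup>2 = (norm w)\<^sup>2 - 2 * (R * norm w) + R\<^sup>2"
    by (simp add: power2_diff)
  moreover have "(R + 1) * norm w = R * norm w + norm w" by (simp add: algebra_simps)
  ultimately have "2 * norm w \<le> (norm v)\<^sup>2 + H"
    using vw zero_le_power2[of R] by linarith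
  then show ?thesis using v by auto
qed auto

text \<open>\<open>R'\<close> is chosen before \<open>A\<close>, from \<open>F\<close>,
  \<open>H\<close> and \<open>R\<close> alone. This uniformity lets one ball contain the centres for
  the limit and for all large \<open>n\<close>.\<close>

lemma dual_centers_bounded:
  assumes "finite F" and Fe: "\<And>e::'a::euclidean_space. norm e = 1 \<Longrightarrow> \<exists>v\<in>F. R + 1 \<le> v \<bullet> e"
    and "0 \<le> R"
  obtains R' where "\<And>A S w. (\<And>p. p \<in> A \<Longrightarrow> 0 \<le> snd p) \<Longrightarrow> (\<And>v. v \<in> F \<Longrightarrow> \<exists>h\<le>H. (v, h) \<in> A) \<Longrightarrow>
    S \<subseteq> A \<Longrightarrow> w \<in> (\<Inter>p\<in>S. laguerre_cell p A) \<Longrightarrow>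
    convex hull (fst ` S) \<inter> cball 0 R \<noteq> {} \<Longrightarrow> norm w \<le> R'"
proof
  fix A :: "('a \<times> real) set" and S w
  assume A: "\<And>p. p \<in> A \<Longrightarrow> 0 \<le> snd p" "\<And>v. v \<in> F \<Longrightarrow> \<exists>h\<le>H. (v, h) \<in> A"
    and S: "S \<subseteq> A" "w \<in> (\<Inter>p\<in>S. laguerre_cell p A)"
    and "convex hull (fst ` S) \<inter> cball 0 R \<noteq> {}"
  then obtain x where x: "x \<in> convex hull (fst ` S)" "norm x \<le> R" by auto
  have nn: "0 \<le> (\<Sum>v\<in>F. (norm v)\<^sup>2)" by (simp add: sum_nonneg)
  have le: "(norm v)\<^sup>2 \<le> (\<Sum>v\<in>F. (norm v)\<^sup>2)" if "v \<in> F" for v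
    using that assms(1) by (intro member_le_sum) auto
  from dual_center_bound[OF A Fe \<open>0 \<le> R\<close> S x]
  show "norm w \<le> R + (\<Sum>v\<in>F. (norm v)\<^sup>2) + \<bar>H\<bar>"
  proof
    assume "\<exists>v\<in>F. 2 * norm w \<le> (norm v)\<^sup>2 + H"
    then obtain v where "v \<in> F" "2 * norm w \<le> (norm v)\<^sup>2 + H" by auto
    with le[of v] nn \<open>0 \<le> R\<close> norm_ge_zero[of w] show ?thesis by linarith
  next
    assume "norm w \<le> R"
    then show ?thesis using nn by linarith
  qed
qed

text \<open>Simplices meeting a ball have their centres in a fixed larger ball, so their vertices
  own one of the finitely many cells meeting that ball. Locally the skeleton is a finite union of
  boundaries.\<close>

lemma closed_skel_laguerre_dual:
  assumes A: "weighted_config A" and sp: "spread {v. \<exists>h\<le>H. (v, h) \<in> A}"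
  shows "closed (skel (laguerre_dual A))"
proof (rule closed_if_closed_Int_cball)
  fix R :: real
  define R0 where "R0 = max R 0"
  obtain F where F: "F \<subseteq> {v. \<exists>h\<le>H. (v, h) \<in> A}" "finite F"
      "\<forall>e. norm e = 1 \<longrightarrow> (\<exists>v\<in>F. R0 + 1 \<le> v \<bullet> e)"
    using sp unfolding spread_def by blast
  have R0: "0 \<le> R0" by (simp add: R0_def)
  obtain R' where R'0: "\<And>A S w. (\<And>p. p \<in> A \<Longrightarrow> 0 \<le> snd p) \<Longrightarrow> (\<And>v. v \<in> F \<Longrightarrow> \<exists>h\<le>H. (v, h) \<in> A) \<Longrightarrow>
    S \<subseteq> A \<Longrightarrow> w \<in> (\<Inter>p\<in>S. laguerre_cell p A) \<Longrightarrow>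
    convex hull (fst ` S) \<inter> cball 0 R0 \<noteq> {} \<Longrightarrow> norm w \<le> R'"
    using dual_centers_bounded[OF F(2) _ R0, of H] F(3) by blast
  have R': "norm w \<le> R'" if "S \<subseteq> A" "w \<in> (\<Inter>p\<in>S. laguerre_cell p A)"
      "convex hull (fst ` S) \<inter> cball 0 R0 \<noteq> {}" for S w
    using R'0[OF weighted_configD(2)[OF A] _ that] F(1) by blast
  define Q where "Q = {r\<in>A. laguerre_cell r A \<inter> cball 0 R' \<noteq> {}}"
  have finQ: "finite Q" using finite_relevant[OF A] by (simp add: Q_def)
  define \<S> where "\<S> = {S. S \<subseteq> Q \<and> card S = DIM('a) + 1 \<and> (\<Inter>p\<in>S. laguerre_cell p A) \<noteq> {}}"
  have "skel (laguerre_dual A) \<inter> cball 0 R = (\<Union>S\<in>\<S>. frontier (convex hull (fst ` S)) \<inter> cball 0 R)"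
  proof safe
    fix x assume x: "x \<in> skel (laguerre_dual A)" "x \<in> cball 0 R"
    then obtain S where S: "S \<subseteq> A" "card S = DIM('a) + 1" "(\<Inter>p\<in>S. laguerre_cell p A) \<noteq> {}"
        "x \<in> frontier (convex hull (fst ` S))"
      by (auto simp: skel_def laguerre_dual_def)
    then obtain w where w: "w \<in> (\<Inter>p\<in>S. laguerre_cell p A)" by blast
    have "finite S" using S(2) card.infinite by fastforce
    then have "closed (convex hull (fst ` S))"
      by (simp add: compact_imp_closed finite_imp_compact compact_convex_hull)
    then have "x \<in> convex hull (fst ` S)" using S(4) by (auto simp: frontier_def)
    moreover have "norm x \<le> R0" using x(2) by (auto simp: R0_def)
    ultimately have "convex hull (fst ` S) \<inter> cball 0 R0 \<noteq> {}" by auto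
    then have "norm w \<le> R'" by (rule R'[OF S(1) w])
    then have "S \<subseteq> Q" using w S(1) by (fastforce simp: Q_def)
    then have "S \<in> \<S>" using S by (auto simp: \<S>_def)
    then show "x \<in> (\<Union>S\<in>\<S>. frontier (convex hull (fst ` S)) \<inter> cball 0 R)" using S x by blast
  next
    fix x S assume "S \<in> \<S>" "x \<in> frontier (convex hull (fst ` S))"
    then show "x \<in> skel (laguerre_dual A)"
      unfolding skel_def laguerre_dual_def \<S>_def Q_def by blast
  qed
  moreover have "finite \<S>" using finQ by (simp add: \<S>_def)
  ultimately show "closed (skel (laguerre_dual A) \<inter> cball 0 R)"
    by (auto intro!: closed_UN closed_Int)
qed

section \<open>Deterministic convergence of the skeletons\<close>

lemma strict_mono_counterexamples:
  assumes "\<not> eventually P sequentially"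
  obtains k :: "nat \<Rightarrow> nat" where "strict_mono k" "\<And>j. \<not> P (k j)"
proof -
  have "infinite {n. \<not> P n}"
    using assms unfolding cofinite_eq_sequentially[symmetric] eventually_cofinite by simp
  then obtain k :: "nat \<Rightarrow> nat" where "strict_mono k" "\<forall>j. k j \<in> {n. \<not> P n}"
    using infinite_enumerate[of "{n. \<not> P n}"] by auto
  then show ?thesis using that by auto
qed

text \<open>The vector \<open>adjoint g 1\<close> represents the coordinate functional of
  \<open>b\<close>.\<close>

lemma linear_dual_functional:
  fixes B :: "'a::euclidean_space set"
  assumes "independent B" "b \<in> B"
  obtains y where "b \<bullet> y = 1" "\<And>b'. b' \<in> B \<Longrightarrow> b' \<noteq> b \<Longrightarrow> b' \<bullet> y = 0"
proof -
  obtain g :: "'a \<Rightarrow> real" where g: "linear g" "\<forall>x\<in>B. g x = (if x = b then 1 else 0)"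
    using linear_independent_extend[OF assms(1), of "\<lambda>x. if x = b then 1 else 0"] by auto
  have "g x = x \<bullet> adjoint g 1" for x
    using adjoint_works[OF g(1), of x 1] by simp
  then show ?thesis using that[of "adjoint g 1"] g(2) assms(2) by auto
qed

text \<open>Given small height perturbations of affinely independent points, a power centre of the
  perturbed points is found near any point equidistant to the unperturbed ones: up to the
  norm of the shift, which drops out, the conditions are linear in the shift.\<close>

lemma perturbed_power_centre:
  fixes V :: "'a::euclidean_space set" and h :: "nat \<Rightarrow> 'a \<Rightarrow> real"
  assumes V: "\<not> affine_dependent V" "finite V"
    and eq: "\<And>v v'. v \<in> V \<Longrightarrow> v' \<in> V \<Longrightarrow> norm (w - v) = norm (w - v')"
    and h: "\<And>v. v \<in> V \<Longrightarrow> (\<lambda>n. h n v) \<longlonglongrightarrow> 0"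
  obtains c where "c \<longlonglongrightarrow> w"
    "\<And>n v v'. v \<in> V \<Longrightarrow> v' \<in> V \<Longrightarrow> lpow (c n) (v, h n v) = lpow (c n) (v', h n v')"
proof (cases "V = {}")
  case True
  then show ?thesis using that[of "\<lambda>n. w"] by auto
next
  case False
  then obtain a where a: "a \<in> V" by auto
  define V' where "V' = V - {a}"
  define B where "B = (\<lambda>v. v - a) ` V'"
  have "independent B"
  proof
    assume "dependent B"
    then have "dependent {x - a |x. x \<in> V'}" by (simp add: B_def Setcompr_eq_image)
    then have "affine_dependent (insert a V')"
      by (intro dependent_imp_affine_dependent) (auto simp: V'_def)
    then show False using V a by (simp add: V'_def insert_absorb)
  qed
  have "\<exists>y. (v - a) \<bullet> y = 1 \<and> (\<forall>v'\<in>V'. v' \<noteq> v \<longrightarrow> (v' - a) \<bullet> y = 0)" if "v \<in> V'" for v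
  proof -
    have "v - a \<in> B" using that by (auto simp: B_def)
    from linear_dual_functional[OF \<open>independent B\<close> this] obtain y
      where y: "(v - a) \<bullet> y = 1" "\<And>b'. b' \<in> B \<Longrightarrow> b' \<noteq> v - a \<Longrightarrow> b' \<bullet> y = 0" by metis
    have "(v' - a) \<bullet> y = 0" if "v' \<in> V'" "v' \<noteq> v" for v'
      using y(2)[of "v' - a"] that by (auto simp: B_def)
    then show ?thesis using y(1) by blast
  qed
  then obtain y where y: "\<And>v. v \<in> V' \<Longrightarrow> (v - a) \<bullet> y v = 1"
      "\<And>v v'. v \<in> V' \<Longrightarrow> v' \<in> V' \<Longrightarrow> v' \<noteq> v \<Longrightarrow> (v' - a) \<bullet> y v = 0"
    by metis
  \<comment> \<open>The \<open>y v\<close> are dual to the edge vectors \<open>v - a\<close>, so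
    \<delta> solves the linear conditions on all edges at once. The factor 1/2 offsets the 2 of the
    mixed term in the squared norm, and the coefficients vanish as the heights do.\<close>
  define \<delta> where "\<delta> n = (\<Sum>v\<in>V'. ((h n v - h n a) / 2) *\<^sub>R y v)" for n
  have \<delta>: "(v - a) \<bullet> \<delta> n = (h n v - h n a) / 2" if "v \<in> V'" for v n
  proof -
    have "(v - a) \<bullet> \<delta> n = (\<Sum>v'\<in>V'. (h n v' - h n a) / 2 * ((v - a) \<bullet> y v'))"
      by (simp add: \<delta>_def inner_sum_right)
    also have "\<dots> = (\<Sum>v'\<in>V'. if v' = v then (h n v' - h n a) / 2 else 0)"
      using y that by (intro sum.cong) auto
    also have "\<dots> = (h n v - h n a) / 2" using that V(2) by (simp add: V'_def)
    finally show ?thesis .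
  qed
  have "\<delta> \<longlonglongrightarrow> (\<Sum>v\<in>V'. ((0 - 0) / 2) *\<^sub>R y v)"
    unfolding \<delta>_def using a by (intro tendsto_intros h) (auto simp: V'_def)
  then have "(\<lambda>n. w + \<delta> n) \<longlonglongrightarrow> w + 0" by (intro tendsto_intros) auto
  then have lim: "(\<lambda>n. w + \<delta> n) \<longlonglongrightarrow> w" by simp
  have key: "lpow (w + \<delta> n) (v, h n v) = lpow (w + \<delta> n) (a, h n a)" if "v \<in> V" for v n
  proof (cases "v = a")
    case False
    then have v: "v \<in> V'" using that by (simp add: V'_def)
    have "lpow (w + \<delta> n) (v, h n v) - lpow (w + \<delta> n) (a, h n a)
        = (norm (w - v))\<^sup>2 - (norm (w - a))\<^sup>2 - 2 * ((v - a) \<bullet> \<delta> n) + h n v - h n a"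
      by (simp add: lpow_def power2_norm_eq_inner algebra_simps inner_commute)
    also have "\<dots> = 0" using \<delta>[OF v, of n] eq[OF that a] by simp
    finally show ?thesis by simp
  qed simp
  then have "lpow (w + \<delta> n) (v, h n v) = lpow (w + \<delta> n) (v', h n v')" if "v \<in> V" "v' \<in> V" for n v v'
    using key[OF that(1), of n] key[OF that(2), of n] by metis
  then show ?thesis using lim by (intro that[of "\<lambda>n. w + \<delta> n"])
qed

lemma skel_laguerre_dualI:
  assumes "S \<subseteq> A" "card S = DIM('a) + 1" "(\<Inter>p\<in>S. laguerre_cell p A) \<noteq> {}"
    "(x::'a::euclidean_space) \<in> frontier (convex hull (fst ` S))"
  shows "x \<in> skel (laguerre_dual A)"
  using assms unfolding skel_def laguerre_dual_def by blast

text \<open>The first clause makes the equations for a perturbed centre solvable and the simplices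
  non-degenerate. The second says that no sphere carries d + 2 points, so that at a Voronoi vertex
  all further points are strictly farther away.\<close>

definition generic :: "'a::euclidean_space set \<Rightarrow> bool" where
  "generic X \<longleftrightarrow> (\<forall>S\<subseteq>X. finite S \<and> card S \<le> DIM('a) + 1 \<longrightarrow> \<not> affine_dependent S) \<and>
     (\<forall>S\<subseteq>X. card S = DIM('a) + 2 \<longrightarrow> \<not> (\<exists>w r. \<forall>v\<in>S. norm (w - v) = r))"

text \<open>This isolates what the coupling yields for one outcome. The points over \<open>A\<close>
  sink to height 0, and by \<open>local\<close> all other points eventually leave every region that
  is bounded in site and height.\<close>

locale laguerre_limit =
  fixes A :: "'a::euclidean_space set" and An :: "nat \<Rightarrow> ('a \<times> real) set"
    and h :: "nat \<Rightarrow> 'a \<Rightarrow> real"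
  assumes An: "weighted_config (An n)"
    and lf: "locally_finite_set A"
    and ev: "v \<in> A \<Longrightarrow> \<forall>\<^sub>F n in sequentially. (v, h n v) \<in> An n"
    and h: "v \<in> A \<Longrightarrow> (\<lambda>n. h n v) \<longlonglongrightarrow> 0"
    and local: "\<forall>\<^sub>F n in sequentially. \<forall>p\<in>An n. norm (fst p) \<le> r \<longrightarrow> snd p \<le> r \<longrightarrow> fst p \<in> A"
    and spread: "spread A"
    and generic: "generic A"
begin

lemma A0: "weighted_config (at_height_0 A)"
  using lf by (rule weighted_config_at_height_0)

text \<open>One finite set of sites controls the window for the limit and for all large
  \<open>n\<close> together. The competitor \<open>a\<close> stays fixed and its height is
  eventually below 1, the summand 1 in \<open>T\<close>. This gives a common bound on power, hence
  on site and height, and \<open>local\<close> applies.\<close>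

lemma relevant_points:
  "\<exists>F. finite F \<and> F \<subseteq> A \<and>
    (\<forall>v\<in>A. laguerre_cell (v, 0) (at_height_0 A) \<inter> cball 0 R \<noteq> {} \<longrightarrow> v \<in> F) \<and>
    (\<forall>\<^sub>F n in sequentially. (\<forall>v\<in>F. (v, h n v) \<in> An n) \<and>
       (\<forall>p\<in>An n. laguerre_cell p (An n) \<inter> cball 0 R \<noteq> {} \<longrightarrow> fst p \<in> F \<and> p = (fst p, h n (fst p))))"
proof -
  obtain a where a: "a \<in> A" using spread_nonempty[OF spread] by auto
  define T where "T = (R + norm a)\<^sup>2 + 1"
  define r where "r = max (R + 1 + T) T"
  define F where "F = A \<inter> cball 0 r"
  have finF: "finite F" using lf by (simp add: F_def locally_finite_set_def)
  have low: "norm (fst p) \<le> r \<and> snd p \<le> r"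
    if lp: "p \<in> A'" "(a, x) \<in> A'" "x \<le> 1" "0 \<le> snd p" "laguerre_cell p A' \<inter> cball 0 R \<noteq> {}"
    for A' :: "('a \<times> real) set" and p x
  proof -
    obtain w where w: "w \<in> laguerre_cell p A'" "norm w \<le> R"
      using lp(5) unfolding mem_cball_0[symmetric] by blast
    have "lpow w p \<le> lpow w (a, x)" using w(1) that by (auto simp: laguerre_cell_def)
    also have "\<dots> \<le> T" using lpow_mono_radius[OF w(2), of "(a, x)"] that by (simp add: T_def)
    finally show ?thesis using lpow_le_imp_bounds[OF _ that(4) w(2), of T] by (auto simp: r_def)
  qed
  have "\<forall>\<^sub>F n in sequentially. h n a < 1"
    using h[OF a] by (rule order_tendstoD) simp
  moreover have "\<forall>\<^sub>F n in sequentially. \<forall>v\<in>F. (v, h n v) \<in> An n"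
    using finF ev by (auto simp: eventually_ball_finite_distrib F_def)
  ultimately have "\<forall>\<^sub>F n in sequentially. (\<forall>v\<in>F. (v, h n v) \<in> An n) \<and>
      (\<forall>p\<in>An n. laguerre_cell p (An n) \<inter> cball 0 R \<noteq> {} \<longrightarrow> fst p \<in> F \<and> p = (fst p, h n (fst p)))"
    using ev[OF a] local[of r]
  proof eventually_elim
    case (elim n)
    have "fst p \<in> F \<and> p = (fst p, h n (fst p))"
      if p: "p \<in> An n" "laguerre_cell p (An n) \<inter> cball 0 R \<noteq> {}" for p
    proof -
      have l: "norm (fst p) \<le> r \<and> snd p \<le> r"
        using low[of p "An n" "h n a"] p elim weighted_configD(2)[OF An] by auto
      then have "fst p \<in> F" using elim(4) p by (auto simp: F_def)
      moreover from this have "(fst p, h n (fst p)) \<in> An n" using elim(2) by blast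
      ultimately show ?thesis
        using weighted_configD(3)[OF An, of n] p(1) by (metis fst_conv inj_onD)
    qed
    then show ?case using elim(2) by blast
  qed
  moreover have "v \<in> F" if "v \<in> A" "laguerre_cell (v, 0) (at_height_0 A) \<inter> cball 0 R \<noteq> {}" for v
    using low[of "(v, 0)" "at_height_0 A" 0] that a by (auto simp: F_def at_height_0_def)
  moreover have "F \<subseteq> A" by (simp add: F_def)
  ultimately show ?thesis using finF by blast
qed

text \<open>A cell is cut out by one weak inequality per competitor. Every competitor in
  \<open>A\<close> is eventually present, and weak inequalities pass to the limit.\<close>

lemma laguerre_cell_limit:
  assumes "v \<in> A" "strict_mono (k :: nat \<Rightarrow> nat)" "w \<longlonglongrightarrow> l"
    "\<And>j. w j \<in> laguerre_cell (v, h (k j) v) (An (k j))"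
  shows "l \<in> laguerre_cell (v, 0) (at_height_0 A)"
proof -
  have "lpow l (v, 0) \<le> lpow l (u, 0)" if "u \<in> A" for u
  proof (rule tendsto_le)
    have hk: "(\<lambda>j. h (k j) x) \<longlonglongrightarrow> 0" if "x \<in> A" for x
      using LIMSEQ_subseq_LIMSEQ[OF h[OF that] assms(2)] by (simp add: o_def)
    show "(\<lambda>j. lpow (w j) (u, h (k j) u)) \<longlonglongrightarrow> lpow l (u, 0)"
      "(\<lambda>j. lpow (w j) (v, h (k j) v)) \<longlonglongrightarrow> lpow l (v, 0)"
      unfolding lpow_def fst_conv snd_conv
      by (intro tendsto_intros hk assms that)+
    have "\<forall>\<^sub>F j in sequentially. (u, h (k j) u) \<in> An (k j)"
      using eventually_compose_filterlim[OF ev[OF that] filterlim_subseq[OF assms(2)]] .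
    then show "\<forall>\<^sub>F j in sequentially. lpow (w j) (v, h (k j) v) \<le> lpow (w j) (u, h (k j) u)"
      by eventually_elim (use assms(4) in \<open>auto simp: laguerre_cell_def\<close>)
  qed simp
  then show ?thesis by (auto simp: laguerre_cell_def at_height_0_def)
qed

lemma lim_skel_eq:
  "skel (laguerre (at_height_0 A)) = {w. \<exists>v\<in>A. \<exists>u\<in>A. v \<noteq> u \<and>
     w \<in> laguerre_cell (v, 0) (at_height_0 A) \<and> w \<in> laguerre_cell (u, 0) (at_height_0 A)}"
  unfolding skel_laguerre_eq[OF A0] by (auto simp: at_height_0_def)

text \<open>By \<open>relevant_points\<close> only finitely many pairs of sites contribute, so each
  pair may be treated alone. If points far from the limit skeleton kept occurring in both cells of a
  pair, compactness would give a limit point in two limit cells, hence on the limit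
  skeleton.\<close>

lemma eventually_skel_upper:
  assumes "\<epsilon> > 0" "compact C"
  shows "\<forall>\<^sub>F n in sequentially. (skel (laguerre (An n)) - open_nbhd \<epsilon> (skel (laguerre (at_height_0 A)))) \<inter> C = {}"
proof -
  let ?Z = "skel (laguerre (at_height_0 A))"
  obtain R where R: "C \<subseteq> cball 0 R"
    using bounded_subset_ballD[OF compact_imp_bounded[OF assms(2)], of 0] ball_subset_cball by blast
  obtain F where F: "finite F" "F \<subseteq> A"
    "\<forall>v\<in>A. laguerre_cell (v, 0) (at_height_0 A) \<inter> cball 0 R \<noteq> {} \<longrightarrow> v \<in> F"
    "\<forall>\<^sub>F n in sequentially. (\<forall>v\<in>F. (v, h n v) \<in> An n) \<and>
       (\<forall>p\<in>An n. laguerre_cell p (An n) \<inter> cball 0 R \<noteq> {} \<longrightarrow> fst p \<in> F \<and> p = (fst p, h n (fst p)))"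
    using relevant_points[of R] by blast
  have "\<forall>\<^sub>F n in sequentially. \<not> (\<exists>w\<in>C. w \<in> laguerre_cell (v, h n v) (An n) \<and>
      w \<in> laguerre_cell (u, h n u) (An n) \<and> w \<notin> open_nbhd \<epsilon> ?Z)"
    if vu: "v \<in> F" "u \<in> F - {v}" for v u
  proof (rule ccontr)
    assume "\<not> ?thesis"
    then obtain k :: "nat \<Rightarrow> nat" where k: "strict_mono k" "\<And>j. \<exists>w\<in>C. w \<in> laguerre_cell (v, h (k j) v) (An (k j)) \<and>
      w \<in> laguerre_cell (u, h (k j) u) (An (k j)) \<and> w \<notin> open_nbhd \<epsilon> ?Z"
      by (rule strict_mono_counterexamples) blast
    then obtain w where w: "\<And>j. w j \<in> C" "\<And>j. w j \<in> laguerre_cell (v, h (k j) v) (An (k j))"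
      "\<And>j. w j \<in> laguerre_cell (u, h (k j) u) (An (k j))" "\<And>j. w j \<notin> open_nbhd \<epsilon> ?Z" by metis
    obtain l s where s: "strict_mono (s :: nat \<Rightarrow> nat)" "(w \<circ> s) \<longlonglongrightarrow> l"
      using assms(2) w(1) unfolding compact_def by blast
    have ks: "strict_mono (k \<circ> s)" using k(1) s(1) by (rule strict_mono_o)
    have "l \<in> laguerre_cell (v, 0) (at_height_0 A)" "l \<in> laguerre_cell (u, 0) (at_height_0 A)"
      using laguerre_cell_limit[OF _ ks s(2)] w(2,3) vu F(2) by auto
    then have "l \<in> ?Z" using vu F(2) by (auto simp: lim_skel_eq)
    moreover obtain j where "dist ((w \<circ> s) j) l < \<epsilon>"
      using s(2) assms(1) unfolding lim_sequentially by (meson order_refl)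
    ultimately have "w (s j) \<in> open_nbhd \<epsilon> ?Z" by (auto simp: open_nbhd_def dist_norm)
    then show False using w(4) by blast
  qed
  then have "\<forall>\<^sub>F n in sequentially. \<forall>v\<in>F. \<forall>u\<in>F - {v}. \<not> (\<exists>w\<in>C. w \<in> laguerre_cell (v, h n v) (An n) \<and>
      w \<in> laguerre_cell (u, h n u) (An n) \<and> w \<notin> open_nbhd \<epsilon> ?Z)"
    using F(1) by (simp add: eventually_ball_finite_distrib)
  then show ?thesis using F(4)
  proof eventually_elim
    case (elim n)
    show ?case
    proof safe
      fix w assume w: "w \<in> skel (laguerre (An n))" "w \<notin> open_nbhd \<epsilon> ?Z" "w \<in> C"
      obtain p q where pq: "p \<in> An n" "q \<in> An n" "p \<noteq> q" "w \<in> laguerre_cell p (An n)" "w \<in> laguerre_cell q (An n)"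
        using w(1) unfolding skel_laguerre_eq[OF An] by blast
      have "w \<in> cball 0 R" using w R by auto
      then have "laguerre_cell p (An n) \<inter> cball 0 R \<noteq> {}" "laguerre_cell q (An n) \<inter> cball 0 R \<noteq> {}"
        using pq by blast+
      then have *: "fst p \<in> F" "p = (fst p, h n (fst p))" "fst q \<in> F" "q = (fst q, h n (fst q))"
        using elim(2) pq(1,2) by blast+
      then have "fst q \<in> F - {fst p}" using pq(3) by auto
      then have "\<not> (w \<in> laguerre_cell (fst p, h n (fst p)) (An n) \<and> w \<in> laguerre_cell (fst q, h n (fst q)) (An n))"
        using elim(1) *(1) w(2,3) by blast
      then show "w \<in> {}" using * pq(4,5) by simp
    qed
  qed
qed

text \<open>A ball free of skeleton points lies in a single cell. If this kept happening for one
  site at points of the limit skeleton, the limit would put a ball around such a point inside one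
  limit cell, contradicting \<open>not_interior_laguerre_cell\<close>.\<close>

lemma eventually_skel_lower:
  assumes "\<epsilon> > 0" "compact C"
  shows "\<forall>\<^sub>F n in sequentially. (skel (laguerre (at_height_0 A)) - open_nbhd \<epsilon> (skel (laguerre (An n)))) \<inter> C = {}"
proof -
  let ?Z = "skel (laguerre (at_height_0 A))"
  obtain R0 where R0: "C \<subseteq> cball 0 R0"
    using bounded_subset_ballD[OF compact_imp_bounded[OF assms(2)], of 0] ball_subset_cball by blast
  \<comment> \<open>Enlarging by \<epsilon> keeps the balls around points of \<open>C\<close> inside
    the window.\<close>
  define R where "R = R0 + \<epsilon>"
  have R: "ball w \<epsilon> \<subseteq> cball 0 R" if "w \<in> C" for w
  proof
    fix x assume "x \<in> ball w \<epsilon>"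
    then show "x \<in> cball 0 R"
      using that R0 norm_triangle_ineq2[of x w] by (force simp: R_def dist_norm norm_minus_commute)
  qed
  obtain F where F: "finite F" "F \<subseteq> A"
    "\<forall>v\<in>A. laguerre_cell (v, 0) (at_height_0 A) \<inter> cball 0 R \<noteq> {} \<longrightarrow> v \<in> F"
    "\<forall>\<^sub>F n in sequentially. (\<forall>v\<in>F. (v, h n v) \<in> An n) \<and>
       (\<forall>p\<in>An n. laguerre_cell p (An n) \<inter> cball 0 R \<noteq> {} \<longrightarrow> fst p \<in> F \<and> p = (fst p, h n (fst p)))"
    using relevant_points[of R] by blast
  obtain a where a: "a \<in> A" using spread_nonempty[OF spread] by auto
  have closedZ: "closed ?Z" by (rule closed_skel_laguerre[OF A0])
  have "\<forall>\<^sub>F n in sequentially. \<not> (\<exists>w\<in>C \<inter> ?Z. ball w \<epsilon> \<subseteq> laguerre_cell (v, h n v) (An n))"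
    if v: "v \<in> F" for v
  proof (rule ccontr)
    assume "\<not> ?thesis"
    then obtain k :: "nat \<Rightarrow> nat" where k: "strict_mono k"
        "\<And>j. \<exists>w\<in>C \<inter> ?Z. ball w \<epsilon> \<subseteq> laguerre_cell (v, h (k j) v) (An (k j))"
      by (rule strict_mono_counterexamples) blast
    then obtain w where w: "\<And>j. w j \<in> C \<inter> ?Z" "\<And>j. ball (w j) \<epsilon> \<subseteq> laguerre_cell (v, h (k j) v) (An (k j))"
      by metis
    have "compact (C \<inter> ?Z)" using assms(2) closedZ by (rule compact_Int_closed)
    then obtain l s where s: "l \<in> C \<inter> ?Z" "strict_mono (s :: nat \<Rightarrow> nat)" "(w \<circ> s) \<longlonglongrightarrow> l"
      using w(1) unfolding compact_def by blast
    have ks: "strict_mono (k \<circ> s)" using k(1) s(2) by (rule strict_mono_o)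
    have "ball l \<epsilon> \<subseteq> laguerre_cell (v, 0) (at_height_0 A)"
    proof
      fix x assume x: "x \<in> ball l \<epsilon>"
      show "x \<in> laguerre_cell (v, 0) (at_height_0 A)"
      proof (rule laguerre_cell_limit[OF _ ks])
        show "v \<in> A" using v F(2) by auto
        have "(\<lambda>j. (w \<circ> s) j + (x - l)) \<longlonglongrightarrow> l + (x - l)" by (intro tendsto_intros s(3))
        then show "(\<lambda>j. (w \<circ> s) j + (x - l)) \<longlonglongrightarrow> x" by simp
        have "(w \<circ> s) j + (x - l) \<in> ball (w (s j)) \<epsilon>" for j
          using x by (simp add: dist_norm norm_minus_commute)
        then show "(w \<circ> s) j + (x - l) \<in> laguerre_cell (v, h ((k \<circ> s) j) v) (An ((k \<circ> s) j))" for j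
          using w(2)[of "s j"] unfolding o_def by blast
      qed
    qed
    then have int: "l \<in> interior (laguerre_cell (v, 0) (at_height_0 A))"
      using assms(1) by (meson mem_interior)
    obtain u where "u \<in> A" "u \<noteq> v" "l \<in> laguerre_cell (u, 0) (at_height_0 A)"
      using s(1) unfolding lim_skel_eq by auto
    then have "l \<notin> interior (laguerre_cell (v, 0) (at_height_0 A))"
      using v F(2) by (intro not_interior_laguerre_cell) (auto simp: at_height_0_def)
    then show False using int by blast
  qed
  then have "\<forall>\<^sub>F n in sequentially. \<forall>v\<in>F. \<not> (\<exists>w\<in>C \<inter> ?Z. ball w \<epsilon> \<subseteq> laguerre_cell (v, h n v) (An n))"
    using F(1) by (simp add: eventually_ball_finite_distrib)
  then show ?thesis using F(4) ev[OF a]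
  proof eventually_elim
    case (elim n)
    have "w \<in> open_nbhd \<epsilon> (skel (laguerre (An n)))" if w: "w \<in> C" "w \<in> ?Z" for w
    proof (rule ccontr)
      assume "\<not> ?thesis"
      then have no: "ball w \<epsilon> \<inter> skel (laguerre (An n)) = {}"
        by (auto simp: open_nbhd_def dist_norm)
      obtain p where p: "p \<in> An n" "w \<in> laguerre_cell p (An n)"
        using ex_laguerre_cell[OF An] elim(3) by blast
      have "w \<in> ball w \<epsilon>" using assms(1) by simp
      define Q where "Q = {r\<in>An n. laguerre_cell r (An n) \<inter> cball 0 R \<noteq> {}} - {p}"
      have finQ: "finite Q" using finite_relevant[OF An] by (simp add: Q_def)
      define D where "D = (\<Union>r\<in>Q. laguerre_cell r (An n))"
      have "closed D" unfolding D_def using finQ by (auto intro: closed_laguerre_cell)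
      have cov: "ball w \<epsilon> \<subseteq> laguerre_cell p (An n) \<union> D"
      proof
        fix x assume x: "x \<in> ball w \<epsilon>"
        obtain r where r: "r \<in> An n" "x \<in> laguerre_cell r (An n)"
          using ex_laguerre_cell[OF An] p(1) by blast
        have "x \<in> cball 0 R" using x R w(1) by blast
        then have "laguerre_cell r (An n) \<inter> cball 0 R \<noteq> {}" using r by blast
        then show "x \<in> laguerre_cell p (An n) \<union> D" using r by (auto simp: D_def Q_def)
      qed
      \<comment> \<open>Two cells can only meet on the skeleton, so the cell of \<open>p\<close> and
        the union of the others cut the ball into disjoint relatively closed parts, and
        connectedness leaves only one.\<close>
      have "laguerre_cell p (An n) \<inter> D \<inter> ball w \<epsilon> = {}"
        using no p(1) unfolding skel_laguerre_eq[OF An] D_def Q_def by blast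
      then have "laguerre_cell p (An n) \<inter> ball w \<epsilon> = {} \<or> D \<inter> ball w \<epsilon> = {}"
        using connected_ball[of w \<epsilon>] \<open>closed D\<close> cov closed_laguerre_cell[of p "An n"]
        unfolding connected_closed by blast
      then have "ball w \<epsilon> \<subseteq> laguerre_cell p (An n)" using cov p(2) \<open>w \<in> ball w \<epsilon>\<close> by blast
      moreover have "laguerre_cell p (An n) \<inter> cball 0 R \<noteq> {}"
        using p(2) R[OF w(1)] \<open>w \<in> ball w \<epsilon>\<close> by blast
      moreover from this have "fst p \<in> F" "p = (fst p, h n (fst p))" using elim(2) p(1) by blast+
      ultimately show False using elim(1) w by fastforce
    qed
    then show ?case by blast
  qed
qed

lemma lift_dual:
  assumes "S \<subseteq> at_height_0 A"
  shows "S = (\<lambda>v. (v, 0)) ` fst ` S" "fst ` S \<subseteq> A" "card (fst ` S) = card S"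
proof -
  show "S = (\<lambda>v. (v, 0)) ` fst ` S" using assms by (force simp: at_height_0_def)
  show "fst ` S \<subseteq> A" using assms by (force simp: at_height_0_def)
  show "card (fst ` S) = card S"
    using assms by (intro card_image) (auto simp: at_height_0_def inj_on_def)
qed

text \<open>By \<open>generic\<close> all other points of \<open>A\<close> are strictly farther from
  \<open>w\<close> than the vertices. Near \<open>w\<close> only finitely many sites compete, so the
  gaps persist at the perturbed centres \<open>c n\<close>. The cell owning \<open>c n\<close>
  therefore belongs to a vertex, and by equality of powers \<open>c n\<close> lies in the cells of
  all vertices.\<close>

lemma eventually_dual_simplex:
  assumes V: "V \<subseteq> A" "card V = DIM('a) + 1" "w \<in> (\<Inter>v\<in>V. laguerre_cell (v, 0) (at_height_0 A))"
  shows "\<forall>\<^sub>F n in sequentially. (\<Inter>v\<in>V. laguerre_cell (v, h n v) (An n)) \<noteq> {}"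
proof -
  have finV: "finite V" using V(2) card.infinite by fastforce
  have "V \<noteq> {}" using V(2) by auto
  then obtain a where a: "a \<in> V" by auto
  then have "a \<in> A" using V by auto
  have eq: "norm (w - v) = norm (w - u)" if "v \<in> V" "u \<in> V" for u v
  proof -
    have "lpow w (v, 0) = lpow w (u, 0)"
      using V that by (intro antisym) (fastforce simp: laguerre_cell_def at_height_0_def)+
    then show ?thesis by (simp add: lpow_def)
  qed
  have ind: "\<not> affine_dependent V"
    using generic V(1) finV V(2) unfolding generic_def by (metis order_refl)
  obtain c where c: "c \<longlonglongrightarrow> w"
    "\<And>n v v'. v \<in> V \<Longrightarrow> v' \<in> V \<Longrightarrow> lpow (c n) (v, h n v) = lpow (c n) (v', h n v')"
    using perturbed_power_centre[OF ind finV eq, of h] h V(1) by blast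
  have strict: "lpow w (a, 0) < lpow w (u, 0)" if "u \<in> A - V" for u
  proof -
    have "lpow w (a, 0) \<le> lpow w (u, 0)"
      using V(3) a that by (fastforce simp: laguerre_cell_def at_height_0_def)
    moreover have "lpow w (a, 0) \<noteq> lpow w (u, 0)"
    proof
      assume "lpow w (a, 0) = lpow w (u, 0)"
      then have "norm (w - u) = norm (w - a)" by (simp add: lpow_def)
      then have *: "\<forall>v\<in>insert u V. norm (w - v) = norm (w - a)" using eq[OF _ a] by (metis insert_iff)
      have "insert u V \<subseteq> A" "card (insert u V) = DIM('a) + 2"
        using that V finV by auto
      then have "\<not> (\<exists>w r. \<forall>v\<in>insert u V. norm (w - v) = r)"
        using generic unfolding generic_def by blast
      then show False using * by blast
    qed
    ultimately show ?thesis by simp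
  qed
  obtain F where F: "finite F" "F \<subseteq> A"
    "\<forall>v\<in>A. laguerre_cell (v, 0) (at_height_0 A) \<inter> cball 0 (norm w + 1) \<noteq> {} \<longrightarrow> v \<in> F"
    "\<forall>\<^sub>F n in sequentially. (\<forall>v\<in>F. (v, h n v) \<in> An n) \<and>
       (\<forall>p\<in>An n. laguerre_cell p (An n) \<inter> cball 0 (norm w + 1) \<noteq> {} \<longrightarrow> fst p \<in> F \<and> p = (fst p, h n (fst p)))"
    using relevant_points[of "norm w + 1"] by blast
  have lim: "(\<lambda>n. lpow (c n) (u, h n u)) \<longlonglongrightarrow> lpow w (u, 0)" if "u \<in> A" for u
    unfolding lpow_def fst_conv snd_conv by (intro tendsto_intros c(1) h that)
  have "\<forall>\<^sub>F n in sequentially. \<forall>u\<in>F - V. lpow (c n) (a, h n a) < lpow (c n) (u, h n u)"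
  proof -
    have "\<forall>\<^sub>F n in sequentially. lpow (c n) (a, h n a) < lpow (c n) (u, h n u)" if "u \<in> F - V" for u
    proof -
      have u: "u \<in> A" "u \<in> A - V" using that F(2) by auto
      have "(\<lambda>n. lpow (c n) (u, h n u) - lpow (c n) (a, h n a)) \<longlonglongrightarrow> lpow w (u, 0) - lpow w (a, 0)"
        by (intro tendsto_diff lim u \<open>a \<in> A\<close>)
      then have "\<forall>\<^sub>F n in sequentially. 0 < lpow (c n) (u, h n u) - lpow (c n) (a, h n a)"
        by (rule order_tendstoD(1)) (use strict[OF u(2)] in simp)
      then show ?thesis by eventually_elim simp
    qed
    then show ?thesis using F(1) by (simp add: eventually_ball_finite_distrib)
  qed
  moreover have "\<forall>\<^sub>F n in sequentially. norm (c n) < norm w + 1"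
    by (rule order_tendstoD[OF tendsto_norm[OF c(1)]]) simp
  ultimately show ?thesis using F(4) ev[OF \<open>a \<in> A\<close>]
  proof eventually_elim
    case (elim n)
    obtain p where p: "p \<in> An n" "c n \<in> laguerre_cell p (An n)"
      using ex_laguerre_cell[OF An] elim(4) by blast
    moreover have "c n \<in> cball 0 (norm w + 1)" using elim(2) by auto
    ultimately obtain u where u: "u \<in> F" "p = (u, h n u)" using elim(3) by blast
    have "lpow (c n) (u, h n u) \<le> lpow (c n) (a, h n a)"
      using p elim(4) u(2) by (auto simp: laguerre_cell_def)
    then have "u \<in> V" using elim(1) u(1) by (meson DiffI not_le)
    have "c n \<in> laguerre_cell (v, h n v) (An n)" if "v \<in> V" for v
      using p(2) c(2)[OF that \<open>u \<in> V\<close>, of n] u(2) by (simp add: laguerre_cell_def)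
    then show ?case by blast
  qed
qed

text \<open>Near the window both skeletons come from vertex sets in one finite family \<V>, and the
  boundary attached to a vertex set does not see the heights. It remains to match which sets occur:
  from \<open>An n\<close> to the limit by compactness of the ball holding the centres, conversely
  by \<open>eventually_dual_simplex\<close>.\<close>

lemma eventually_skel_dual:
  "\<forall>\<^sub>F n in sequentially. skel (laguerre_dual (An n)) \<inter> cball 0 R =
     skel (laguerre_dual (at_height_0 A)) \<inter> cball 0 R"
proof -
  define R0 where "R0 = max R 0"
  have R0: "0 \<le> R0" by (simp add: R0_def)
  obtain F0 where F0: "F0 \<subseteq> A" "finite F0" "\<And>e. norm e = 1 \<Longrightarrow> (\<exists>v\<in>F0. R0 + 1 \<le> v \<bullet> e)"
    using spread unfolding spread_def by blast
  \<comment> \<open>The height bound 1 covers the limit, where heights are 0, as well as all large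
    \<open>n\<close> for the finitely many sites in \<open>F0\<close>.\<close>
  obtain R' where R': "\<And>A S w. (\<And>p. p \<in> A \<Longrightarrow> 0 \<le> snd p) \<Longrightarrow> (\<And>v. v \<in> F0 \<Longrightarrow> \<exists>h\<le>1. (v, h) \<in> A) \<Longrightarrow>
    S \<subseteq> A \<Longrightarrow> w \<in> (\<Inter>p\<in>S. laguerre_cell p A) \<Longrightarrow>
    convex hull (fst ` S) \<inter> cball 0 R0 \<noteq> {} \<Longrightarrow> norm w \<le> R'"
    using dual_centers_bounded[OF F0(2,3) R0, of 1] by blast
  obtain F where F: "finite F" "F \<subseteq> A"
    "\<forall>v\<in>A. laguerre_cell (v, 0) (at_height_0 A) \<inter> cball 0 R' \<noteq> {} \<longrightarrow> v \<in> F"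
    "\<forall>\<^sub>F n in sequentially. (\<forall>v\<in>F. (v, h n v) \<in> An n) \<and>
       (\<forall>p\<in>An n. laguerre_cell p (An n) \<inter> cball 0 R' \<noteq> {} \<longrightarrow> fst p \<in> F \<and> p = (fst p, h n (fst p)))"
    using relevant_points[of R'] by blast
  define \<V> where "\<V> = {V. V \<subseteq> F \<and> card V = DIM('a) + 1}"
  have fin\<V>: "finite \<V>" using F(1) by (simp add: \<V>_def)
  have front: "x \<in> convex hull X" if "x \<in> frontier (convex hull X)" "finite X" for x :: 'a and X
    using frontier_subset_closed[OF compact_imp_closed[OF compact_convex_hull[OF finite_imp_compact[OF that(2)]]]] that(1)
    by blast
  have "\<forall>\<^sub>F n in sequentially. (\<Inter>v\<in>V. laguerre_cell (v, h n v) (An n)) \<inter> cball 0 R' \<noteq> {} \<longrightarrow>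
      (\<Inter>v\<in>V. laguerre_cell (v, 0) (at_height_0 A)) \<noteq> {}" if V: "V \<in> \<V>" for V
  proof (rule ccontr)
    assume "\<not> ?thesis"
    then obtain k :: "nat \<Rightarrow> nat" where k: "strict_mono k"
      "\<And>j. \<not> ((\<Inter>v\<in>V. laguerre_cell (v, h (k j) v) (An (k j))) \<inter> cball 0 R' \<noteq> {} \<longrightarrow>
      (\<Inter>v\<in>V. laguerre_cell (v, 0) (at_height_0 A)) \<noteq> {})"
      by (rule strict_mono_counterexamples) blast
    then have "\<forall>j. \<exists>w. w \<in> (\<Inter>v\<in>V. laguerre_cell (v, h (k j) v) (An (k j))) \<inter> cball 0 R'" by blast
    then obtain w where w: "\<And>j. w j \<in> (\<Inter>v\<in>V. laguerre_cell (v, h (k j) v) (An (k j))) \<inter> cball 0 R'"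
      by metis
    obtain l s where s: "strict_mono (s :: nat \<Rightarrow> nat)" "(w \<circ> s) \<longlonglongrightarrow> l"
      using compact_cball[of "0::'a" R'] w unfolding compact_def by blast
    have ks: "strict_mono (k \<circ> s)" using k(1) s(1) by (rule strict_mono_o)
    have "l \<in> laguerre_cell (v, 0) (at_height_0 A)" if "v \<in> V" for v
      using laguerre_cell_limit[OF _ ks s(2), of v] w that F(2) V by (auto simp: \<V>_def)
    then show False using k(2)[of 0] by blast
  qed
  then have "\<forall>\<^sub>F n in sequentially. \<forall>V\<in>\<V>. (\<Inter>v\<in>V. laguerre_cell (v, h n v) (An n)) \<inter> cball 0 R' \<noteq> {} \<longrightarrow>
      (\<Inter>v\<in>V. laguerre_cell (v, 0) (at_height_0 A)) \<noteq> {}"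
    using fin\<V> by (simp add: eventually_ball_finite_distrib)
  moreover have "\<forall>\<^sub>F n in sequentially. \<forall>V\<in>\<V>. (\<Inter>v\<in>V. laguerre_cell (v, 0) (at_height_0 A)) \<noteq> {} \<longrightarrow>
     (\<Inter>v\<in>V. laguerre_cell (v, h n v) (An n)) \<noteq> {}"
  proof -
    have "\<forall>\<^sub>F n in sequentially. (\<Inter>v\<in>V. laguerre_cell (v, 0) (at_height_0 A)) \<noteq> {} \<longrightarrow>
     (\<Inter>v\<in>V. laguerre_cell (v, h n v) (An n)) \<noteq> {}" if "V \<in> \<V>" for V
    proof (cases "(\<Inter>v\<in>V. laguerre_cell (v, 0) (at_height_0 A)) = {}")
      case False
      then obtain w where "w \<in> (\<Inter>v\<in>V. laguerre_cell (v, 0) (at_height_0 A))" by blast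
      then have "\<forall>\<^sub>F n in sequentially. (\<Inter>v\<in>V. laguerre_cell (v, h n v) (An n)) \<noteq> {}"
        using that F(2) by (intro eventually_dual_simplex) (auto simp: \<V>_def)
      then show ?thesis by eventually_elim auto
    qed auto
    then show ?thesis using fin\<V> by (simp add: eventually_ball_finite_distrib)
  qed
  moreover have "\<forall>\<^sub>F n in sequentially. \<forall>v\<in>F0. h n v < 1 \<and> (v, h n v) \<in> An n"
  proof -
    have "\<forall>\<^sub>F n in sequentially. h n v < 1 \<and> (v, h n v) \<in> An n" if "v \<in> F0" for v
      using that F0(1) by (intro eventually_conj ev order_tendstoD[OF h]) auto
    then show ?thesis using F0(2) by (simp add: eventually_ball_finite_distrib)
  qed
  ultimately show ?thesis using F(4)
  proof eventually_elim
    case (elim n)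
    have F0n: "\<exists>x\<le>1. (v, x) \<in> An n" if "v \<in> F0" for v
      using elim(3) that less_imp_le by blast
    have F00: "\<exists>x\<le>1. (v, x) \<in> at_height_0 A" if "v \<in> F0" for v
      using F0(1) that by (auto simp: at_height_0_def intro!: exI[of _ "0::real"])
    show ?case
    proof (intro equalityI subsetI IntI)
      fix x assume x: "x \<in> skel (laguerre_dual (An n)) \<inter> cball 0 R"
      then show "x \<in> cball 0 R" by auto
      obtain S where S: "S \<subseteq> An n" "card S = DIM('a) + 1" "(\<Inter>p\<in>S. laguerre_cell p (An n)) \<noteq> {}"
          "x \<in> frontier (convex hull (fst ` S))"
        using x by (auto simp: skel_def laguerre_dual_def)
      then obtain w where w: "w \<in> (\<Inter>p\<in>S. laguerre_cell p (An n))" by blast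
      have finS: "finite S" using S(2) card.infinite by fastforce
      have "x \<in> convex hull (fst ` S) \<inter> cball 0 R0" using front[OF S(4)] finS x by (auto simp: R0_def)
      then have wR: "norm w \<le> R'"
        by (intro R'[OF weighted_configD(2)[OF An[of n]] F0n S(1) w]) blast+
      have cell: "fst p \<in> F \<and> p = (fst p, h n (fst p))" if "p \<in> S" for p
      proof -
        have "w \<in> laguerre_cell p (An n) \<inter> cball 0 R'" using w wR that by auto
        then show ?thesis using elim(4) S(1) that by blast
      qed
      have "card (fst ` S) = card S"
        using weighted_configD(3)[OF An] S(1) by (intro card_image) (rule inj_on_subset)
      then have V: "fst ` S \<in> \<V>" using cell S(2) by (auto simp: \<V>_def)
      have "w \<in> laguerre_cell (v, h n v) (An n)" if "v \<in> fst ` S" for v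
        using that cell w by fastforce
      then have "w \<in> (\<Inter>v\<in>fst ` S. laguerre_cell (v, h n v) (An n)) \<inter> cball 0 R'" using wR by auto
      then have "(\<Inter>v\<in>fst ` S. laguerre_cell (v, 0) (at_height_0 A)) \<noteq> {}" using elim(1) V by blast
      moreover define S0 where "S0 = (\<lambda>v. (v, 0::real)) ` fst ` S"
      ultimately have "(\<Inter>p\<in>S0. laguerre_cell p (at_height_0 A)) \<noteq> {}" by auto
      moreover have "S0 \<subseteq> at_height_0 A" using V F(2) by (auto simp: S0_def \<V>_def at_height_0_def)
      moreover have "card S0 = DIM('a) + 1"
        unfolding S0_def using V by (subst card_image) (auto simp: inj_on_def \<V>_def)
      moreover have "fst ` S0 = fst ` S" by (force simp: S0_def)
      ultimately show "x \<in> skel (laguerre_dual (at_height_0 A))"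
        using S(4) by (intro skel_laguerre_dualI[of S0]) simp_all
    next
      fix x assume x: "x \<in> skel (laguerre_dual (at_height_0 A)) \<inter> cball 0 R"
      then show "x \<in> cball 0 R" by auto
      obtain S where S: "S \<subseteq> at_height_0 A" "card S = DIM('a) + 1" "(\<Inter>p\<in>S. laguerre_cell p (at_height_0 A)) \<noteq> {}"
          "x \<in> frontier (convex hull (fst ` S))"
        using x by (auto simp: skel_def laguerre_dual_def)
      then obtain w where w: "w \<in> (\<Inter>p\<in>S. laguerre_cell p (at_height_0 A))" by blast
      have finS: "finite S" using S(2) card.infinite by fastforce
      have "x \<in> convex hull (fst ` S) \<inter> cball 0 R0" using front[OF S(4)] finS x by (auto simp: R0_def)
      then have wR: "norm w \<le> R'"
        by (intro R'[OF weighted_configD(2)[OF A0] F00 S(1) w]) blast+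
      have cells: "w \<in> laguerre_cell (v, 0) (at_height_0 A)" if "v \<in> fst ` S" for v
        using w that lift_dual(1)[OF S(1)] by blast
      then have "v \<in> F" if "v \<in> fst ` S" for v
        using that F(3) wR lift_dual(2)[OF S(1)] cells[OF that] by force
      then have V: "fst ` S \<in> \<V>" using S(2) lift_dual(3)[OF S(1)] by (auto simp: \<V>_def)
      then have "(\<Inter>v\<in>fst ` S. laguerre_cell (v, h n v) (An n)) \<noteq> {}"
        using elim(2) cells by blast
      moreover define Sn where "Sn = (\<lambda>v. (v, h n v)) ` fst ` S"
      ultimately have "(\<Inter>p\<in>Sn. laguerre_cell p (An n)) \<noteq> {}" by auto
      moreover have "Sn \<subseteq> An n" using V elim(4) by (auto simp: Sn_def \<V>_def)
      moreover have "card Sn = DIM('a) + 1"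
        unfolding Sn_def using V by (subst card_image) (auto simp: inj_on_def \<V>_def)
      moreover have "fst ` Sn = fst ` S" by (force simp: Sn_def)
      ultimately show "x \<in> skel (laguerre_dual (An n))"
        using S(4) by (intro skel_laguerre_dualI[of Sn]) simp_all
    qed
  qed
qed

end

section \<open>Measurability of the skeletons\<close>

text \<open>By compactness of \<open>K\<close> the existential quantifier can be moved to a countable dense subset
  at the price of a slack \<open>1/(m+1)\<close> in the first \<open>m+1\<close> constraints.\<close>

lemma sets_Collect_ex_compact:
  fixes g :: "'i::countable \<Rightarrow> 'w \<Rightarrow> 'b::{metric_space, second_countable_topology} \<Rightarrow> real"
  assumes K: "compact K"
    and meas: "\<And>i w. (\<lambda>x. g i x w) \<in> borel_measurable M"
    and cont: "\<And>i x. x \<in> space M \<Longrightarrow> continuous_on K (g i x)"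
  shows "{x\<in>space M. \<exists>w\<in>K. \<forall>i. g i x w \<le> 0} \<in> sets M"
proof -
  obtain D where D: "countable D" "D \<subseteq> K" "K \<subseteq> closure D" using separable by metis
  define g' where "g' n = g (from_nat n)" for n :: nat
  have all: "(\<forall>i. P i) \<longleftrightarrow> (\<forall>n. P (from_nat n))" for P :: "'i \<Rightarrow> bool"
    by (metis from_nat_to_nat)
  have "{x\<in>space M. \<exists>w\<in>K. \<forall>i. g i x w \<le> 0}
      = {x\<in>space M. \<forall>m::nat. \<exists>w\<in>D. \<forall>n\<in>{..m}. g' n x w < 1 / real (Suc m)}"
  proof (intro Collect_cong conj_cong refl iffI allI)
    fix x and m :: nat assume x: "x \<in> space M" and "\<exists>w\<in>K. \<forall>i. g i x w \<le> 0"
    then obtain w where w: "w \<in> K" "\<And>i. g i x w \<le> 0" by auto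
    have "\<exists>e>0. \<forall>w'\<in>K. dist w' w < e \<longrightarrow> g' n x w' < 1 / real (Suc m)" for n
    proof -
      have "0 < 1 / real (Suc m)" by simp
      then obtain e where "e > 0" "\<forall>w'\<in>K. dist w' w < e \<longrightarrow> dist (g' n x w') (g' n x w) < 1 / real (Suc m)"
        using cont[OF x, of "from_nat n"] w(1) unfolding continuous_on_iff g'_def by metis
      moreover have "g' n x w \<le> 0" using w(2) by (simp add: g'_def)
      ultimately show ?thesis by (intro exI[of _ e]) (auto simp: dist_real_def)
    qed
    then obtain e where e: "\<And>n. e n > 0" "\<And>n w'. w' \<in> K \<Longrightarrow> dist w' w < e n \<Longrightarrow> g' n x w' < 1 / real (Suc m)"
      by metis
    define e0 where "e0 = Min (e ` {..m})"
    have "e0 > 0" using e(1) by (simp add: e0_def)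
    moreover have "w \<in> closure D" using w(1) D(3) by auto
    ultimately obtain w' where w': "w' \<in> D" "dist w' w < e0" unfolding closure_approachable by metis
    have "dist w' w < e n" if "n \<le> m" for n
    proof -
      have "e0 \<le> e n" using that by (auto simp: e0_def intro: Min_le)
      then show ?thesis using w'(2) by simp
    qed
    then show "\<exists>w\<in>D. \<forall>n\<in>{..m}. g' n x w < 1 / real (Suc m)" using e(2) w'(1) D(2) by blast
  next
    fix x assume x: "x \<in> space M" and *: "\<forall>m::nat. \<exists>w\<in>D. \<forall>n\<in>{..m}. g' n x w < 1 / real (Suc m)"
    then obtain w where w: "\<And>m::nat. w m \<in> D" "\<And>m n. n \<le> m \<Longrightarrow> g' n x (w m) < 1 / real (Suc m)"
      by (metis atMost_iff)
    have "\<forall>m. w m \<in> K" using w(1) D(2) by blast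
    then obtain l s where l: "l \<in> K" "strict_mono (s :: nat \<Rightarrow> nat)" "(w \<circ> s) \<longlonglongrightarrow> l"
      using K unfolding compact_def by blast
    have "g' n x l \<le> 0" for n
    proof (rule tendsto_le[OF sequentially_bot])
      show "(\<lambda>j. g' n x ((w \<circ> s) j)) \<longlonglongrightarrow> g' n x l"
        unfolding g'_def using \<open>\<forall>m. w m \<in> K\<close>
        by (intro continuous_on_tendsto_compose[OF cont[OF x] l(3,1)]) simp
      have "(\<lambda>m. 1 / real (Suc m)) \<longlonglongrightarrow> 0" by (rule LIMSEQ_Suc[OF lim_1_over_n])
      from LIMSEQ_subseq_LIMSEQ[OF this l(2)]
      show "(\<lambda>j. 1 / real (Suc (s j))) \<longlonglongrightarrow> 0" by (simp add: o_def)
      show "\<forall>\<^sub>F j in sequentially. g' n x ((w \<circ> s) j) \<le> 1 / real (Suc (s j))"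
        using eventually_ge_at_top[of n]
      proof eventually_elim
        case (elim j)
        then have "n \<le> s j" using seq_suble[OF l(2), of j] by linarith
        then show ?case using w(2)[of n "s j"] by simp
      qed
    qed
    then have "\<forall>i. g i x l \<le> 0" unfolding all[of "\<lambda>i. g i x l \<le> 0"] g'_def by blast
    then show "\<exists>w\<in>K. \<forall>i. g i x w \<le> 0" using l(1) by blast
  qed
  moreover have "{x\<in>space M. \<forall>m::nat. \<exists>w\<in>D. \<forall>n\<in>{..m}. g' n x w < 1 / real (Suc m)} \<in> sets M"
  proof -
    have "{x\<in>space M. g' n x w < c} \<in> sets M" for n w c
      using meas[of "from_nat n" w] by (simp add: g'_def)
    then show ?thesis using D(1)
      by (intro sets.sets_Collect_countable_All sets.sets_Collect_countable_Bex sets.sets_Collect_countable_Ball) auto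
  qed
  ultimately show ?thesis by simp
qed

text \<open>A point outside the hull is strictly separated by some normal, and strict separation
  from finitely many points is an open condition on the normal. Testing a dense set of normals is
  thus enough, which brings hull membership into the form of
  \<open>sets_Collect_ex_compact\<close>.\<close>

lemma mem_convex_hull_iff_support:
  fixes S :: "'a::euclidean_space set"
  assumes S: "finite S" "S \<noteq> {}" and D: "closure D = UNIV"
  shows "z \<in> convex hull S \<longleftrightarrow> (\<forall>y\<in>D. z \<bullet> y \<le> Max ((\<lambda>s. s \<bullet> y) ` S))"
proof
  assume z: "z \<in> convex hull S"
  show "\<forall>y\<in>D. z \<bullet> y \<le> Max ((\<lambda>s. s \<bullet> y) ` S)"
  proof
    fix y
    have "convex hull S \<subseteq> {x. y \<bullet> x \<le> Max ((\<lambda>s. s \<bullet> y) ` S)}"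
      using S by (intro hull_minimal convex_halfspace_le) (auto simp: inner_commute[of y] intro!: Max_ge)
    then show "z \<bullet> y \<le> Max ((\<lambda>s. s \<bullet> y) ` S)" using z by (auto simp: inner_commute)
  qed
next
  assume *: "\<forall>y\<in>D. z \<bullet> y \<le> Max ((\<lambda>s. s \<bullet> y) ` S)"
  show "z \<in> convex hull S"
  proof (rule ccontr)
    assume "z \<notin> convex hull S"
    moreover have "closed (convex hull S)"
      by (rule compact_imp_closed[OF compact_convex_hull[OF finite_imp_compact[OF S(1)]]])
    ultimately obtain a b where ab: "a \<bullet> z < b" "\<forall>x\<in>convex hull S. a \<bullet> x > b"
      using separating_hyperplane_closed_point[OF convex_convex_hull] by blast
    define U where "U = (\<Inter>s\<in>S. {y. s \<bullet> y < z \<bullet> y})"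
    have "open U" unfolding U_def using S(1) by (intro open_INT) (auto intro!: open_Collect_less continuous_intros)
    moreover have "- a \<in> U"
      using ab hull_subset[of S convex] by (force simp: U_def inner_commute)
    ultimately obtain y where y: "y \<in> D" "y \<in> U"
      using D open_Int_closure_eq_empty[of U D] by auto
    have "Max ((\<lambda>s. s \<bullet> y) ` S) < z \<bullet> y" using y(2) S by (auto simp: U_def)
    then show False using * y(1) by auto
  qed
qed

lemma sets_Collect_convex_hull_hit:
  fixes v :: "'i \<Rightarrow> 'w \<Rightarrow> 'a::euclidean_space"
  assumes I: "finite I" "I \<noteq> {}" and v: "\<And>i. i \<in> I \<Longrightarrow> v i \<in> borel_measurable M" and K: "compact K"
  shows "{x\<in>space M. K \<inter> convex hull ((\<lambda>i. v i x) ` I) \<noteq> {}} \<in> sets M"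
proof -
  obtain D :: "'a set" where D: "countable D" "UNIV \<subseteq> closure D" using separable by metis
  then have D': "closure D = UNIV" by auto
  then have "D \<noteq> {}" by auto
  define g where "g n x z = z \<bullet> from_nat_into D n - Max ((\<lambda>i. v i x \<bullet> from_nat_into D n) ` I)" for n :: nat and x z
  have mx: "(\<lambda>x. Max ((\<lambda>i. f i x) ` I)) \<in> borel_measurable M" if "\<And>i. i \<in> I \<Longrightarrow> f i \<in> borel_measurable M"
    for f :: "'i \<Rightarrow> 'w \<Rightarrow> real"
    using I that by (intro borel_measurable_Max) auto
  have "{x\<in>space M. \<exists>z\<in>K. \<forall>n. g n x z \<le> 0} \<in> sets M"
  proof (rule sets_Collect_ex_compact[OF K])
    show "(\<lambda>x. g n x z) \<in> borel_measurable M" for n z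
      unfolding g_def using v by (intro borel_measurable_diff mx borel_measurable_const borel_measurable_inner) auto
    show "continuous_on K (g n x)" for n x unfolding g_def by (intro continuous_intros)
  qed
  moreover have "(\<forall>n. g n x z \<le> 0) \<longleftrightarrow> z \<in> convex hull ((\<lambda>i. v i x) ` I)" for x z
  proof -
    have "(\<forall>n. g n x z \<le> 0) \<longleftrightarrow> (\<forall>y\<in>D. z \<bullet> y \<le> Max ((\<lambda>i. v i x \<bullet> y) ` I))"
      unfolding g_def using \<open>D \<noteq> {}\<close> D(1)
      by (metis diff_le_0_iff_le from_nat_into from_nat_into_surj)
    also have "\<dots> \<longleftrightarrow> z \<in> convex hull ((\<lambda>i. v i x) ` I)"
      using I by (subst mem_convex_hull_iff_support[OF _ _ D']) (auto simp: image_image)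
    finally show ?thesis .
  qed
  ultimately show ?thesis by (simp add: Int_def Bex_def disjoint_iff)
qed

text \<open>A measurable listing with validity flags reduces events about the configuration to
  countable operations on indices. Different indices may list the same point, so distinctness is
  tested on the sites rather than on the indices.\<close>

locale enumerated_config =
  fixes M :: "'w measure" and Y :: "'i::countable \<Rightarrow> 'w \<Rightarrow> 'a::euclidean_space \<times> real"
    and V :: "'i \<Rightarrow> 'w \<Rightarrow> bool" and A :: "'w \<Rightarrow> ('a \<times> real) set"
  assumes Y: "Y i \<in> borel_measurable M"
    and V: "{x\<in>space M. V i x} \<in> sets M"
    and A: "x \<in> space M \<Longrightarrow> A x = {Y i x | i. V i x}"
    and wc: "x \<in> space M \<Longrightarrow> weighted_config (A x)"
begin

lemma fst_Y: "(\<lambda>x. fst (Y i x)) \<in> borel_measurable M"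
  by (rule measurable_compose[OF Y]) (intro borel_measurable_continuous_onI continuous_intros)

lemma snd_Y: "(\<lambda>x. snd (Y i x)) \<in> borel_measurable M"
  by (rule measurable_compose[OF Y]) (intro borel_measurable_continuous_onI continuous_intros)

lemma lpow_Y: "(\<lambda>x. lpow w (Y i x)) \<in> borel_measurable M"
proof -
  note [measurable] = fst_Y snd_Y
  show ?thesis unfolding lpow_def by measurable
qed

lemma mem_cell_iff:
  assumes "x \<in> space M"
  shows "w \<in> laguerre_cell p (A x) \<longleftrightarrow> (\<forall>m. V m x \<longrightarrow> lpow w p \<le> lpow w (Y m x))"
  unfolding laguerre_cell_def A[OF assms] by blast

lemma ex_A: "x \<in> space M \<Longrightarrow> (\<exists>p\<in>A x. P p) \<longleftrightarrow> (\<exists>i. V i x \<and> P (Y i x))"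
  unfolding A by blast

lemma sets_Collect_common_cell:
  assumes K: "compact K"
  shows "{x\<in>space M. \<exists>w\<in>K. \<forall>i\<in>I. w \<in> laguerre_cell (Y i x) (A x)} \<in> sets M"
proof -
  \<comment> \<open>Constraints are indexed by pairs of a cell and a competitor; the value 0 voids
    those with an invalid competitor or a cell outside \<open>I\<close>.\<close>
  define g where "g p x w = (if V (snd p) x then
      (if fst p \<in> I then lpow w (Y (fst p) x) - lpow w (Y (snd p) x) else 0) else 0)" for p x w
  have "{x\<in>space M. \<exists>w\<in>K. \<forall>p. g p x w \<le> 0} \<in> sets M"
  proof (rule sets_Collect_ex_compact[OF K])
    show "(\<lambda>x. g p x w) \<in> borel_measurable M" for p w
      unfolding g_def
      by (cases "fst p \<in> I") (auto intro!: measurable_If borel_measurable_diff lpow_Y V)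
    show "continuous_on K (g p x)" for p x
      unfolding g_def by (cases "V (snd p) x"; cases "fst p \<in> I") (auto intro!: continuous_intros)
  qed
  moreover have "(\<forall>p. g p x w \<le> 0) \<longleftrightarrow> (\<forall>i\<in>I. w \<in> laguerre_cell (Y i x) (A x))" if "x \<in> space M" for x w
    by (auto simp: g_def mem_cell_iff[OF that])
  ultimately show ?thesis by (simp cong: conj_cong)
qed

lemma sets_Collect_neq: "{x\<in>space M. fst (Y i x) \<noteq> fst (Y j x)} \<in> sets M"
proof -
  have "(\<lambda>x. fst (Y i x) - fst (Y j x)) \<in> borel_measurable M"
    by (intro borel_measurable_diff fst_Y)
  from measurable_sets[OF this, of "- {0}"]
  have "(\<lambda>x. fst (Y i x) - fst (Y j x)) -` (- {0}) \<inter> space M \<in> sets M" by simp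
  also have "(\<lambda>x. fst (Y i x) - fst (Y j x)) -` (- {0}) \<inter> space M = {x\<in>space M. fst (Y i x) \<noteq> fst (Y j x)}"
    by auto
  finally show ?thesis .
qed

lemma random_closed_set_skel_laguerre: "random_closed_set M (\<lambda>x. skel (laguerre (A x)))"
  unfolding random_closed_set_def
proof (intro conjI ballI allI impI)
  fix x assume "x \<in> space M"
  then show "closed (skel (laguerre (A x)))" by (intro closed_skel_laguerre wc)
next
  fix K :: "'a set" assume K: "compact K"
  let ?P = "\<lambda>i j x. V i x \<and> V j x \<and> fst (Y i x) \<noteq> fst (Y j x) \<and>
      (\<exists>w\<in>K. \<forall>l\<in>{i, j}. w \<in> laguerre_cell (Y l x) (A x))"
  have "{x\<in>space M. skel (laguerre (A x)) \<inter> K \<noteq> {}} = {x\<in>space M. \<exists>i j. ?P i j x}"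
  proof (intro Collect_cong conj_cong refl)
    fix x assume x: "x \<in> space M"
    have "w \<in> skel (laguerre (A x)) \<longleftrightarrow> (\<exists>i j. V i x \<and> V j x \<and> fst (Y i x) \<noteq> fst (Y j x) \<and>
        (\<forall>l\<in>{i, j}. w \<in> laguerre_cell (Y l x) (A x)))" for w
    proof -
      have "w \<in> skel (laguerre (A x)) \<longleftrightarrow> (\<exists>p\<in>A x. \<exists>q\<in>A x. fst p \<noteq> fst q \<and>
          w \<in> laguerre_cell p (A x) \<and> w \<in> laguerre_cell q (A x))"
        unfolding skel_laguerre_eq[OF wc[OF x]] mem_Collect_eq
        using inj_on_eq_iff[OF weighted_configD(3)[OF wc[OF x]]]
        by (intro bex_cong refl) auto
      also have "\<dots> \<longleftrightarrow> (\<exists>i j. V i x \<and> V j x \<and> fst (Y i x) \<noteq> fst (Y j x) \<and>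
        (\<forall>l\<in>{i, j}. w \<in> laguerre_cell (Y l x) (A x)))"
        unfolding ex_A[OF x] by (simp add: ex_simps(1,2)[symmetric] conj_ac del: ex_simps)
      finally show ?thesis .
    qed
    then show "skel (laguerre (A x)) \<inter> K \<noteq> {} \<longleftrightarrow> (\<exists>i j. ?P i j x)"
      unfolding disjoint_iff by blast
  qed
  also have "\<dots> \<in> sets M"
    using K by (intro sets.sets_Collect_countable_Ex sets.sets_Collect_conj V sets_Collect_neq
        sets_Collect_common_cell) auto
  finally show "{x\<in>space M. skel (laguerre (A x)) \<inter> K \<noteq> {}} \<in> sets M" .
qed

text \<open>The boundary of a non-degenerate simplex is the union of its facets, and each facet is
  the hull of finitely many measurable points; affine independence enters here. The assumption on
  \<open>spread\<close> provides closedness.\<close>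

lemma random_closed_set_skel_laguerre_dual:
  assumes gen: "\<And>x S. x \<in> space M \<Longrightarrow> S \<subseteq> fst ` A x \<Longrightarrow> card S = DIM('a) + 1 \<Longrightarrow> \<not> affine_dependent S"
    and sp: "\<And>x. x \<in> space M \<Longrightarrow> \<exists>H. spread {v. \<exists>h\<le>H. (v, h) \<in> A x}"
  shows "random_closed_set M (\<lambda>x. skel (laguerre_dual (A x)))"
  unfolding random_closed_set_def
proof (intro conjI ballI allI impI)
  fix x assume x: "x \<in> space M"
  then obtain H where "spread {v. \<exists>h\<le>H. (v, h) \<in> A x}" using sp by blast
  then show "closed (skel (laguerre_dual (A x)))" by (rule closed_skel_laguerre_dual[OF wc[OF x]])
next
  fix K :: "'a set" assume K: "compact K"
  define \<I> where "\<I> = {I :: 'i set. finite I \<and> card I = DIM('a) + 1}"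
  have "countable \<I>"
    unfolding \<I>_def by (rule countable_subset[OF _ countable_Collect_finite]) auto
  let ?v = "\<lambda>x i. fst (Y i x)"
  \<comment> \<open>The common point of the cells may lie anywhere, so balls of integer radius
    supply the compactness that \<open>sets_Collect_common_cell\<close> asks for.\<close>
  let ?P = "\<lambda>I x. (\<forall>i\<in>I. V i x) \<and> (\<forall>i\<in>I. \<forall>j\<in>I - {i}. fst (Y i x) \<noteq> fst (Y j x)) \<and>
      (\<exists>R::nat. \<exists>w\<in>cball 0 (real R). \<forall>i\<in>I. w \<in> laguerre_cell (Y i x) (A x)) \<and>
      (\<exists>i\<in>I. K \<inter> convex hull (?v x ` (I - {i})) \<noteq> {})"
  have "{x\<in>space M. skel (laguerre_dual (A x)) \<inter> K \<noteq> {}} = {x\<in>space M. \<exists>I\<in>\<I>. ?P I x}"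
  proof (intro Collect_cong conj_cong refl iffI)
    fix x assume x: "x \<in> space M"
    have frontier: "frontier (convex hull T) = \<Union>{convex hull (T - {v}) |v. v \<in> T}"
      if "T \<subseteq> fst ` A x" "card T = DIM('a) + 1" for T
      using frontier_convex_hull_cases[OF gen[OF x that]] that(2) by simp
    {
      assume "skel (laguerre_dual (A x)) \<inter> K \<noteq> {}"
      then obtain S z where S: "S \<subseteq> A x" "card S = DIM('a) + 1" "(\<Inter>p\<in>S. laguerre_cell p (A x)) \<noteq> {}"
        "z \<in> frontier (convex hull (fst ` S))" "z \<in> K"
        by (auto simp: skel_def laguerre_dual_def)
      have finS: "finite S" using S(2) card.infinite by fastforce
      have injS: "inj_on fst S" using weighted_configD(3)[OF wc[OF x]] S(1) by (rule inj_on_subset)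
      have "\<forall>p\<in>S. \<exists>i. V i x \<and> Y i x = p" using S(1) unfolding A[OF x] by blast
      then obtain idx where idx: "\<And>p. p \<in> S \<Longrightarrow> V (idx p) x" "\<And>p. p \<in> S \<Longrightarrow> Y (idx p) x = p" by metis
      then have inj: "inj_on idx S" unfolding inj_on_def by metis
      define I where "I = idx ` S"
      have "I \<in> \<I>" using finS inj S(2) by (simp add: \<I>_def I_def card_image)
      moreover have "\<forall>i\<in>I. V i x" using idx by (auto simp: I_def)
      moreover have neq: "\<forall>i\<in>I. \<forall>j\<in>I - {i}. fst (Y i x) \<noteq> fst (Y j x)"
      proof (intro ballI)
        fix i j assume "i \<in> I" "j \<in> I - {i}"
        then obtain p q where "p \<in> S" "q \<in> S" "i = idx p" "j = idx q" "p \<noteq> q" by (auto simp: I_def)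
        then show "fst (Y i x) \<noteq> fst (Y j x)" using idx(2) injS by (auto dest: inj_onD)
      qed
      moreover have "\<exists>R::nat. \<exists>w\<in>cball 0 (real R). \<forall>i\<in>I. w \<in> laguerre_cell (Y i x) (A x)"
      proof -
        obtain w where w: "w \<in> (\<Inter>p\<in>S. laguerre_cell p (A x))" using S(3) by blast
        obtain R :: nat where "norm w \<le> real R" using real_arch_simple by blast
        then show ?thesis using w idx by (intro exI[of _ R] bexI[of _ w]) (auto simp: I_def)
      qed
      moreover have "\<exists>i\<in>I. K \<inter> convex hull (?v x ` (I - {i})) \<noteq> {}"
      proof -
        have "card (fst ` S) = DIM('a) + 1" using card_image[OF injS] S(2) by simp
        then obtain v where v: "v \<in> fst ` S" "z \<in> convex hull (fst ` S - {v})"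
          using frontier[of "fst ` S"] S(1,4) by blast
        then obtain p where p: "p \<in> S" "v = fst p" by auto
        have "?v x ` (I - {idx p}) = fst ` S - {v}"
        proof -
          have e: "I - {idx p} = idx ` (S - {p})"
            using inj_on_image_set_diff[OF inj, of S "{p}"] p(1) by (simp add: I_def)
          have "?v x ` (I - {idx p}) = fst ` (\<lambda>i. Y i x) ` idx ` (S - {p})" by (simp add: image_image e)
          also have "(\<lambda>i. Y i x) ` idx ` (S - {p}) = (\<lambda>q. q) ` (S - {p})"
            unfolding image_image by (rule image_cong) (use idx(2) in auto)
          also have "fst ` (\<lambda>q. q) ` (S - {p}) = fst ` S - {v}"
            using inj_on_image_set_diff[OF injS, of S "{p}"] p by simp
          finally show ?thesis .
        qed
        then show ?thesis using v(2) S(5) p(1) by (intro bexI[of _ "idx p"]) (auto simp: I_def)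
      qed
      ultimately show "\<exists>I\<in>\<I>. ?P I x" by blast
    next
      assume "\<exists>I\<in>\<I>. ?P I x"
      then obtain I i w z where I: "I \<in> \<I>" "\<forall>i\<in>I. V i x" "\<forall>i\<in>I. \<forall>j\<in>I - {i}. ?v x i \<noteq> ?v x j"
        "\<forall>i\<in>I. w \<in> laguerre_cell (Y i x) (A x)"
        "i \<in> I" "z \<in> K" "z \<in> convex hull (?v x ` (I - {i}))" by blast
      define S where "S = (\<lambda>i. Y i x) ` I"
      have fstS: "fst ` S = ?v x ` I" by (simp add: S_def image_image)
      have injv: "inj_on (?v x) I" using I(3) unfolding inj_on_def by blast
      have card: "card (fst ` S) = DIM('a) + 1" unfolding fstS using card_image[OF injv] I(1) by (simp add: \<I>_def)
      have "inj_on (\<lambda>i. Y i x) I" using injv by (auto simp: inj_on_def)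
      then have "card S = DIM('a) + 1" using I(1) by (simp add: \<I>_def S_def card_image)
      moreover have SA: "S \<subseteq> A x" using I(2) unfolding A[OF x] S_def by blast
      moreover have "w \<in> (\<Inter>p\<in>S. laguerre_cell p (A x))" using I(4) by (auto simp: S_def)
      moreover have "z \<in> frontier (convex hull (fst ` S))"
      proof -
        have "?v x ` (I - {i}) = fst ` S - {?v x i}" unfolding fstS using injv I(5) by (auto simp: inj_on_def)
        then have "z \<in> convex hull (fst ` S - {?v x i})" using I(7) by simp
        moreover have "?v x i \<in> fst ` S" using I(5) fstS by auto
        ultimately show ?thesis unfolding frontier[OF image_mono[OF SA] card] by blast
      qed
      ultimately have "z \<in> skel (laguerre_dual (A x))" by (intro skel_laguerre_dualI) auto
      then show "skel (laguerre_dual (A x)) \<inter> K \<noteq> {}" using I(6) by auto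
    }
  qed
  also have "\<dots> \<in> sets M"
  proof (rule sets.sets_Collect_countable_Ex'[OF _ \<open>countable \<I>\<close>])
    fix I assume I: "I \<in> \<I>"
    then have fin: "finite I" "I \<noteq> {}" by (auto simp: \<I>_def)
    have "I - {i} \<noteq> {}" if "i \<in> I" for i
    proof
      assume "I - {i} = {}"
      then have "I = {i}" using that by auto
      then show False using I by (simp add: \<I>_def)
    qed
    then show "{x\<in>space M. ?P I x} \<in> sets M"
      using fin K by (intro sets.sets_Collect_conj sets.sets_Collect_countable_Ex sets.sets_Collect_finite_All
          sets.sets_Collect_finite_Ex V sets_Collect_neq sets_Collect_common_cell
          sets_Collect_convex_hull_hit fst_Y) auto
  qed
  finally show "{x\<in>space M. skel (laguerre_dual (A x)) \<inter> K \<noteq> {}} \<in> sets M" .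
qed

end

section \<open>A Poisson process on the upper half-space\<close>

type_synonym 'a sample = "nat \<Rightarrow> nat \<times> (nat \<Rightarrow> 'a \<times> real)"

text \<open>In a sample \<open>\<omega>\<close>, the \<open>j\<close>-th half-shell carries the points \<open>snd (\<omega> j) t\<close> with \<open>t < fst (\<omega> j)\<close>; the
  remaining entries of the sequence are not used.\<close>

definition half_shell :: "nat \<Rightarrow> ('a::euclidean_space \<times> real) set" where
  "half_shell j = {p. 0 < snd p \<and> real j \<le> norm p \<and> norm p < real j + 1}"

definition upper_lebesgue :: "('a::euclidean_space \<times> real) measure" where
  "upper_lebesgue = density lborel (indicator {p. 0 < snd p})"

definition shell_vol :: "('a::euclidean_space) itself \<Rightarrow> nat \<Rightarrow> real" where
  "shell_vol _ j = measure lborel (half_shell j :: ('a \<times> real) set)"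

text \<open>Poisson many independent uniform points. The sequence of points is infinite, so that the
  space does not depend on the number. Shells have finite positive volume, and a bounded set meets
  only finitely many of them.\<close>

definition shell_space :: "nat \<Rightarrow> (nat \<times> (nat \<Rightarrow> 'a::euclidean_space \<times> real)) measure" where
  "shell_space j = measure_pmf (pois (shell_vol TYPE('a) j)) \<Otimes>\<^sub>M
     PiM UNIV (\<lambda>_. uniform_measure lborel (half_shell j))"

definition shells_space :: "('a::euclidean_space) sample measure" where
  "shells_space = PiM UNIV shell_space"

text \<open>Indices are counted rather than points, as in \<open>prob_label_counts\<close>. The two
  counts agree when the valid points are distinct, see \<open>card_shells_config\<close>.\<close>

definition shell_count :: "nat \<Rightarrow> ('a::euclidean_space \<times> real) set \<Rightarrow>
    'a sample \<Rightarrow> nat" where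
  "shell_count j B \<omega> = card {t. t < fst (\<omega> j) \<and> snd (\<omega> j) t \<in> B \<inter> half_shell j}"

lemma upper_half_space_borel: "{p :: 'a::euclidean_space \<times> real. 0 < snd p} \<in> sets borel"
  by (rule borel_open[OF open_Collect_less[OF continuous_on_const continuous_on_snd[OF continuous_on_id]]])

lemma measure_upper_lebesgue:
  assumes "B \<in> sets borel"
  shows "measure upper_lebesgue B = measure lborel (B \<inter> {p. 0 < snd p})"
proof -
  have "emeasure upper_lebesgue B = (\<integral>\<^sup>+p. indicator {p. 0 < snd p} p * indicator B p \<partial>lborel)"
    unfolding upper_lebesgue_def using assms upper_half_space_borel
    by (intro emeasure_density borel_measurable_indicator) auto
  also have "\<dots> = (\<integral>\<^sup>+p. indicator (B \<inter> {p. 0 < snd p}) p \<partial>lborel)"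
    by (intro nn_integral_cong) (auto simp: indicator_def)
  also have "\<dots> = emeasure lborel (B \<inter> {p. 0 < snd p})"
    using assms upper_half_space_borel by (intro nn_integral_indicator) auto
  finally show ?thesis by (simp add: measure_def)
qed

lemma half_shell_borel [simp]: "(half_shell j :: ('a::euclidean_space \<times> real) set) \<in> sets borel"
proof -
  have eq: "(half_shell j :: ('a \<times> real) set) = {p. 0 < snd p} \<inter> (- ball 0 (real j) \<inter> ball 0 (real j + 1))"
    by (auto simp: half_shell_def)
  have "- ball 0 (real j) \<inter> ball 0 (real j + 1) \<in> sets (borel :: ('a \<times> real) measure)"
    by auto
  from sets.Int[OF upper_half_space_borel this] show ?thesis unfolding eq .
qed

lemma bounded_half_shell: "bounded (half_shell j :: ('a::euclidean_space \<times> real) set)"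
  by (rule bounded_subset[OF bounded_ball[of 0 "real j + 1"]]) (auto simp: half_shell_def)

lemma half_shell_disjoint:
  "j \<noteq> j' \<Longrightarrow> half_shell j \<inter> half_shell j' = ({} :: ('a::euclidean_space \<times> real) set)"
proof (rule ccontr)
  assume "j \<noteq> j'" and "half_shell j \<inter> half_shell j' \<noteq> ({} :: ('a \<times> real) set)"
  then obtain p :: "'a \<times> real" where "real j \<le> norm p" "norm p < real j + 1" "real j' \<le> norm p" "norm p < real j' + 1"
    by (auto simp: half_shell_def)
  then have "real j < real (Suc j')" "real j' < real (Suc j)" by linarith+
  then show False using \<open>j \<noteq> j'\<close> by linarith
qed

lemma emeasure_half_shell:
  "emeasure lborel (half_shell j :: ('a::euclidean_space \<times> real) set) \<noteq> 0"
  "emeasure lborel (half_shell j :: ('a::euclidean_space \<times> real) set) \<noteq> \<infinity>"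
proof -
  \<comment> \<open>Radius 1/4 around height \<open>j + 1/2\<close> keeps heights positive and norms
    between \<open>j\<close> and \<open>j + 1\<close>, which certifies positive volume.\<close>
  let ?b = "ball (0 :: 'a, real j + 1/2) (1/4)"
  have "?b \<subseteq> half_shell j"
  proof
    fix p assume p: "p \<in> ?b"
    have "norm ((0 :: 'a, real j + 1/2)) = real j + 1/2" by (simp add: norm_Pair)
    then have n: "\<bar>norm p - (real j + 1/2)\<bar> < 1/4"
      using p norm_triangle_ineq3[of p "(0 :: 'a, real j + 1/2)"] by (simp add: dist_norm norm_minus_commute)
    have "\<bar>snd p - (real j + 1/2)\<bar> \<le> dist p (0 :: 'a, real j + 1/2)"
      using dist_snd_le[of p "(0 :: 'a, real j + 1/2)"] by (simp add: dist_real_def)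
    then have "\<bar>snd p - (real j + 1/2)\<bar> < 1/4" using p by (simp add: dist_commute)
    then have "0 < snd p" by linarith
    moreover have "real j \<le> norm p" "norm p < real j + 1" using n by linarith+
    ultimately show "p \<in> half_shell j" by (simp add: half_shell_def)
  qed
  then have "emeasure lborel ?b \<le> emeasure lborel (half_shell j :: ('a \<times> real) set)"
    by (intro emeasure_mono) auto
  moreover have "emeasure lborel ?b \<noteq> 0" using content_ball_pos[of "1/4" "(0 :: 'a, real j + 1/2)"]
    by (auto simp: measure_def)
  ultimately show "emeasure lborel (half_shell j :: ('a \<times> real) set) \<noteq> 0" by auto
  show "emeasure lborel (half_shell j :: ('a \<times> real) set) \<noteq> \<infinity>"
    using emeasure_bounded_finite[OF bounded_half_shell[of j, where 'a='a]] by simp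
qed

lemma prob_space_uniform_half_shell:
  "prob_space (uniform_measure lborel (half_shell j :: ('a::euclidean_space \<times> real) set))"
  by (rule prob_space_uniform_measure[OF emeasure_half_shell])

lemma prob_space_shell_points:
  "prob_space (PiM UNIV (\<lambda>_::nat. uniform_measure lborel (half_shell j :: ('a::euclidean_space \<times> real) set)))"
  by (intro prob_space_PiM prob_space_uniform_half_shell)

lemma prob_space_shell_space: "prob_space (shell_space j)"
  unfolding shell_space_def
  by (intro prob_space_pair measure_pmf.prob_space_axioms prob_space_shell_points)

lemma prob_space_shells_space: "prob_space shells_space"
  unfolding shells_space_def by (intro prob_space_PiM prob_space_shell_space)

lemma space_shell_space [simp]: "space (shell_space j) = UNIV"
  by (auto simp: shell_space_def space_pair_measure space_PiM)

lemma space_shells_space [simp]: "space shells_space = UNIV"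
  by (auto simp: shells_space_def space_PiM)

lemma measurable_fst_shell:
  "fst \<in> measurable (shell_space j :: (nat \<times> (nat \<Rightarrow> 'a::euclidean_space \<times> real)) measure) (count_space UNIV)"
proof -
  have "fst \<in> measurable (shell_space j :: (nat \<times> (nat \<Rightarrow> 'a \<times> real)) measure) (measure_pmf (pois (shell_vol TYPE('a) j)))"
    unfolding shell_space_def by (rule measurable_fst)
  then show ?thesis by (simp cong: measurable_cong_sets)
qed

lemma measurable_point_shell:
  "(\<lambda>y. snd y t) \<in> borel_measurable (shell_space j :: (nat \<times> (nat \<Rightarrow> 'a::euclidean_space \<times> real)) measure)"
proof -
  have "(\<lambda>y. snd y t) \<in> measurable (shell_space j :: (nat \<times> (nat \<Rightarrow> 'a \<times> real)) measure) (uniform_measure lborel (half_shell j))"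
    unfolding shell_space_def
    by (rule measurable_compose[OF measurable_snd measurable_component_singleton]) auto
  then show ?thesis by (simp cong: measurable_cong_sets)
qed

lemma measurable_component_shells: "(\<lambda>\<omega>. \<omega> j) \<in> measurable shells_space (shell_space j)"
  unfolding shells_space_def by (rule measurable_component_singleton) auto

lemma measurable_number: "(\<lambda>\<omega>. fst (\<omega> j)) \<in> measurable shells_space (count_space UNIV)"
  by (rule measurable_compose[OF measurable_component_shells measurable_fst_shell])

lemma measurable_point: "(\<lambda>\<omega>. snd (\<omega> j) t) \<in> borel_measurable shells_space"
  by (rule measurable_compose[OF measurable_component_shells measurable_point_shell])

lemma measurable_label_count:
  assumes "lab \<in> measurable borel (count_space UNIV)"
  shows "(\<lambda>y. card {t. t < fst y \<and> lab (snd y t) = i}) \<in> measurable (shell_space j) (count_space UNIV)"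
proof (rule measurable_card)
  fix t
  have "(\<lambda>y. lab (snd y t)) \<in> measurable (shell_space j) (count_space UNIV)"
    by (rule measurable_compose[OF measurable_point_shell assms])
  note [measurable] = this measurable_fst_shell[of j]
  show "{y \<in> space (shell_space j). t \<in> {t. t < fst y \<and> lab (snd y t) = i}} \<in> sets (shell_space j)"
    unfolding mem_Collect_eq by measurable
qed

lemma measurable_shell_count:
  assumes "B \<in> sets borel"
  shows "shell_count j B \<in> measurable shells_space (count_space UNIV)"
  unfolding shell_count_def
proof (rule measurable_card)
  fix t
  have [measurable]: "(\<lambda>\<omega>. snd (\<omega> j) t) \<in> borel_measurable shells_space" "B \<inter> half_shell j \<in> sets borel"
      "(\<lambda>\<omega>. fst (\<omega> j)) \<in> measurable shells_space (count_space UNIV)"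
    using assms by (auto simp: measurable_point measurable_number)
  show "{\<omega> \<in> space shells_space. t \<in> {t. t < fst (\<omega> j) \<and> snd (\<omega> j) t \<in> B \<inter> half_shell j}} \<in> sets shells_space"
    unfolding mem_Collect_eq by measurable
qed

text \<open>Shells are independent by construction, and inside one shell
  \<open>prob_label_counts\<close> applies. The shell volume is both the Poisson rate and the
  denominator of the uniform law, so the rate of a label is the volume of its region.\<close>

lemma prob_shell_labels:
  fixes lab :: "nat \<Rightarrow> ('a::euclidean_space \<times> real) \<Rightarrow> nat"
  assumes lab: "\<And>j. lab j \<in> measurable borel (count_space UNIV)" and le: "\<And>j x. lab j x \<le> m"
  shows "measure shells_space {\<omega>. \<forall>j<J. \<forall>i\<le>m. card {t. t < fst (\<omega> j) \<and> lab j (snd (\<omega> j) t) = i} = k j i} =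
    (\<Prod>j<J. \<Prod>i\<le>m. pmf (pois (measure lborel (half_shell j \<inter> lab j -` {i}))) (k j i))"
proof -
  interpret prob_space "shells_space :: 'a sample measure"
    by (rule prob_space_shells_space)
  define E where "E j = {y :: nat \<times> (nat \<Rightarrow> 'a \<times> real). \<forall>i\<le>m. card {t. t < fst y \<and> lab j (snd y t) = i} = k j i}" for j
  have E_sets: "E j \<in> sets (shell_space j)" for j
  proof -
    have "{y\<in>space (shell_space j). card {t. t < fst y \<and> lab j (snd y t) = i} = k j i}
        \<in> sets (shell_space j :: (nat \<times> (nat \<Rightarrow> 'a \<times> real)) measure)" for i
      using measurable_sets[OF measurable_label_count[OF lab, of j i j], of "{k j i}"]
      by (simp add: vimage_def Int_def conj_commute)
    then have "{y\<in>space (shell_space j). \<forall>i\<in>{..m}. card {t. t < fst y \<and> lab j (snd y t) = i} = k j i}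
        \<in> sets (shell_space j :: (nat \<times> (nat \<Rightarrow> 'a \<times> real)) measure)"
      by (intro sets.sets_Collect_finite_All) auto
    then show ?thesis by (simp add: E_def Ball_def)
  qed
  have E: "measure (shell_space j) (E j) = (\<Prod>i\<le>m. pmf (pois (measure lborel (half_shell j \<inter> lab j -` {i}))) (k j i))" for j
  proof -
    let ?U = "uniform_measure lborel (half_shell j) :: ('a \<times> real) measure"
    have "lab j \<in> measurable ?U (count_space UNIV)" using lab[of j] by (simp cong: measurable_cong_sets)
    from prob_label_counts[OF prob_space_uniform_half_shell this le, of "shell_vol TYPE('a) j" "k j"]
    have "measure (shell_space j) (E j) = (\<Prod>i\<le>m. pmf (pois (shell_vol TYPE('a) j * measure ?U (lab j -` {i} \<inter> space ?U))) (k j i))"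
      by (simp add: shell_space_def E_def shell_vol_def space_pair_measure space_PiM)
    also have "\<dots> = (\<Prod>i\<le>m. pmf (pois (measure lborel (half_shell j \<inter> lab j -` {i}))) (k j i))"
    proof (intro prod.cong refl)
      fix i
      have "lab j -` {i} \<in> sets borel" using measurable_sets[OF lab[of j], of "{i}"] by simp
      then have "measure ?U (lab j -` {i}) = measure lborel (half_shell j \<inter> lab j -` {i}) / shell_vol TYPE('a) j"
        unfolding shell_vol_def by (intro measure_uniform_measure emeasure_half_shell) auto
      moreover have "shell_vol TYPE('a) j \<noteq> 0"
        using emeasure_half_shell[where j=j and 'a='a] by (simp add: shell_vol_def measure_def enn2real_eq_0_iff)
      ultimately have "shell_vol TYPE('a) j * measure ?U (lab j -` {i}) = measure lborel (half_shell j \<inter> lab j -` {i})"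
        by simp
      then show "pmf (pois (shell_vol TYPE('a) j * measure ?U (lab j -` {i} \<inter> space ?U))) (k j i)
          = pmf (pois (measure lborel (half_shell j \<inter> lab j -` {i}))) (k j i)" by simp
    qed
    finally show ?thesis .
  qed
  have ev: "{\<omega>. \<forall>j<J. \<forall>i\<le>m. card {t. t < fst (\<omega> j) \<and> lab j (snd (\<omega> j) t) = i} = k j i}
      = {\<omega>. \<forall>j\<in>{..<J}. \<omega> j \<in> E j}"
    by (simp add: E_def Ball_def)
  have emb: "{\<omega>. \<forall>j\<in>{..<J}. \<omega> j \<in> E j} = prod_emb UNIV shell_space {..<J} (PiE {..<J} E)"
    by (intro set_eqI) (simp add: prod_emb_def PiE_iff space_PiM)
  have "emeasure shells_space {\<omega>. \<forall>j\<in>{..<J}. \<omega> j \<in> E j} = (\<Prod>j<J. emeasure (shell_space j) (E j))"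
    unfolding shells_space_def emb by (intro emeasure_PiM_emb prob_space_shell_space E_sets) auto
  also have "\<dots> = (\<Prod>j<J. ennreal (measure (shell_space j) (E j)))"
    using prob_space.finite_measure[OF prob_space_shell_space]
    by (intro prod.cong refl finite_measure.emeasure_eq_measure) auto
  also have "\<dots> = ennreal (\<Prod>j<J. measure (shell_space j) (E j))" by (simp add: prod_ennreal)
  finally show ?thesis unfolding ev measure_def[of shells_space] by (simp add: E prod_nonneg)
qed

lemma sum_times_singleton: "(\<Sum>p\<in>A \<times> {b}. g p) = (\<Sum>a\<in>A. g (a, b))"
  by (rule sum.reindex_bij_witness[of _ "\<lambda>a. (a, b)" fst]) auto

text \<open>The disjoint family becomes a labelling of the points. The counts per shell and label
  are independent Poisson variables, and grouping them by label and summing over shells assembles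
  each \<open>B i\<close>.\<close>

lemma prob_shell_counts:
  fixes B :: "nat \<Rightarrow> ('a::euclidean_space \<times> real) set"
  assumes B: "\<And>i. i < m \<Longrightarrow> B i \<in> sets borel" "\<And>i. i < m \<Longrightarrow> B i \<subseteq> ball 0 (real J)"
    and disj: "disjoint_family_on B {..<m}"
  shows "measure shells_space {\<omega>. \<forall>i<m. (\<Sum>j<J. shell_count j (B i) \<omega>) = k i}
    = (\<Prod>i<m. pmf (pois (measure upper_lebesgue (B i))) (k i))"
proof -
  interpret prob_space "shells_space :: 'a sample measure"
    by (rule prob_space_shells_space)
  \<comment> \<open>Label \<open>m\<close> collects everything outside the shell or outside all
    \<open>B i\<close>; for the remaining points disjointness makes the least index the only
    one.\<close>
  define lab where "lab j x = (if x \<in> half_shell j then (LEAST i. i = m \<or> i < m \<and> x \<in> B i) else m)" for j x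
  have le: "lab j x \<le> m" for j x by (auto simp: lab_def intro: Least_le)
  have lab_iff: "lab j x = i \<longleftrightarrow> x \<in> B i \<inter> half_shell j" if i: "i < m" for i j x
  proof (cases "x \<in> half_shell j")
    case True
    let ?Q = "\<lambda>i. i = m \<or> i < m \<and> x \<in> B i"
    have "?Q (LEAST i. ?Q i)" by (rule LeastI[of ?Q m]) simp
    then have 1: "lab j x = i \<Longrightarrow> x \<in> B i" using True i by (auto simp: lab_def)
    have "lab j x = i" if "x \<in> B i"
    proof -
      have "lab j x \<le> i" using True that i by (auto simp: lab_def intro: Least_le)
      then have "lab j x < m" using i by simp
      then have "x \<in> B (lab j x)" using \<open>?Q (LEAST i. ?Q i)\<close> True by (auto simp: lab_def)
      then show ?thesis using disj i \<open>lab j x < m\<close> that unfolding disjoint_family_on_def by blast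
    qed
    then show ?thesis using 1 True by auto
  next
    case False then show ?thesis using i by (simp add: lab_def)
  qed
  have lab: "lab j \<in> measurable borel (count_space UNIV)" for j
  proof (rule measurable_count_space_eq2_countable[THEN iffD2], intro conjI ballI)
    have small: "lab j -` {i} \<in> sets borel" if "i < m" for i
    proof -
      have "lab j -` {i} = B i \<inter> half_shell j" using lab_iff[OF that] by auto
      then show ?thesis using B(1)[OF that] by auto
    qed
    have "lab j x = m \<longleftrightarrow> lab j x \<notin> {..<m}" for x using le[of j x] by auto
    then have large: "lab j -` {m} = - (\<Union>i<m. lab j -` {i})" by blast
    fix i :: nat
    show "lab j -` {i} \<inter> space borel \<in> sets borel"
    proof (cases i m rule: linorder_cases)
      case less then show ?thesis using small by simp
    next
      case equal
      have "- (\<Union>i<m. lab j -` {i}) \<in> sets borel" using small by (intro borel_comp sets.finite_UN) auto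
      then show ?thesis using equal large by simp
    next
      case greater
      then have "lab j -` {i} = {}" using le[of j] by (auto simp: not_le[symmetric])
      then show ?thesis by simp
    qed
  qed auto
  define X where "X p \<omega> = card {t. t < fst (\<omega> (fst p)) \<and> lab (fst p) (snd (\<omega> (fst p)) t) = snd p}"
    for p :: "nat \<times> nat" and \<omega> :: "'a sample"
  define a where "a p = measure lborel (half_shell (fst p) \<inter> lab (fst p) -` {snd p})" for p
  let ?I = "{..<J} \<times> {..m}"
  have Xm: "X p \<in> measurable shells_space (count_space UNIV)" for p
    unfolding X_def by (rule measurable_compose[OF measurable_component_shells measurable_label_count[OF lab]])
  have joint: "prob {\<omega>\<in>space shells_space. \<forall>p\<in>?I. X p \<omega> = k p} = (\<Prod>p\<in>?I. pmf (pois (a p)) (k p))" for k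
  proof -
    have "(\<Prod>p\<in>?I. pmf (pois (a p)) (k p)) = (\<Prod>j<J. \<Prod>i\<le>m. pmf (pois (a (j, i))) (k (j, i)))"
      by (simp add: prod.cartesian_product split_beta)
    moreover have "{\<omega>\<in>space shells_space. \<forall>p\<in>?I. X p \<omega> = k p} =
       {\<omega>. \<forall>j<J. \<forall>i\<le>m. card {t. t < fst (\<omega> j) \<and> lab j (snd (\<omega> j) t) = i} = k (j, i)}"
      by (auto simp: X_def)
    ultimately show ?thesis using prob_shell_labels[OF lab le, where J=J and k="\<lambda>j i. k (j, i)"] by (simp add: a_def)
  qed
  have ind: "indep_vars (\<lambda>_. count_space UNIV) X ?I"
    and marg: "\<And>p. p \<in> ?I \<Longrightarrow> distr shells_space (count_space UNIV) (X p) = measure_pmf (pois (a p))"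
    using indep_vars_of_joint_pmf[of ?I X "\<lambda>p. pois (a p)"] Xm joint by auto
  define C where "C i \<omega> = (\<Sum>p\<in>{..<J} \<times> {i}. X p \<omega>)" for i \<omega>
  have ind2: "indep_vars (\<lambda>_. count_space UNIV) C {..<m}"
  proof -
    have "indep_vars (\<lambda>i. PiM ({..<J} \<times> {i}) (\<lambda>_. count_space UNIV))
        (\<lambda>i \<omega>. restrict (\<lambda>p. X p \<omega>) ({..<J} \<times> {i})) {..<m}"
      by (rule indep_vars_restrict[OF ind]) (auto simp: disjoint_family_on_def)
    then have "indep_vars (\<lambda>_. count_space UNIV)
        (\<lambda>i \<omega>. (\<lambda>f. \<Sum>p\<in>{..<J} \<times> {i}. f p) (restrict (\<lambda>p. X p \<omega>) ({..<J} \<times> {i}))) {..<m}"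
    proof (rule indep_vars_compose2)
      fix i
      have "PiM ({..<J} \<times> {i}) (\<lambda>_. count_space UNIV) = (count_space (PiE ({..<J} \<times> {i}) (\<lambda>_. UNIV)) :: (nat \<times> nat \<Rightarrow> nat) measure)"
        by (rule count_space_PiM_finite) auto
      then show "(\<lambda>f. \<Sum>p\<in>{..<J} \<times> {i}. f p) \<in> measurable (PiM ({..<J} \<times> {i}) (\<lambda>_. count_space UNIV)) (count_space (UNIV :: nat set))"
        by simp
    qed
    then show ?thesis by (simp add: C_def[abs_def] cong: sum.cong)
  qed
  have Cprob: "prob {\<omega>. C i \<omega> = l} = pmf (pois (measure upper_lebesgue (B i))) l" if i: "i < m" for i l
  proof -
    have "prob {\<omega>\<in>space shells_space. C i \<omega> = l} = pmf (pois (\<Sum>p\<in>{..<J} \<times> {i}. a p)) l"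
      unfolding C_def
    proof (rule prob_sum_pois)
      show "indep_vars (\<lambda>_. count_space UNIV) X ({..<J} \<times> {i})"
        by (rule indep_vars_subset[OF ind]) (use i in auto)
      fix p and l :: nat assume "p \<in> {..<J} \<times> {i}"
      then have "p \<in> ?I" using i by auto
      have "prob {\<omega>\<in>space shells_space. X p \<omega> = l} = measure (distr shells_space (count_space UNIV) (X p)) {l}"
        using Xm by (subst measure_distr) (auto intro!: arg_cong[where f=prob])
      then show "prob {\<omega>\<in>space shells_space. X p \<omega> = l} = pmf (pois (a p)) l"
        using marg[OF \<open>p \<in> ?I\<close>] by (simp add: measure_pmf_single)
    qed (auto simp: a_def)
    also have "(\<Sum>p\<in>{..<J} \<times> {i}. a p) = (\<Sum>j<J. measure lborel (half_shell j \<inter> B i))"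
    proof -
      have "(\<Sum>p\<in>{..<J} \<times> {i}. a p) = (\<Sum>j<J. a (j, i))"
        by (rule sum_times_singleton)
      also have "\<dots> = (\<Sum>j<J. measure lborel (half_shell j \<inter> B i))"
      proof (intro sum.cong refl)
        fix j
        have "half_shell j \<inter> lab j -` {i} = half_shell j \<inter> B i" using lab_iff[OF i, of j] by auto
        then show "a (j, i) = measure lborel (half_shell j \<inter> B i)" by (simp add: a_def)
      qed
      finally show ?thesis .
    qed
    also have "\<dots> = measure lborel (\<Union>j<J. half_shell j \<inter> B i)"
    proof (rule measure_finite_Union[symmetric])
      show "disjoint_family_on (\<lambda>j. half_shell j \<inter> B i) {..<J}"
        using half_shell_disjoint unfolding disjoint_family_on_def by blast
      fix j assume "j \<in> {..<J}"
      have "bounded (half_shell j \<inter> B i)" using bounded_half_shell by (rule bounded_subset) auto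
      from emeasure_bounded_finite[OF this] show "emeasure lborel (half_shell j \<inter> B i) \<noteq> \<infinity>" by simp
    qed (use B(1)[OF i] in auto)
    also have "(\<Union>j<J. half_shell j \<inter> B i) = B i \<inter> {p. 0 < snd p}"
    proof (intro equalityI subsetI)
      fix p assume p: "p \<in> B i \<inter> {p. 0 < snd p}"
      define j where "j = nat \<lfloor>norm p\<rfloor>"
      have "p \<in> half_shell j" using p by (simp add: half_shell_def j_def)
      moreover have "norm p < real J" using p B(2)[OF i] by auto
      then have "j < J" unfolding j_def by (smt (verit) floor_less_iff nat_less_iff norm_ge_zero of_int_of_nat_eq zero_le_floor)
      ultimately show "p \<in> (\<Union>j<J. half_shell j \<inter> B i)" using p by auto
    qed (auto simp: half_shell_def)
    also have "measure lborel (B i \<inter> {p. 0 < snd p}) = measure upper_lebesgue (B i)"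
      using measure_upper_lebesgue[OF B(1)[OF i]] by simp
    finally show ?thesis by simp
  qed
  have C_eq: "C i \<omega> = (\<Sum>j<J. shell_count j (B i) \<omega>)" if "i < m" for i \<omega>
  proof -
    have "C i \<omega> = (\<Sum>j<J. X (j, i) \<omega>)"
      unfolding C_def by (rule sum_times_singleton)
    then show ?thesis using lab_iff[OF that] by (simp add: X_def shell_count_def)
  qed
  show ?thesis
  proof (cases "m = 0")
    case True then show ?thesis using prob_space by simp
  next
    case False
    have "prob (\<Inter>i\<in>{..<m}. C i -` {k i} \<inter> space shells_space) = (\<Prod>i<m. prob (C i -` {k i} \<inter> space shells_space))"
      by (rule indep_varsD_finite[OF ind2]) (use False in auto)
    also have "(\<Inter>i\<in>{..<m}. C i -` {k i} \<inter> space shells_space) = {\<omega>. \<forall>i<m. (\<Sum>j<J. shell_count j (B i) \<omega>) = k i}"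
      using False C_eq by auto
    also have "(\<Prod>i<m. prob (C i -` {k i} \<inter> space shells_space)) = (\<Prod>i<m. pmf (pois (measure upper_lebesgue (B i))) (k i))"
      using Cprob by (intro prod.cong refl) (simp add: vimage_def)
    finally show ?thesis .
  qed
qed

section \<open>Almost sure properties\<close>

text \<open>Replacing coordinate \<open>i\<close> by an independent copy does not change the product
  law. By Fubini it therefore suffices to vary that coordinate with all others frozen.\<close>

lemma AE_PiM_resample:
  fixes M :: "'i \<Rightarrow> 'b measure"
  assumes prob: "\<And>i. prob_space (M i)"
    and meas: "{x\<in>space (PiM UNIV M). Q x} \<in> sets (PiM UNIV M)"
    and ae: "\<And>x. x \<in> space (PiM UNIV M) \<Longrightarrow> AE z in M i. Q (x(i := z))"
  shows "AE x in PiM UNIV M. Q x"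
proof -
  let ?P = "PiM UNIV M"
  let ?T = "\<lambda>(z, x). x(i := z)"
  interpret Mi: prob_space "M i" by (rule prob)
  interpret P: prob_space ?P by (intro prob_space_PiM prob)
  interpret pair_sigma_finite ?P "M i" ..
  have T: "?T \<in> measurable (M i \<Otimes>\<^sub>M ?P) ?P"
    unfolding split_beta by (rule measurable_fun_upd[where J=UNIV]) auto
  have T': "(\<lambda>p. (fst p)(i := snd p)) \<in> measurable (?P \<Otimes>\<^sub>M M i) ?P"
    by (rule measurable_fun_upd[where J=UNIV]) auto
  have "{p\<in>space (?P \<Otimes>\<^sub>M M i). Q ((fst p)(i := snd p))}
      = (\<lambda>p. (fst p)(i := snd p)) -` {x\<in>space ?P. Q x} \<inter> space (?P \<Otimes>\<^sub>M M i)"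
    using measurable_space[OF T'] by auto
  then have S': "{p\<in>space (?P \<Otimes>\<^sub>M M i). Q ((fst p)(i := snd p))} \<in> sets (?P \<Otimes>\<^sub>M M i)"
    using measurable_sets[OF T' meas] by simp
  have "AE x in ?P. AE z in M i. Q (x(i := z))" using ae by (rule AE_I2)
  then have ae2: "AE z in M i. AE x in ?P. Q (x(i := z))"
    using AE_commute[of "\<lambda>x z. Q (x(i := z))"] S' by simp
  have "{p\<in>space (M i \<Otimes>\<^sub>M ?P). Q (?T p)} \<in> sets (M i \<Otimes>\<^sub>M ?P)"
  proof -
    have "{p\<in>space (M i \<Otimes>\<^sub>M ?P). Q (?T p)} = ?T -` {x\<in>space ?P. Q x} \<inter> space (M i \<Otimes>\<^sub>M ?P)"
      using measurable_space[OF T] by auto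
    then show ?thesis using measurable_sets[OF T meas] by simp
  qed
  note S = this
  interpret Q: pair_sigma_finite "M i" ?P ..
  from S have "AE p in M i \<Otimes>\<^sub>M ?P. Q (?T p)"
    using ae2 by (intro Q.AE_pair_measure) auto
  then have "AE x in distr (M i \<Otimes>\<^sub>M ?P) ?P ?T. Q x"
    using AE_distr_iff[OF T meas] by simp
  note D = this
  have "distr (M i \<Otimes>\<^sub>M ?P) ?P ?T = ?P"
    using distr_pair_PiM_eq_PiM[of UNIV M i] prob by simp
  from D[unfolded this] show ?thesis .
qed

definition point :: "nat \<times> nat \<Rightarrow> ('a::euclidean_space) sample \<Rightarrow> 'a \<times> real" where
  "point i \<omega> = snd (\<omega> (fst i)) (snd i)"

definition set_point :: "nat \<times> nat \<Rightarrow> ('a::euclidean_space) sample \<Rightarrow> 'a \<times> real \<Rightarrow>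
    'a sample" where
  "set_point i \<omega> z = fun_upd \<omega> (fst i) (fst (\<omega> (fst i)), fun_upd (snd (\<omega> (fst i))) (snd i) z)"

lemma point_set_point: "point i (set_point i' \<omega> z) = (if i = i' then z else point i \<omega>)"
  by (cases i; cases i') (auto simp: point_def set_point_def)

lemma measurable_point': "point i \<in> borel_measurable shells_space"
  unfolding point_def by (rule measurable_point)

text \<open>Resampling is applied twice, to a shell and then to one point inside it. The uniform law
  on the shell is absolutely continuous, so a statement for Lebesgue-almost every position is
  enough.\<close>

lemma AE_shells_resample:
  fixes Q :: "('a::euclidean_space) sample \<Rightarrow> bool"
  assumes meas: "{\<omega>. Q \<omega>} \<in> sets shells_space"
    and ae: "\<And>\<omega>. AE z in lborel. Q (set_point i \<omega> z)"
  shows "AE \<omega> in shells_space. Q \<omega>"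
  unfolding shells_space_def
proof (rule AE_PiM_resample[where i="fst i"])
  let ?U = "uniform_measure lborel (half_shell (fst i)) :: ('a \<times> real) measure"
  let ?UU = "PiM UNIV (\<lambda>_::nat. ?U)"
  let ?N = "measure_pmf (pois (shell_vol TYPE('a) (fst i)))"
  show "{x \<in> space (PiM UNIV shell_space). Q x} \<in> sets (PiM UNIV shell_space)"
    using meas by (simp add: shells_space_def[symmetric])
  fix \<omega> :: "'a sample"
  interpret N: prob_space ?N by (rule measure_pmf.prob_space_axioms)
  interpret UU: prob_space ?UU by (rule prob_space_shell_points)
  interpret pair_sigma_finite ?N ?UU ..
  have upd: "(\<lambda>y. fun_upd \<omega> (fst i) y) \<in> measurable (shell_space (fst i)) shells_space"
    unfolding shells_space_def by (rule measurable_fun_upd[where J=UNIV]) (auto simp: space_PiM)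
  have S: "{y\<in>space (shell_space (fst i)). Q (fun_upd \<omega> (fst i) y)} \<in> sets (shell_space (fst i))"
    using measurable_sets[OF upd meas] by (simp add: vimage_def)
  have "AE x in ?UU. Q (fun_upd \<omega> (fst i) (n, x))" for n
  proof (rule AE_PiM_resample[where i="snd i"])
    have "(\<lambda>x. (n, x)) \<in> measurable ?UU (shell_space (fst i))"
      unfolding shell_space_def by simp
    from measurable_sets[OF this S]
    show "{x \<in> space ?UU. Q (fun_upd \<omega> (fst i) (n, x))} \<in> sets ?UU"
      by (simp add: vimage_def space_PiM)
    show "prob_space ?U" by (rule prob_space_uniform_half_shell)
    fix x
    have "AE z in lborel. Q (set_point i (fun_upd \<omega> (fst i) (n, x)) z)" by (rule ae)
    then have "AE z in lborel. z \<in> half_shell (fst i) \<longrightarrow> Q (fun_upd \<omega> (fst i) (n, x(snd i := z)))"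
      by eventually_elim (simp add: set_point_def)
    then show "AE z in ?U. Q (fun_upd \<omega> (fst i) (n, x(snd i := z)))"
      by (intro AE_uniform_measureI) auto
  qed
  then show "AE z in shell_space (fst i). Q (fun_upd \<omega> (fst i) z)"
    unfolding shell_space_def using S
    by (intro AE_pair_measure) (auto simp: shell_space_def)
qed (rule prob_space_shell_space)

section \<open>Null sets for the position of one point\<close>

lemma AE_lborel_fst:
  assumes "AE v in lborel. P (v :: 'a::euclidean_space)"
  shows "AE z in (lborel :: ('a \<times> real) measure). P (fst z)"
proof -
  obtain N where N: "{v. \<not> P v} \<subseteq> N" "N \<in> null_sets lborel"
    using assms unfolding eventually_ae_filter by auto
  have "emeasure (lborel \<Otimes>\<^sub>M lborel) (N \<times> (UNIV :: real set)) = emeasure lborel N * emeasure lborel (UNIV :: real set)"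
    using N(2) by (intro lborel.emeasure_pair_measure_Times) auto
  then have "emeasure (lborel :: ('a \<times> real) measure) (N \<times> UNIV) = 0"
    using N(2) by (simp add: lborel_prod null_setsD1)
  moreover have "N \<times> (UNIV :: real set) \<in> sets (lborel \<Otimes>\<^sub>M lborel)" using N(2) by (intro pair_measureI) auto
  then have "N \<times> UNIV \<in> sets (lborel :: ('a \<times> real) measure)" unfolding lborel_prod .
  ultimately have "N \<times> UNIV \<in> null_sets (lborel :: ('a \<times> real) measure)" by (intro null_setsI)
  then show ?thesis by (rule AE_I') (use N(1) in auto)
qed

lemma AE_lborel_snd_neq: "AE z in (lborel :: ('a::euclidean_space \<times> real) measure). snd z \<noteq> c"
proof -
  have "(0 :: 'a, 1 :: real) \<noteq> 0" by (simp add: prod_eq_iff)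
  then have "negligible {z :: 'a \<times> real. (0, 1) \<bullet> z = c}" by (intro negligible_hyperplane) simp
  moreover have "closed {z :: 'a \<times> real. (0, 1) \<bullet> z = c}" by (rule closed_hyperplane)
  ultimately have "{z :: 'a \<times> real. (0, 1) \<bullet> z = c} \<in> null_sets lborel"
    by (simp add: negligible_iff_null_sets null_sets_completion_iff)
  then show ?thesis by (rule AE_I') (auto simp: inner_prod_def)
qed

lemma AE_lborel_not_closed:
  assumes "negligible S" "closed (S :: 'a::euclidean_space set)"
  shows "AE v in lborel. v \<notin> S"
proof -
  have "S \<in> null_sets lborel"
    using assms by (simp add: negligible_iff_null_sets null_sets_completion_iff)
  then show ?thesis by (rule AE_not_in)
qed

text \<open>With the points of \<open>J\<close> frozen, their images are so few that they lie in a
  hyperplane, which the image of the resampled point avoids by \<open>null\<close>. The remaining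
  work is measurability: hull membership is rewritten as solvability for a coefficient vector, and
  injectivity lets sums over the image be written as sums over \<open>J\<close>.\<close>

lemma AE_not_in_affine_hull:
  fixes \<phi> :: "'a::euclidean_space \<Rightarrow> 'b::euclidean_space"
  assumes \<phi>: "continuous_on UNIV \<phi>"
    and null: "\<And>y b. y \<noteq> 0 \<Longrightarrow> AE v in lborel. y \<bullet> \<phi> v \<noteq> b"
    and J: "finite J" "card J \<le> DIM('b)" "i \<notin> J"
  shows "AE \<omega> in shells_space. inj_on (\<lambda>i. \<phi> (fst (point i \<omega>))) J \<longrightarrow>
     \<phi> (fst (point i \<omega>)) \<notin> affine hull ((\<lambda>i. \<phi> (fst (point i \<omega>))) ` J)"
proof -
  \<comment> \<open>An injection of \<open>J\<close> into the basis stores the affine coefficients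
    as coordinates of one vector \<open>c\<close> of the target space, so that compact balls are
    available.\<close>
  obtain e :: "nat \<times> nat \<Rightarrow> 'b" where e: "e ` J \<subseteq> Basis" "inj_on e J"
    using card_le_inj[OF J(1) finite_Basis] J(2) by auto
  define g where "g c \<omega> = \<bar>(\<Sum>i\<in>J. c \<bullet> e i) - 1\<bar> +
      norm ((\<Sum>i\<in>J. (c \<bullet> e i) *\<^sub>R \<phi> (fst (point i \<omega>))) - \<phi> (fst (point i \<omega>)))" for c and \<omega> :: "'a sample"
  \<comment> \<open>There is one constraint only, indexed by \<open>unit\<close> to fit
    \<open>sets_Collect_ex_compact\<close>; the balls exhaust the coefficient vectors.\<close>
  define Q where "Q \<omega> \<longleftrightarrow> (\<forall>m::nat. \<not> (\<exists>c\<in>cball 0 (real m). \<forall>u::unit. g c \<omega> \<le> 0))" for \<omega>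
  have \<phi>_meas: "(\<lambda>\<omega>. \<phi> (fst (point i \<omega>))) \<in> borel_measurable shells_space" for i
    by (rule measurable_compose[OF measurable_point'])
      (intro borel_measurable_continuous_onI continuous_on_compose2[OF \<phi>] continuous_intros, auto)
  note [measurable] = \<phi>_meas
  have Q_meas: "{\<omega>. Q \<omega>} \<in> sets shells_space"
  proof -
    have "{\<omega>\<in>space shells_space. \<exists>c\<in>cball 0 (real m). \<forall>u::unit. g c \<omega> \<le> 0} \<in> sets shells_space" for m
    proof (rule sets_Collect_ex_compact)
      show "(\<lambda>\<omega>. g c \<omega>) \<in> borel_measurable shells_space" for c unfolding g_def by measurable
      show "continuous_on (cball 0 (real m)) (\<lambda>c. g c \<omega>)" for \<omega> unfolding g_def by (intro continuous_intros)
    qed simp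
    then have "{\<omega>\<in>space shells_space. \<forall>m. \<not> (\<exists>c\<in>cball 0 (real m). \<forall>u::unit. g c \<omega> \<le> 0)} \<in> sets shells_space"
      by (intro sets.sets_Collect_countable_All sets.sets_Collect_neg)
    then show ?thesis by (simp add: Q_def)
  qed
  have Q_iff: "Q \<omega> \<longleftrightarrow> \<not> (\<exists>c. (\<Sum>i\<in>J. c \<bullet> e i) = 1 \<and> (\<Sum>i\<in>J. (c \<bullet> e i) *\<^sub>R \<phi> (fst (point i \<omega>))) = \<phi> (fst (point i \<omega>)))" for \<omega>
  proof -
    have g0: "g c \<omega> \<le> 0 \<longleftrightarrow> (\<Sum>i\<in>J. c \<bullet> e i) = 1 \<and> (\<Sum>i\<in>J. (c \<bullet> e i) *\<^sub>R \<phi> (fst (point i \<omega>))) = \<phi> (fst (point i \<omega>))" for c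
    proof -
      have "\<bar>x\<bar> + norm y \<le> 0 \<longleftrightarrow> x = 0 \<and> y = 0" for x :: real and y :: 'b
        by (smt (verit) norm_ge_zero norm_le_zero_iff)
      then show ?thesis by (simp add: g_def)
    qed
    have "\<exists>m::nat. c \<in> cball 0 (real m)" for c :: 'b using real_arch_simple[of "norm c"] by simp
    then show ?thesis unfolding Q_def g0 by blast
  qed
  have "AE \<omega> in shells_space. Q \<omega>"
  proof (rule AE_shells_resample[OF Q_meas, of i])
    fix \<omega> :: "'a sample"
    let ?S = "(\<lambda>i. \<phi> (fst (point i \<omega>))) ` J"
    have "aff_dim ?S \<le> int (card ?S) - 1" using J(1) by (intro aff_dim_le_card) auto
    also have "\<dots> < int DIM('b)" using card_image_le[OF J(1), of "\<lambda>i. \<phi> (fst (point i \<omega>))"] J(2) by linarith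
    finally obtain y b where y: "y \<noteq> 0" "?S \<subseteq> {x. y \<bullet> x = b}" using aff_lowdim_subset_hyperplane by blast
    have "AE z in (lborel :: ('a \<times> real) measure). y \<bullet> \<phi> (fst z) \<noteq> b" by (rule AE_lborel_fst[OF null[OF y(1)]])
    then show "AE z in lborel. Q (set_point i \<omega> z)"
    proof eventually_elim
      case (elim z)
      have pJ: "point k (set_point i \<omega> z) = point k \<omega>" if "k \<in> J" for k
        using that J(3) by (auto simp: point_set_point)
      show "Q (set_point i \<omega> z)"
        unfolding Q_iff
      proof
        assume "\<exists>c. (\<Sum>k\<in>J. c \<bullet> e k) = 1 \<and> (\<Sum>k\<in>J. (c \<bullet> e k) *\<^sub>R \<phi> (fst (point k (set_point i \<omega> z))))
            = \<phi> (fst (point i (set_point i \<omega> z)))"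
        then obtain c where c: "(\<Sum>k\<in>J. c \<bullet> e k) = 1" "(\<Sum>k\<in>J. (c \<bullet> e k) *\<^sub>R \<phi> (fst (point k \<omega>))) = \<phi> (fst z)"
          using pJ by (auto simp: point_set_point cong: sum.cong)
        have "y \<bullet> \<phi> (fst z) = (\<Sum>k\<in>J. (c \<bullet> e k) * (y \<bullet> \<phi> (fst (point k \<omega>))))"
          unfolding c(2)[symmetric] by (simp add: inner_sum_right)
        also have "\<dots> = (\<Sum>k\<in>J. (c \<bullet> e k) * b)" using y(2) by (intro sum.cong) auto
        also have "\<dots> = b" using c(1) by (simp add: sum_distrib_right[symmetric])
        finally show False using elim by simp
      qed
    qed
  qed
  then show ?thesis
  proof eventually_elim
    case (elim \<omega>)
    let ?f = "\<lambda>i. \<phi> (fst (point i \<omega>))"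
    show ?case
    proof (intro impI notI)
      assume inj: "inj_on ?f J" and "?f i \<in> affine hull (?f ` J)"
      then obtain u where u: "sum u (?f ` J) = 1" "(\<Sum>v\<in>?f ` J. u v *\<^sub>R v) = ?f i"
        using J(1) by (auto simp: affine_hull_finite)
      define c where "c = (\<Sum>k\<in>J. u (?f k) *\<^sub>R e k)"
      have ce: "c \<bullet> e k = u (?f k)" if k: "k \<in> J" for k
      proof -
        have "c \<bullet> e k = (\<Sum>l\<in>J. u (?f l) * (e l \<bullet> e k))" by (simp add: c_def inner_sum_left)
        also have "\<dots> = (\<Sum>l\<in>J. if l = k then u (?f l) else 0)"
        proof (intro sum.cong refl)
          fix l assume l: "l \<in> J"
          have "e l \<bullet> e k = (if l = k then 1 else 0)"
            using inner_Basis[of "e l" "e k"] inj_on_eq_iff[OF e(2) l k] subsetD[OF e(1)] l k by simp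
          then show "u (?f l) * (e l \<bullet> e k) = (if l = k then u (?f l) else 0)" by simp
        qed
        also have "\<dots> = u (?f k)" using J(1) k by simp
        finally show ?thesis .
      qed
      have "(\<Sum>k\<in>J. c \<bullet> e k) = 1" using u(1) ce by (simp add: sum.reindex[OF inj])
      moreover have "(\<Sum>k\<in>J. (c \<bullet> e k) *\<^sub>R ?f k) = ?f i" using u(2) ce by (simp add: sum.reindex[OF inj])
      ultimately show False using elim unfolding Q_iff by blast
    qed
  qed
qed

lemma AE_hyperplane: "y \<noteq> 0 \<Longrightarrow> AE v in lborel. y \<bullet> (v :: 'a::euclidean_space) \<noteq> b"
  using AE_lborel_not_closed[OF negligible_hyperplane closed_hyperplane, of y b] by simp

text \<open>The lift \<open>v \<mapsto> (v, \<bar>v\<bar>\<^sup>2)\<close> turns cosphericality into affine dependence.\<close>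

lemma AE_lifted_hyperplane:
  fixes y :: "'a::euclidean_space \<times> real"
  assumes "y \<noteq> 0"
  shows "AE v in lborel. y \<bullet> (v, v \<bullet> v) \<noteq> b"
proof (cases "snd y = 0")
  case True
  then have "fst y \<noteq> 0" using assms by (auto simp: prod_eq_iff)
  then show ?thesis using AE_hyperplane[of "fst y" b] True by (simp add: inner_prod_def)
next
  case False
  define c where "c = snd y"
  \<comment> \<open>Completing the square turns the equation into that of a sphere with centre
    \<open>a\<close>.\<close>
  define a where "a = - (1 / (2 * c)) *\<^sub>R fst y"
  have "{v. y \<bullet> (v, v \<bullet> v) = b} \<subseteq> sphere a (sqrt (b / c + a \<bullet> a))"
  proof
    fix v assume "v \<in> {v. y \<bullet> (v, v \<bullet> v) = b}"
    then have "fst y \<bullet> v + c * (v \<bullet> v) = b" by (simp add: inner_prod_def c_def)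
    then have "v \<bullet> v = b / c - (fst y \<bullet> v) / c" using False by (simp add: c_def field_simps)
    moreover have "a \<bullet> v = - (fst y \<bullet> v) / (2 * c)" by (simp add: a_def)
    ultimately have "(norm (a - v))\<^sup>2 = b / c + a \<bullet> a"
      by (simp add: power2_norm_eq_inner inner_diff_left inner_diff_right inner_commute)
    then have "norm (a - v) = sqrt (b / c + a \<bullet> a)" by (metis norm_ge_zero real_sqrt_unique)
    then show "v \<in> sphere a (sqrt (b / c + a \<bullet> a))" by (simp add: dist_norm)
  qed
  moreover have "AE v in lborel. v \<notin> sphere a (sqrt (b / c + a \<bullet> a))"
    by (rule AE_lborel_not_closed) (auto intro: negligible_convex_frontier simp: negligible_sphere)
  ultimately show ?thesis by (auto elim!: eventually_mono)
qed

text \<open>Uniform samples lie in their shell only almost surely. Imposing it makes local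
  finiteness and positive heights hold for every sample.\<close>

definition valid_point :: "nat \<times> nat \<Rightarrow> ('a::euclidean_space) sample \<Rightarrow> bool" where
  "valid_point i \<omega> \<longleftrightarrow> snd i < fst (\<omega> (fst i)) \<and> point i \<omega> \<in> half_shell (fst i)"

definition shells_config :: "('a::euclidean_space) sample \<Rightarrow> ('a \<times> real) set" where
  "shells_config \<omega> = {point i \<omega> | i. valid_point i \<omega>}"

text \<open>Every slab of small levels has to be spread: for the density \<open>f n\<close> the
  levels below \<open>I1 (f n) a\<close> are those known to survive with heights at most
  \<open>a\<close>, and for a given \<open>n\<close> this slab may be thin.\<close>

definition good_config :: "real \<Rightarrow> ('a::euclidean_space \<times> real) set \<Rightarrow> bool" where
  "good_config \<gamma> \<xi> \<longleftrightarrow> (\<forall>p\<in>\<xi>. 0 < snd p \<and> snd p \<noteq> \<gamma>) \<and> inj_on fst \<xi> \<and> generic (fst ` \<xi>) \<and>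
     (\<forall>\<epsilon>>0. spread {v. \<exists>u<\<epsilon>. (v, u) \<in> \<xi>})"

lemma valid_point_in_ball:
  assumes "valid_point i \<omega>" "point i \<omega> \<in> ball 0 (real J)"
  shows "fst i < J"
proof -
  have "real (fst i) \<le> norm (point i \<omega>)" using assms by (simp add: valid_point_def half_shell_def)
  also have "\<dots> < real J" using assms by simp
  finally show ?thesis by simp
qed

lemma locally_finite_shells_config: "locally_finite_set (shells_config \<omega>)"
  unfolding locally_finite_set_def
proof (intro allI impI)
  fix B :: "('a \<times> real) set" assume "bounded B"
  then obtain r where r: "B \<subseteq> ball 0 r" using bounded_subset_ballD by blast
  obtain J :: nat where J: "r \<le> real J" using real_arch_simple by blast
  have "shells_config \<omega> \<inter> B \<subseteq> (\<lambda>i. point i \<omega>) ` (SIGMA j:{..<J}. {..<fst (\<omega> j)})"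
  proof
    fix p assume p: "p \<in> shells_config \<omega> \<inter> B"
    then obtain i where i: "valid_point i \<omega>" "p = point i \<omega>" by (auto simp: shells_config_def)
    then have "fst i < J" using p r J by (intro valid_point_in_ball[of i \<omega>]) auto
    moreover have "snd i < fst (\<omega> (fst i))" using i(1) by (simp add: valid_point_def)
    ultimately have "i \<in> (SIGMA j:{..<J}. {..<fst (\<omega> j)})" by (cases i) auto
    then show "p \<in> (\<lambda>i. point i \<omega>) ` (SIGMA j:{..<J}. {..<fst (\<omega> j)})" using i(2) by blast
  qed
  then show "finite (shells_config \<omega> \<inter> B)" by (rule finite_subset) auto
qed

lemma card_shells_config:
  assumes inj: "inj_on (\<lambda>i. point i \<omega>) {i. valid_point i \<omega>}" and B: "B \<subseteq> ball 0 (real J)"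
  shows "card (shells_config \<omega> \<inter> B) = (\<Sum>j<J. shell_count j B \<omega>)"
proof -
  have "shells_config \<omega> \<inter> B = (\<lambda>i. point i \<omega>) ` {i. valid_point i \<omega> \<and> point i \<omega> \<in> B}"
    unfolding shells_config_def by blast
  also have "card \<dots> = card {i. valid_point i \<omega> \<and> point i \<omega> \<in> B}"
    by (rule card_image[OF inj_on_subset[OF inj]]) auto
  also have "{i. valid_point i \<omega> \<and> point i \<omega> \<in> B} =
      (SIGMA j:{..<J}. {t. t < fst (\<omega> j) \<and> snd (\<omega> j) t \<in> B \<inter> half_shell j})"
  proof (intro set_eqI iffI)
    fix i assume i: "i \<in> {i. valid_point i \<omega> \<and> point i \<omega> \<in> B}"
    then have "fst i < J" using B by (intro valid_point_in_ball[of i \<omega>]) auto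
    then show "i \<in> (SIGMA j:{..<J}. {t. t < fst (\<omega> j) \<and> snd (\<omega> j) t \<in> B \<inter> half_shell j})"
      using i by (cases i) (simp add: valid_point_def point_def)
  next
    fix i assume "i \<in> (SIGMA j:{..<J}. {t. t < fst (\<omega> j) \<and> snd (\<omega> j) t \<in> B \<inter> half_shell j})"
    then show "i \<in> {i. valid_point i \<omega> \<and> point i \<omega> \<in> B}"
      by (cases i) (simp add: valid_point_def point_def)
  qed
  also have "card \<dots> = (\<Sum>j<J. shell_count j B \<omega>)"
    unfolding shell_count_def by (rule card_SigmaI) auto
  finally show ?thesis .
qed

lemma measurable_sum_shell_count:
  assumes "B \<in> sets borel"
  shows "(\<lambda>\<omega>. \<Sum>j<J. shell_count j B \<omega>) \<in> measurable shells_space (count_space UNIV)"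
proof -
  note [measurable] = measurable_shell_count[OF assms]
  show ?thesis by measurable
qed

text \<open>Missing every \<open>U N\<close> is at most as likely as missing a single one, whose
  void probability is at most \<open>exp (- (real N * c))\<close>.\<close>

lemma AE_hit:
  fixes U :: "nat \<Rightarrow> ('a::euclidean_space \<times> real) set"
  assumes U: "\<And>N. U N \<in> sets borel" "\<And>N. bounded (U N)" "\<And>N. real N * c \<le> measure upper_lebesgue (U N)"
    and c: "c > 0"
  shows "AE \<omega> in shells_space. \<exists>N. \<exists>p\<in>shells_config \<omega>. p \<in> U N"
proof -
  interpret prob_space "shells_space :: 'a sample measure"
    by (rule prob_space_shells_space)
  have "\<exists>J::nat. U N \<subseteq> ball 0 (real J)" for N
  proof -
    obtain r where r: "U N \<subseteq> ball 0 r" using bounded_subset_ballD[OF U(2)] by blast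
    obtain J :: nat where "r \<le> real J" using real_arch_simple by blast
    then show ?thesis using r subset_ball[of r "real J" 0] by blast
  qed
  then obtain J where J: "\<And>N. U N \<subseteq> ball 0 (real (J N))" by metis
  define E where "E N = {\<omega>. (\<Sum>j<J N. shell_count j (U N) \<omega>) = 0}" for N
  have E_sets: "E N \<in> sets shells_space" for N
    using measurable_sets[OF measurable_sum_shell_count[OF U(1)[of N], of "J N"], of "{0}"]
    by (simp add: E_def vimage_def)
  have E_prob: "prob (E N) \<le> exp (- (real N * c))" for N
  proof -
    have "prob (E N) = pmf (pois (measure upper_lebesgue (U N))) 0"
      using prob_shell_counts[where m=1 and B="\<lambda>_. U N" and J="J N" and k="\<lambda>_. 0"] U(1) J by (simp add: E_def disjoint_family_on_def)
    also have "\<dots> = exp (- measure upper_lebesgue (U N))" by (simp add: pmf_pois)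
    also have "\<dots> \<le> exp (- (real N * c))" using U(3)[of N] by simp
    finally show ?thesis .
  qed
  have "prob (\<Inter>N. E N) \<le> exp (- (real N * c))" for N
    using finite_measure_mono[of "\<Inter>N. E N" "E N"] E_sets E_prob[of N] by fastforce
  moreover have "(\<lambda>N. exp (- (real N * c))) \<longlonglongrightarrow> 0"
    using c by real_asymp
  ultimately have "prob (\<Inter>N. E N) \<le> 0"
    by (intro LIMSEQ_le_const) auto
  then have "(\<Inter>N. E N) \<in> null_sets shells_space"
    using E_sets by (intro null_setsI) (auto simp: emeasure_eq_measure measure_le_0_iff)
  then show ?thesis
  proof (rule AE_I', intro subsetI)
    fix \<omega> assume \<omega>: "\<omega> \<in> {\<omega> \<in> space shells_space. \<not> (\<exists>N. \<exists>p\<in>shells_config \<omega>. p \<in> U N)}"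
    have "shell_count j (U N) \<omega> = 0" for j N
    proof -
      have "{t. t < fst (\<omega> j) \<and> snd (\<omega> j) t \<in> U N \<inter> half_shell j} = {}"
      proof (rule equals0I)
        fix t assume t: "t \<in> {t. t < fst (\<omega> j) \<and> snd (\<omega> j) t \<in> U N \<inter> half_shell j}"
        then have "valid_point (j, t) \<omega>" "point (j, t) \<omega> \<in> U N" by (auto simp: valid_point_def point_def)
        then show False using \<omega> unfolding shells_config_def by blast
      qed
      then show ?thesis by (simp add: shell_count_def)
    qed
    then show "\<omega> \<in> (\<Inter>N. E N)" by (simp add: E_def)
  qed
qed

text \<open>Along each half-axis any slab above height 0 contains infinitely many disjoint balls of
  equal volume, so points occur arbitrarily far out. Such points on all half-axes serve every
  direction, because a unit vector has a coordinate of modulus at least 1/d.\<close>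

lemma AE_spread_shells_config:
  "AE \<omega> in (shells_space :: ('a::euclidean_space) sample measure).
     \<forall>\<epsilon>>0. spread {v. \<exists>u<\<epsilon>. (v, u) \<in> shells_config \<omega>}"
proof -
  \<comment> \<open>The balls touch height 0 from above, hence stay below height
    \<open>2 * r\<close>; the spacing 3 keeps balls of radius at most 1 disjoint.\<close>
  define b where "b e r k = ball (real (3 * k) *\<^sub>R e, r) r" for e :: 'a and r :: real and k :: nat
  define D where "D = Basis \<union> uminus ` (Basis :: 'a set)"
  have D1: "norm e = 1" if "e \<in> D" for e using that by (auto simp: D_def)
  have finD: "finite D" by (simp add: D_def)
  have hit: "AE \<omega> in shells_space. \<exists>N. \<exists>p\<in>shells_config \<omega>. p \<in> (\<Union>k\<in>{m..<m + N}. b e r k)"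
    if e: "e \<in> D" and r: "0 < r" "r \<le> 1" for e r m
  proof (rule AE_hit)
    define c where "c = measure lborel (ball (0 :: 'a \<times> real) r)"
    show "c > 0" using content_ball_pos[OF r(1)] by (simp add: c_def)
    fix N
    show sets: "(\<Union>k\<in>{m..<m + N}. b e r k) \<in> sets borel" by (intro sets.finite_UN) (auto simp: b_def)
    show "bounded (\<Union>k\<in>{m..<m + N}. b e r k)" by (intro bounded_UN) (auto simp: b_def)
    have pos: "0 < snd p" if "p \<in> b e r k" for p and k :: nat
    proof -
      have "dist r (snd p) < r"
        using that dist_snd_le[of "(real (3 * k) *\<^sub>R e, r)" p] by (simp add: b_def)
      then show ?thesis by (simp add: dist_real_def)
    qed
    have "real N * c = (\<Sum>k\<in>{m..<m + N}. measure lborel (b e r k))"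
      using r by (simp add: b_def c_def content_ball)
    also have "\<dots> = measure lborel (\<Union>k\<in>{m..<m + N}. b e r k)"
    proof (rule measure_finite_Union[symmetric])
      show "disjoint_family_on (b e r) {m..<m + N}"
        unfolding disjoint_family_on_def
      proof (intro ballI impI)
        fix k l :: nat assume "k \<noteq> l"
        have "b e r k \<inter> b e r l = {}"
        proof (rule equals0I)
          fix p assume p: "p \<in> b e r k \<inter> b e r l"
          have "dist (real (3 * k) *\<^sub>R e) (fst p) < r" "dist (real (3 * l) *\<^sub>R e) (fst p) < r"
            using p dist_fst_le[of "(real (3 * k) *\<^sub>R e, r)" p] dist_fst_le[of "(real (3 * l) *\<^sub>R e, r)" p]
            by (auto simp: b_def)
          then have lt: "dist (real (3 * k) *\<^sub>R e) (real (3 * l) *\<^sub>R e) < 2"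
            using dist_triangle2[of "real (3 * k) *\<^sub>R e" "real (3 * l) *\<^sub>R e" "fst p"] r(2) by linarith
          have eq: "dist (real (3 * k) *\<^sub>R e) (real (3 * l) *\<^sub>R e) = 3 * \<bar>real k - real l\<bar>"
          proof -
            have "real (3 * k) *\<^sub>R e - real (3 * l) *\<^sub>R e = (3 * (real k - real l)) *\<^sub>R e"
              by (simp add: algebra_simps)
            then show ?thesis by (simp only: dist_norm norm_scaleR D1[OF e] abs_mult)
          qed
          have "\<bar>real k - real l\<bar> \<ge> 1" using \<open>k \<noteq> l\<close> by linarith
          moreover have "\<not> 3 * d < 2" if "1 \<le> d" for d :: real using that by simp
          ultimately show False using lt unfolding eq by blast
        qed
        then show "b e r k \<inter> b e r l = {}" .
      qed
      show "b e r ` {m..<m + N} \<subseteq> sets lborel" by (auto simp: b_def)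
      show "emeasure lborel (b e r k) \<noteq> \<infinity>" for k
        unfolding b_def using emeasure_lborel_ball_finite[of "(real (3 * k) *\<^sub>R e, r)" r] by simp
    qed simp
    also have "(\<Union>k\<in>{m..<m + N}. b e r k) = (\<Union>k\<in>{m..<m + N}. b e r k) \<inter> {p. 0 < snd p}" using pos by blast
    also have "measure lborel \<dots> = measure upper_lebesgue (\<Union>k\<in>{m..<m + N}. b e r k)"
      by (rule measure_upper_lebesgue[OF sets, symmetric])
    finally show "real N * c \<le> measure upper_lebesgue (\<Union>k\<in>{m..<m + N}. b e r k)" by simp
  qed
  \<comment> \<open>Heights in these balls stay below \<open>2 * r n = 1 / real (Suc n)\<close>,
    which falls below any \<epsilon>; countably many radii leave a single null set.\<close>
  define r where "r n = 1 / (2 * real (Suc n))" for n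
  have r: "0 < r n" "r n \<le> 1" for n by (auto simp: r_def field_simps)
  have "AE \<omega> in shells_space. \<forall>e\<in>D. \<forall>n m. \<exists>N. \<exists>p\<in>shells_config \<omega>. p \<in> (\<Union>k\<in>{m..<m + N}. b e (r n) k)"
    using finD hit r by (simp add: AE_all_countable AE_finite_all)
  then show ?thesis
  proof eventually_elim
    case (elim \<omega>)
    show ?case
      unfolding spread_def
    proof (intro allI impI)
      fix \<epsilon> R :: real assume "\<epsilon> > 0"
      then obtain n where n: "1 / real (Suc n) < \<epsilon>" using nat_approx_posE by blast
      \<comment> \<open>The factor d undoes the coordinate bound 1/d, and the extra 1 pays for the
        distance between the point found and the axis position of its ball.\<close>
      obtain m :: nat where m: "real DIM('a) * (R + 1) \<le> real m" using real_arch_simple by blast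
      have "\<exists>v. (\<exists>u<\<epsilon>. (v, u) \<in> shells_config \<omega>) \<and> (\<exists>k\<ge>m. norm (v - real (3 * k) *\<^sub>R e) \<le> 1)" if e: "e \<in> D" for e
      proof -
        obtain p k where p: "p \<in> shells_config \<omega>" "k \<ge> m" "p \<in> b e (r n) k" using elim e by force
        have "dist (r n) (snd p) < r n" "dist (real (3 * k) *\<^sub>R e) (fst p) < r n"
          using p(3) dist_snd_le[of "(real (3 * k) *\<^sub>R e, r n)" p] dist_fst_le[of "(real (3 * k) *\<^sub>R e, r n)" p]
          by (auto simp: b_def)
        then have "snd p < 2 * r n" "norm (fst p - real (3 * k) *\<^sub>R e) \<le> 1"
          using r(2)[of n] by (auto simp: dist_real_def dist_norm norm_minus_commute)
        moreover have "2 * r n = 1 / real (Suc n)" unfolding r_def by (simp add: divide_simps)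
        then have "2 * r n < \<epsilon>" using n by simp
        ultimately show ?thesis using p(1,2) by (intro exI[of _ "fst p"]) (auto intro!: exI[of _ "snd p"] exI[of _ k])
      qed
      then obtain v where v: "\<And>e. e \<in> D \<Longrightarrow> \<exists>u<\<epsilon>. (v e, u) \<in> shells_config \<omega>"
        "\<And>e. e \<in> D \<Longrightarrow> \<exists>k\<ge>m. norm (v e - real (3 * k) *\<^sub>R e) \<le> 1" by metis
      have "\<exists>w\<in>v ` D. R \<le> w \<bullet> e" if e: "norm e = 1" for e :: 'a
      proof -
        have "\<exists>i\<in>Basis. 1 / real DIM('a) \<le> \<bar>e \<bullet> i\<bar>"
        proof (rule ccontr)
          assume "\<not> ?thesis"
          then have "(\<Sum>i\<in>Basis. \<bar>e \<bullet> i\<bar>) < (\<Sum>i\<in>(Basis :: 'a set). 1 / real DIM('a))"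
            by (intro sum_strict_mono) auto
          also have "\<dots> = 1" by simp
          finally show False using norm_le_l1[of e] e by simp
        qed
        then obtain i where i: "i \<in> Basis" "1 / real DIM('a) \<le> \<bar>e \<bullet> i\<bar>" by auto
        define d where "d = (if 0 \<le> e \<bullet> i then i else - i)"
        have d: "d \<in> D" "d \<bullet> e = \<bar>e \<bullet> i\<bar>" using i(1) by (auto simp: d_def D_def inner_commute)
        obtain k where k: "k \<ge> m" "norm (v d - real (3 * k) *\<^sub>R d) \<le> 1" using v(2)[OF d(1)] by blast
        have "\<bar>(v d - real (3 * k) *\<^sub>R d) \<bullet> e\<bar> \<le> 1"
          using Cauchy_Schwarz_ineq2[of "v d - real (3 * k) *\<^sub>R d" e] k(2) e by simp
        then have "v d \<bullet> e \<ge> real (3 * k) * \<bar>e \<bullet> i\<bar> - 1" by (simp add: inner_diff_left d(2))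
        moreover have "R + 1 \<le> real (3 * k) * \<bar>e \<bullet> i\<bar>"
        proof -
          have "R + 1 \<le> real m * (1 / real DIM('a))" using m by (simp add: field_simps)
          also have "\<dots> \<le> real (3 * k) * \<bar>e \<bullet> i\<bar>" using i(2) k(1) by (intro mult_mono) auto
          finally show ?thesis .
        qed
        ultimately show ?thesis using d(1) by (intro bexI[of _ "v d"]) auto
      qed
      then show "\<exists>F\<subseteq>{v. \<exists>u<\<epsilon>. (v, u) \<in> shells_config \<omega>}. finite F \<and> (\<forall>e. norm e = 1 \<longrightarrow> (\<exists>v\<in>F. R \<le> v \<bullet> e))"
        using v(1) finD by (intro exI[of _ "v ` D"]) auto
    qed
  qed
qed

text \<open>An affinely dependent set has a point in the affine hull of the others, which the
  conditions on \<open>f\<close> forbid. The lifts of d + 2 points on a sphere lie on a hyperplane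
  in dimension d + 1, so they are affinely dependent.\<close>

lemma generic_of_affine_conditions:
  fixes f :: "'i \<Rightarrow> 'a::euclidean_space"
  assumes A1: "\<And>i J. finite J \<Longrightarrow> card J \<le> DIM('a) \<Longrightarrow> i \<notin> J \<Longrightarrow> inj_on f J \<Longrightarrow> f i \<notin> affine hull (f ` J)"
    and A2: "\<And>i J. finite J \<Longrightarrow> card J \<le> DIM('a) + 1 \<Longrightarrow> i \<notin> J \<Longrightarrow> inj_on (\<lambda>i. (f i, f i \<bullet> f i)) J \<Longrightarrow>
      (f i, f i \<bullet> f i) \<notin> affine hull ((\<lambda>i. (f i, f i \<bullet> f i)) ` J)"
    and X: "X \<subseteq> range f"
  shows "generic X"
  unfolding generic_def
proof (intro conjI allI impI notI; (elim conjE exE)?)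
  obtain idx where idx: "\<And>v. v \<in> X \<Longrightarrow> f (idx v) = v" using X by (metis f_inv_into_f subsetD)
  have idx_inj: "inj_on idx X" using idx by (rule inj_on_inverseI)
  {
    fix S assume S: "S \<subseteq> X" "finite S" "card S \<le> DIM('a) + 1" "affine_dependent S"
    then obtain x where x: "x \<in> S" "x \<in> affine hull (S - {x})" unfolding affine_dependent_def by blast
    let ?J = "idx ` (S - {x})"
    have fJ: "f ` ?J = S - {x}"
    proof -
      have "f ` ?J = (\<lambda>v. v) ` (S - {x})" unfolding image_image using idx S(1) by (intro image_cong) auto
      then show ?thesis by simp
    qed
    have "f (idx x) \<notin> affine hull (f ` ?J)"
    proof (rule A1)
      show "finite ?J" using S(2) by simp
      show "card ?J \<le> DIM('a)" using S(2,3) x(1) card_image_le[of "S - {x}" idx] by simp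
      show "idx x \<notin> ?J"
      proof
        assume "idx x \<in> ?J"
        then obtain v where "v \<in> S - {x}" "idx x = idx v" by auto
        then show False using inj_onD[OF idx_inj, of x v] x(1) S(1) by auto
      qed
      show "inj_on f ?J"
        by (rule inj_on_inverseI[of _ idx]) (use idx S(1) in force)
    qed
    then show False using x idx[of x] S(1) unfolding fJ by auto
  next
    fix S w r assume S: "S \<subseteq> X" "card S = DIM('a) + 2" "\<forall>v\<in>S. norm (w - v) = r"
    have finS: "finite S" using S(2) card.infinite by fastforce
    let ?L = "\<lambda>v :: 'a. (v, v \<bullet> v)"
    have injL: "inj_on ?L A" for A by (auto simp: inj_on_def)
    define T where "T = ?L ` S"
    have cardT: "card T = DIM('a) + 2" "finite T" using S(2) finS injL by (auto simp: T_def card_image)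
    have "affine_dependent T"
    proof (rule ccontr)
      assume "\<not> affine_dependent T"
      then have "aff_dim T = int (card T) - 1" by (simp add: affine_independent_iff_card)
      \<comment> \<open>Expanding the squared distance makes the equation of the sphere linear in
        the lifted point.\<close>
      moreover have "T \<subseteq> {z. (- (2 *\<^sub>R w), 1) \<bullet> z = r\<^sup>2 - w \<bullet> w}"
      proof
        fix z assume "z \<in> T"
        then obtain v where v: "v \<in> S" "z = (v, v \<bullet> v)" by (auto simp: T_def)
        have "(norm (w - v))\<^sup>2 = r\<^sup>2" using S(3) v(1) by simp
        then show "z \<in> {z. (- (2 *\<^sub>R w), 1) \<bullet> z = r\<^sup>2 - w \<bullet> w}"
          by (simp add: v(2) inner_prod_def power2_norm_eq_inner inner_diff_left inner_diff_right inner_commute)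
      qed
      then have "aff_dim T \<le> aff_dim {z. (- (2 *\<^sub>R w), 1 :: real) \<bullet> z = r\<^sup>2 - w \<bullet> w}" by (rule aff_dim_subset)
      moreover have "aff_dim {z. (- (2 *\<^sub>R w), 1 :: real) \<bullet> z = r\<^sup>2 - w \<bullet> w} = int DIM('a \<times> real) - 1"
        using aff_dim_hyperplane[of "(- (2 *\<^sub>R w), 1 :: real)" "r\<^sup>2 - w \<bullet> w"] by (simp add: prod_eq_iff)
      ultimately show False using cardT by simp
    qed
    then obtain z where z: "z \<in> T" "z \<in> affine hull (T - {z})" unfolding affine_dependent_def by blast
    then obtain x where x: "x \<in> S" "z = ?L x" by (auto simp: T_def)
    let ?J = "idx ` (S - {x})"
    let ?f = "\<lambda>i. (f i, f i \<bullet> f i)"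
    have fJ: "?f ` ?J = T - {z}"
    proof -
      have "?f ` ?J = ?L ` (S - {x})" unfolding image_image using idx S(1) by (intro image_cong) auto
      also have "\<dots> = T - {z}" using x by (auto simp: T_def)
      finally show ?thesis .
    qed
    have "?f (idx x) \<notin> affine hull (?f ` ?J)"
    proof (rule A2)
      show "finite ?J" using finS by simp
      show "card ?J \<le> DIM('a) + 1" using S(2) finS x(1) card_image_le[of "S - {x}" idx] by simp
      show "idx x \<notin> ?J"
      proof
        assume "idx x \<in> ?J"
        then obtain v where "v \<in> S - {x}" "idx x = idx v" by auto
        then show False using inj_onD[OF idx_inj, of x v] x(1) S(1) by auto
      qed
      show "inj_on ?f ?J"
        by (rule inj_on_inverseI[of _ "\<lambda>z. idx (fst z)"]) (use idx S(1) in force)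
    qed
    then show False using x z idx[of x] S(1) unfolding fJ by auto
  }
qed

text \<open>There are only countably many finite index sets, so the null sets from
  \<open>AE_not_in_affine_hull\<close> can be united. It is applied to the identity and to the lift
  to the paraboloid.\<close>

lemma AE_good_config:
  "AE \<omega> in (shells_space :: ('a::euclidean_space) sample measure).
     good_config \<gamma> (shells_config \<omega>) \<and> inj (\<lambda>i. fst (point i \<omega>))"
proof -
  let ?M = "shells_space :: 'a sample measure"
  let ?v = "\<lambda>i \<omega>. fst (point i \<omega> :: 'a \<times> real)"
  define \<J> where "\<J> = {J :: (nat \<times> nat) set. finite J}"
  have c: "countable \<J>" unfolding \<J>_def by (rule countable_Collect_finite)
  have "AE \<omega> in ?M. card J \<le> DIM('a) \<longrightarrow> i \<notin> J \<longrightarrow> inj_on (\<lambda>i. ?v i \<omega>) J \<longrightarrow>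
      ?v i \<omega> \<notin> affine hull ((\<lambda>i. ?v i \<omega>) ` J)" if "J \<in> \<J>" for i J
  proof (cases "card J \<le> DIM('a) \<and> i \<notin> J")
    case True
    then show ?thesis
      using AE_not_in_affine_hull[of "\<lambda>v::'a. v" J i, OF continuous_on_id AE_hyperplane] that by (simp add: \<J>_def)
  qed auto
  then have A1: "AE \<omega> in ?M. \<forall>J\<in>\<J>. \<forall>i. card J \<le> DIM('a) \<longrightarrow> i \<notin> J \<longrightarrow> inj_on (\<lambda>i. ?v i \<omega>) J \<longrightarrow>
      ?v i \<omega> \<notin> affine hull ((\<lambda>i. ?v i \<omega>) ` J)"
    using c by (simp add: AE_ball_countable AE_all_countable)
  have "AE \<omega> in ?M. card J \<le> DIM('a) + 1 \<longrightarrow> i \<notin> J \<longrightarrow> inj_on (\<lambda>i. (?v i \<omega>, ?v i \<omega> \<bullet> ?v i \<omega>)) J \<longrightarrow>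
      (?v i \<omega>, ?v i \<omega> \<bullet> ?v i \<omega>) \<notin> affine hull ((\<lambda>i. (?v i \<omega>, ?v i \<omega> \<bullet> ?v i \<omega>)) ` J)" if "J \<in> \<J>" for i J
  proof (cases "card J \<le> DIM('a) + 1 \<and> i \<notin> J")
    case True
    have "continuous_on UNIV (\<lambda>v::'a. (v, v \<bullet> v))" by (intro continuous_intros)
    from AE_not_in_affine_hull[OF this AE_lifted_hyperplane, of J i] True that show ?thesis
      by (simp add: \<J>_def)
  qed auto
  then have A2: "AE \<omega> in ?M. \<forall>J\<in>\<J>. \<forall>i. card J \<le> DIM('a) + 1 \<longrightarrow> i \<notin> J \<longrightarrow> inj_on (\<lambda>i. (?v i \<omega>, ?v i \<omega> \<bullet> ?v i \<omega>)) J \<longrightarrow>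
      (?v i \<omega>, ?v i \<omega> \<bullet> ?v i \<omega>) \<notin> affine hull ((\<lambda>i. (?v i \<omega>, ?v i \<omega> \<bullet> ?v i \<omega>)) ` J)"
    using c by (simp add: AE_ball_countable AE_all_countable)
  have A3: "AE \<omega> in ?M. \<forall>i. snd (point i \<omega>) \<noteq> \<gamma>"
    unfolding AE_all_countable
  proof
    fix i
    have "(\<lambda>\<omega>. snd (point i \<omega>)) \<in> borel_measurable ?M"
      by (rule measurable_compose[OF measurable_point'])
        (intro borel_measurable_continuous_onI continuous_intros)
    then have "{\<omega>. snd (point i \<omega>) \<noteq> \<gamma>} \<in> sets ?M"
      using measurable_sets[of "\<lambda>\<omega>. snd (point i \<omega>)" ?M borel "- {\<gamma>}"] by (simp add: vimage_def)
    then show "AE \<omega> in ?M. snd (point i \<omega>) \<noteq> \<gamma>"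
      by (rule AE_shells_resample[where i=i]) (simp add: point_set_point AE_lborel_snd_neq)
  qed
  show ?thesis using A1 A2 A3 AE_spread_shells_config
  proof eventually_elim
    case (elim \<omega>)
    \<comment> \<open>Two equal sites would put one of them into the affine hull of the other, the
      case of a one-point \<open>J\<close>.\<close>
    have inj: "inj (\<lambda>i. ?v i \<omega>)"
    proof (rule injI, rule ccontr)
      fix i j assume ij: "?v i \<omega> = ?v j \<omega>" "i \<noteq> j"
      have "{j} \<in> \<J>" by (simp add: \<J>_def)
      moreover have "card {j} \<le> DIM('a)" using DIM_positive[where 'a='a] by simp
      ultimately have "?v i \<omega> \<notin> affine hull ((\<lambda>i. ?v i \<omega>) ` {j})" using elim(1) ij(2) by blast
      then show False using ij(1) by simp
    qed
    have "generic (fst ` shells_config \<omega>)"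
    proof (rule generic_of_affine_conditions)
      show "fst ` shells_config \<omega> \<subseteq> range (\<lambda>i. ?v i \<omega>)" by (auto simp: shells_config_def)
      fix i J
      show "?v i \<omega> \<notin> affine hull ((\<lambda>i. ?v i \<omega>) ` J)"
        if "finite J" "card J \<le> DIM('a)" "i \<notin> J" "inj_on (\<lambda>i. ?v i \<omega>) J"
        using elim(1) that unfolding \<J>_def by blast
      show "(?v i \<omega>, ?v i \<omega> \<bullet> ?v i \<omega>) \<notin> affine hull ((\<lambda>i. (?v i \<omega>, ?v i \<omega> \<bullet> ?v i \<omega>)) ` J)"
        if "finite J" "card J \<le> DIM('a) + 1" "i \<notin> J" "inj_on (\<lambda>i. (?v i \<omega>, ?v i \<omega> \<bullet> ?v i \<omega>)) J"
        using elim(2) that unfolding \<J>_def by blast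
    qed
    moreover have "\<forall>p\<in>shells_config \<omega>. 0 < snd p \<and> snd p \<noteq> \<gamma>"
    proof
      fix p assume "p \<in> shells_config \<omega>"
      then obtain i where "p = point i \<omega>" "p \<in> half_shell (fst i)"
        unfolding shells_config_def valid_point_def by blast
      then show "0 < snd p \<and> snd p \<noteq> \<gamma>" using spec[OF elim(3), of i] by (simp add: half_shell_def)
    qed
    moreover have "inj_on fst (shells_config \<omega>)"
    proof (rule inj_onI)
      fix p q assume "p \<in> shells_config \<omega>" "q \<in> shells_config \<omega>" "fst p = fst q"
      then obtain i j where "p = point i \<omega>" "q = point j \<omega>" "fst (point i \<omega>) = fst (point j \<omega>)"
        unfolding shells_config_def by blast
      then show "p = q" using injD[OF inj, of i j] by simp
    qed
    ultimately show ?case using elim(4) inj by (simp add: good_config_def)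
  qed
qed

text \<open>The theorem prescribes outcomes of type \<open>nat \<Rightarrow> real\<close>. A sample
  is coded by listing its numbers of points, under tag 0, and the coordinates of its points, under
  positive tags.\<close>

lemma ex_inj_shells_real:
  "\<exists>g :: ('a::euclidean_space) sample \<Rightarrow> nat \<Rightarrow> real. inj g"
proof -
  define g where "g \<omega> k = (case from_nat k of (a, j, t) \<Rightarrow> if a = 0 then real (fst (\<omega> j))
      else snd (\<omega> j) t \<bullet> from_nat_into Basis (a - 1))"
    for \<omega> :: "'a sample" and k :: nat
  have "\<omega> = \<omega>'" if eq: "g \<omega> = g \<omega>'" for \<omega> \<omega>'
  proof
    fix j
    have "fst (\<omega> j) = fst (\<omega>' j)"
      using fun_cong[OF eq, of "to_nat (0::nat, j, 0::nat)"] by (simp add: g_def)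
    moreover have "snd (\<omega> j) t = snd (\<omega>' j) t" for t
    proof (rule euclidean_eqI)
      fix b :: "'a \<times> real" assume "b \<in> Basis"
      then obtain a where a: "from_nat_into Basis a = b"
        using from_nat_into_surj[OF countable_finite[OF finite_Basis]] by blast
      show "snd (\<omega> j) t \<bullet> b = snd (\<omega>' j) t \<bullet> b"
        using fun_cong[OF eq, of "to_nat (Suc a, j, t)"] by (simp add: g_def a)
    qed
    ultimately show "\<omega> j = \<omega>' j" by (simp add: prod_eq_iff fun_eq_iff)
  qed
  then show ?thesis unfolding inj_def by blast
qed

text \<open>Samples in the exceptional null set are replaced by one fixed good sample, which changes
  no law and makes good position hold everywhere. \<open>Y\<close> and \<open>V\<close> are exported
  because the measurability of the skeletons needs a listing.\<close>

theorem ex_good_poisson_process: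
  fixes \<gamma> :: real
  shows "\<exists>(M :: (nat \<Rightarrow> real) measure) (Y :: nat \<times> nat \<Rightarrow> (nat \<Rightarrow> real) \<Rightarrow> 'a::euclidean_space \<times> real) V.
    (\<forall>i. Y i \<in> borel_measurable M) \<and> (\<forall>i. {x\<in>space M. V i x} \<in> sets M) \<and>
    poisson_process M upper_lebesgue (\<lambda>x. {Y i x | i. V i x}) \<and>
    (\<forall>x\<in>space M. good_config \<gamma> {Y i x | i. V i x})"
proof -
  let ?S = "shells_space :: 'a sample measure"
  interpret S: prob_space ?S by (rule prob_space_shells_space)
  obtain N where N: "N \<in> null_sets ?S"
      "{\<omega>. \<not> (good_config \<gamma> (shells_config \<omega>) \<and> inj (\<lambda>i. fst (point i \<omega>)))} \<subseteq> N"
    using AE_good_config[of \<gamma>, where 'a='a] unfolding eventually_ae_filter by auto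
  have "N \<noteq> UNIV"
  proof
    assume "N = UNIV"
    then have "emeasure ?S (space ?S) = 0" using N(1) by auto
    then show False using S.emeasure_space_1 by simp
  qed
  then obtain \<omega>0 where \<omega>0: "\<omega>0 \<notin> N" by auto
  define r where "r \<omega> = (if \<omega> \<in> N then \<omega>0 else \<omega>)" for \<omega>
  have r: "r \<in> measurable ?S ?S"
    unfolding r_def using N(1) by (intro measurable_If) auto
  have rN: "r \<omega> \<notin> N" for \<omega> using \<omega>0 by (simp add: r_def)
  obtain g :: "'a sample \<Rightarrow> nat \<Rightarrow> real" where g: "inj g"
    using ex_inj_shells_real by blast
  define M where "M = embed_measure ?S g"
  \<comment> \<open>Decoding followed by repair; its law under \<open>M\<close> is again
    \<open>shells_space\<close>, so all probabilities can be computed there.\<close>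
  define \<phi> where "\<phi> x = r (inv g x)" for x
  have \<phi>g: "\<phi> (g \<omega>) = r \<omega>" for \<omega> using g by (simp add: \<phi>_def)
  have \<phi>: "\<phi> \<in> measurable M ?S"
    unfolding M_def by (rule measurable_embed_measure1) (simp add: \<phi>g r)
  have gM: "g \<in> measurable ?S M" unfolding M_def by (rule measurable_embed_measure2[OF g])
  have M: "M = distr ?S M g" unfolding M_def by (rule embed_measure_eq_distr[OF g])
  have "prob_space (distr ?S M g)" by (rule S.prob_space_distr[OF gM])
  then have probM: "prob_space M" using M by simp
  have "distr M ?S \<phi> = distr (distr ?S M g) ?S \<phi>" using M by simp
  also have "\<dots> = distr ?S ?S r" using \<phi> gM by (simp add: distr_distr o_def \<phi>g)
  also have "\<dots> = distr ?S ?S (\<lambda>\<omega>. \<omega>)"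
  proof (rule distr_cong_AE)
    show "AE \<omega> in ?S. r \<omega> = \<omega>" using AE_not_in[OF N(1)] by eventually_elim (simp add: r_def)
  qed (use r in auto)
  finally have \<phi>_distr: "distr M ?S \<phi> = ?S" by simp
  have trans: "measure M {x\<in>space M. Q (\<phi> x)} = measure ?S {\<omega>. Q \<omega>}" if "{\<omega>. Q \<omega>} \<in> sets ?S" for Q
  proof -
    have "measure ?S {\<omega>. Q \<omega>} = measure (distr M ?S \<phi>) {\<omega>. Q \<omega>}" by (simp add: \<phi>_distr)
    also have "\<dots> = measure M (\<phi> -` {\<omega>. Q \<omega>} \<inter> space M)" using \<phi> that by (rule measure_distr)
    also have "\<phi> -` {\<omega>. Q \<omega>} \<inter> space M = {x\<in>space M. Q (\<phi> x)}" by auto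
    finally show ?thesis by simp
  qed
  have good: "good_config \<gamma> (shells_config (\<phi> x))" "inj (\<lambda>i. fst (point i (\<phi> x)))" for x
    using N(2) rN[of "inv g x"] unfolding \<phi>_def by blast+
  then have injp: "inj_on (\<lambda>i. point i (\<phi> x)) {i. valid_point i (\<phi> x)}" for x
    by (metis (mono_tags, lifting) injD inj_onI)
  have ex_ball: "\<exists>J::nat. B \<subseteq> ball 0 (real J)" if B: "bounded B" for B :: "('a \<times> real) set"
  proof -
    obtain r where r: "B \<subseteq> ball 0 r" using bounded_subset_ballD[OF B] by blast
    obtain J :: nat where "r \<le> real J" using real_arch_simple by blast
    then show ?thesis using r subset_ball[of r "real J" 0] by blast
  qed
  have pp: "poisson_process M upper_lebesgue (\<lambda>x. shells_config (\<phi> x))"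
  proof (rule poisson_processI[OF probM locally_finite_shells_config])
    fix B :: "('a \<times> real) set" assume B: "B \<in> sets borel" "bounded B"
    obtain J :: nat where J: "B \<subseteq> ball 0 (real J)" using ex_ball[OF B(2)] by blast
    show "(\<lambda>x. card (shells_config (\<phi> x) \<inter> B)) \<in> measurable M (count_space UNIV)"
      unfolding card_shells_config[OF injp J]
      by (rule measurable_compose[OF \<phi> measurable_sum_shell_count[OF B(1)]])
  next
    fix m :: nat and B :: "nat \<Rightarrow> ('a \<times> real) set" and k
    assume B: "\<And>i. i < m \<Longrightarrow> B i \<in> sets borel \<and> bounded (B i)" "disjoint_family_on B {..<m}"
    have "bounded (\<Union>i<m. B i)" using B(1) by (intro bounded_UN) auto
    then obtain J where "(\<Union>i<m. B i) \<subseteq> ball 0 (real J)" using ex_ball by blast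
    then have J: "B i \<subseteq> ball 0 (real J)" if "i < m" for i using that by blast
    let ?Q = "\<lambda>\<omega>. \<forall>i<m. (\<Sum>j<J. shell_count j (B i) \<omega>) = k i"
    have "{\<omega>. ?Q \<omega>} \<in> sets ?S"
    proof -
      have "{\<omega>\<in>space ?S. (\<Sum>j<J. shell_count j (B i) \<omega>) = k i} \<in> sets ?S" if "i \<in> {..<m}" for i
        using measurable_sets[OF measurable_sum_shell_count[of "B i" J], of "{k i}"] B(1) that
        by (simp add: vimage_def)
      then have "{\<omega>\<in>space ?S. \<forall>i\<in>{..<m}. (\<Sum>j<J. shell_count j (B i) \<omega>) = k i} \<in> sets ?S"
        by (intro sets.sets_Collect_finite_All) auto
      then show ?thesis by (simp add: Ball_def)
    qed
    from trans[OF this] have "measure M {x\<in>space M. ?Q (\<phi> x)} = (\<Prod>i<m. pmf (pois (measure upper_lebesgue (B i))) (k i))"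
      using prob_shell_counts[where m=m and B=B and J=J and k=k] B J by simp
    moreover have "{x\<in>space M. ?Q (\<phi> x)} = {x\<in>space M. \<forall>i<m. card (shells_config (\<phi> x) \<inter> B i) = k i}"
      using card_shells_config[OF injp J] by (intro Collect_cong conj_cong refl) simp
    ultimately show "measure M {x\<in>space M. \<forall>i<m. card (shells_config (\<phi> x) \<inter> B i) = k i} =
        (\<Prod>i<m. pmf (pois (measure upper_lebesgue (B i))) (k i))" by simp
  qed
  have Y: "(\<lambda>x. point i (\<phi> x)) \<in> borel_measurable M" for i
    by (rule measurable_compose[OF \<phi> measurable_point'])
  have V: "{x\<in>space M. valid_point i (\<phi> x)} \<in> sets M" for i
  proof -
    have "(\<lambda>x. fst (\<phi> x (fst i))) \<in> measurable M (count_space UNIV)"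
      by (rule measurable_compose[OF \<phi> measurable_number])
    from measurable_sets[OF this, of "{snd i<..}"]
    have "{x\<in>space M. snd i < fst (\<phi> x (fst i))} \<in> sets M" by (simp add: vimage_def Int_def conj_commute)
    moreover have "{x\<in>space M. point i (\<phi> x) \<in> half_shell (fst i)} \<in> sets M"
      using measurable_sets[OF Y[of i] half_shell_borel[of "fst i"]] by (simp add: vimage_def Int_def conj_commute)
    ultimately show ?thesis unfolding valid_point_def by (intro sets.sets_Collect_conj)
  qed
  show ?thesis
    using Y V pp good(1) unfolding shells_config_def
    by (intro exI[of _ M] exI[of _ "\<lambda>i x. point i (\<phi> x)"] exI[of _ "\<lambda>i x. valid_point i (\<phi> x)"]
        conjI allI ballI) blast+
qed

section \<open>The quantile coupling\<close>

definition quantile_dom :: "(real \<Rightarrow> real) \<Rightarrow> real set" where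
  "quantile_dom f = {u. 0 < u \<and> (\<exists>x. u \<le> I1 f x)}"

text \<open>The default 0 keeps the function nonnegative and measurable on the whole line; points
  outside the domain are discarded before lifting.\<close>

definition quantile :: "(real \<Rightarrow> real) \<Rightarrow> real \<Rightarrow> real" where
  "quantile f u = (if u \<in> quantile_dom f then Inf {x. u \<le> I1 f x} else 0)"

definition quantile_lift :: "(real \<Rightarrow> real) \<Rightarrow> 'a \<times> real \<Rightarrow> 'a \<times> real" where
  "quantile_lift f p = (fst p, quantile f (snd p))"

text \<open>The one-dimensional factor of \<open>height_intensity\<close> on Borel sets;
  \<open>I1 f\<close> is its distribution function.\<close>

definition height_measure :: "(real \<Rightarrow> real) \<Rightarrow> real measure" where
  "height_measure f = distr (density lebesgue (\<lambda>h. ennreal (zero_ext f h))) borel (\<lambda>x. x)"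

context
  fixes f :: "real \<Rightarrow> real"
  assumes f: "f \<in> L1loc_plus"
begin

lemma zero_ext_nonneg: "0 \<le> zero_ext f x"
  using f by (auto simp: zero_ext_def L1loc_plus_def)

lemma zero_ext_measurable: "zero_ext f \<in> borel_measurable lebesgue"
proof (rule borel_measurable_LIMSEQ_real)
  fix n :: nat
  have "set_integrable lebesgue {0..real n} (zero_ext f)" using f by (auto simp: L1loc_plus_def)
  then show "(\<lambda>x. indicator {0..real n} x *\<^sub>R zero_ext f x) \<in> borel_measurable lebesgue"
    unfolding set_integrable_def by (rule borel_measurable_integrable)
next
  fix x :: real
  have "\<forall>\<^sub>F n in sequentially. indicator {0..real n} x *\<^sub>R zero_ext f x = zero_ext f x"
    using eventually_ge_at_top[of "nat \<lceil>x\<rceil>"]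
    by eventually_elim (auto simp: zero_ext_def indicator_def; linarith)
  then show "(\<lambda>n. indicator {0..real n} x *\<^sub>R zero_ext f x) \<longlonglongrightarrow> zero_ext f x" by (rule tendsto_eventually)
qed

lemma emeasure_height_measure:
  assumes "B \<in> sets borel"
  shows "emeasure (height_measure f) B = (\<integral>\<^sup>+h. ennreal (zero_ext f h) * indicator B h \<partial>lebesgue)"
proof -
  have "emeasure (height_measure f) B = emeasure (density lebesgue (\<lambda>h. ennreal (zero_ext f h))) B"
    unfolding height_measure_def using assms
    by (subst emeasure_distr) (auto simp: measurable_completion)
  also have "\<dots> = (\<integral>\<^sup>+h. ennreal (zero_ext f h) * indicator B h \<partial>lebesgue)"
    using assms zero_ext_measurable by (intro emeasure_density) auto
  finally show ?thesis .
qed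

lemma set_integrable_zero_ext: "set_integrable lebesgue {..x} (zero_ext f)"
proof -
  have "set_integrable lebesgue {0..x} (zero_ext f)" using f by (auto simp: L1loc_plus_def)
  then show ?thesis
    unfolding set_integrable_def
    by (rule Bochner_Integration.integrable_cong[THEN iffD1, rotated 2]) (auto simp: zero_ext_def indicator_def)
qed

lemma emeasure_height_measure_atMost: "emeasure (height_measure f) {..x} = ennreal (I1 f x)"
proof -
  have "emeasure (height_measure f) {..x} = (\<integral>\<^sup>+h. ennreal (indicator {..x} h *\<^sub>R zero_ext f h) \<partial>lebesgue)"
    by (subst emeasure_height_measure) (auto intro!: nn_integral_cong simp: indicator_def)
  also have "\<dots> = ennreal (\<integral>h. indicator {..x} h *\<^sub>R zero_ext f h \<partial>lebesgue)"
    using set_integrable_zero_ext[of x] zero_ext_nonneg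
    by (intro nn_integral_eq_integral) (auto simp: set_integrable_def)
  finally show ?thesis by (simp add: I1_def set_lebesgue_integral_def)
qed

lemma I1_nonneg: "0 \<le> I1 f x"
  unfolding I1_def set_lebesgue_integral_def using zero_ext_nonneg by (intro integral_nonneg_AE) auto

lemma I1_eq_measure: "I1 f x = measure (height_measure f) {..x}"
  using emeasure_height_measure_atMost[of x] I1_nonneg by (simp add: measure_def)

lemma I1_mono: "x \<le> y \<Longrightarrow> I1 f x \<le> I1 f y"
  using emeasure_mono[of "{..x}" "{..y}" "height_measure f"]
  by (simp add: emeasure_height_measure_atMost I1_nonneg height_measure_def[symmetric])
     (auto simp: height_measure_def)

lemma I1_0: "I1 f 0 = 0"
proof -
  have "ennreal (zero_ext f h) * indicator {..0} h = 0" for h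
    by (simp add: zero_ext_def indicator_def)
  then have "emeasure (height_measure f) {..0} = 0" by (simp only: emeasure_height_measure[OF borel_closed[OF closed_atMost]] nn_integral_const) simp
  then show ?thesis using I1_nonneg[of 0] by (simp add: emeasure_height_measure_atMost)
qed

text \<open>Continuity of a measure from above, phrased with a level \<open>u\<close> because it
  serves to show that the infimum in \<open>quantile\<close> is attained.\<close>

lemma I1_right_continuous:
  assumes "\<And>n::nat. u \<le> I1 f (x + 1 / real (Suc n))"
  shows "u \<le> I1 f x"
proof -
  let ?A = "\<lambda>n::nat. {..x + 1 / real (Suc n)}"
  have "(\<lambda>n. measure (height_measure f) (?A n)) \<longlonglongrightarrow> measure (height_measure f) (\<Inter>n. ?A n)"
  proof (rule Lim_measure_decseq)
    show "range ?A \<subseteq> sets (height_measure f)" by (auto simp: height_measure_def)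
    show "decseq ?A" by (auto simp: decseq_def frac_le intro: order_trans)
    show "emeasure (height_measure f) (?A n) \<noteq> \<infinity>" for n by (simp add: emeasure_height_measure_atMost)
  qed
  moreover have "(\<Inter>n. ?A n) = {..x}"
  proof (intro equalityI subsetI)
    fix y assume y: "y \<in> (\<Inter>n. ?A n)"
    have "y \<le> x + e" if e: "e > 0" for e
    proof -
      obtain n where "1 / real (Suc n) < e" using nat_approx_posE[OF e] by blast
      moreover have "y \<le> x + 1 / real (Suc n)" using y by blast
      ultimately show ?thesis by linarith
    qed
    then show "y \<in> {..x}" by (simp add: field_le_epsilon)
  next
    fix y assume "y \<in> {..x}"
    moreover have "0 \<le> 1 / real (Suc n)" for n by simp
    ultimately show "y \<in> (\<Inter>n. ?A n)" by (meson INT_I add_increasing2 atMost_iff)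
  qed
  ultimately have "(\<lambda>n. I1 f (x + 1 / real (Suc n))) \<longlonglongrightarrow> I1 f x" by (simp add: I1_eq_measure)
  then show ?thesis using assms by (intro LIMSEQ_le_const) auto
qed

text \<open>The Galois connection between a distribution function and its generalised inverse. Right
  continuity makes it hold with weak inequalities on both sides; measurability, law and limits of
  quantiles all go through it.\<close>

lemma quantile_le_iff:
  assumes u: "u \<in> quantile_dom f"
  shows "quantile f u \<le> x \<longleftrightarrow> u \<le> I1 f x"
proof -
  let ?S = "{x. u \<le> I1 f x}"
  have ne: "?S \<noteq> {}" using u by (auto simp: quantile_dom_def)
  have "0 \<le> x" if "x \<in> ?S" for x
    using that u I1_mono[of x 0] I1_0 by (auto simp: quantile_dom_def not_le[symmetric] intro: ccontr)
  then have bdd: "bdd_below ?S" by (rule bdd_belowI)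
  show ?thesis
  proof
    assume "u \<le> I1 f x"
    then show "quantile f u \<le> x" using u bdd by (simp add: quantile_def cInf_lower)
  next
    assume q: "quantile f u \<le> x"
    show "u \<le> I1 f x"
    proof (rule I1_right_continuous)
      fix n :: nat
      have "0 < 1 / real (Suc n)" by simp
      moreover have "Inf ?S \<le> x" using q u by (simp add: quantile_def)
      ultimately have "Inf ?S < x + 1 / real (Suc n)" by linarith
      then obtain y where "y \<in> ?S" "y < x + 1 / real (Suc n)" using ne bdd by (auto simp: cInf_less_iff)
      then show "u \<le> I1 f (x + 1 / real (Suc n))" using I1_mono[of y "x + 1 / real (Suc n)"] by simp
    qed
  qed
qed

lemma quantile_nonneg: "0 \<le> quantile f u"
proof (cases "u \<in> quantile_dom f")
  case True
  show ?thesis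
  proof (rule ccontr)
    assume "\<not> 0 \<le> quantile f u"
    then have "quantile f u \<le> 0" by simp
    then have "u \<le> 0" using quantile_le_iff[OF True] I1_0 by simp
    then show False using True by (simp add: quantile_dom_def)
  qed
qed (simp add: quantile_def)

lemma quantile_dom_borel: "quantile_dom f \<in> sets borel"
proof -
  have "quantile_dom f = {0<..} \<inter> (\<Union>n::nat. {..I1 f (real n)})"
  proof (intro equalityI subsetI)
    fix u assume "u \<in> quantile_dom f"
    then obtain x where x: "0 < u" "u \<le> I1 f x" by (auto simp: quantile_dom_def)
    obtain n :: nat where "x \<le> real n" using real_arch_simple by blast
    then have "u \<le> I1 f (real n)" using I1_mono x(2) order_trans by blast
    then show "u \<in> {0<..} \<inter> (\<Union>n::nat. {..I1 f (real n)})" using x(1) by auto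
  qed (auto simp: quantile_dom_def)
  then show ?thesis by auto
qed

lemma quantile_measurable: "quantile f \<in> borel_measurable borel"
proof (rule borel_measurableI_le)
  fix x
  have "{u. quantile f u \<le> x} = (quantile_dom f \<inter> {..I1 f x}) \<union> (if 0 \<le> x then - quantile_dom f else {})"
    using quantile_le_iff by (auto simp: quantile_def)
  then show "{u \<in> space borel. quantile f u \<le> x} \<in> sets borel" using quantile_dom_borel by auto
qed

text \<open>Inverse transform sampling: by \<open>quantile_le_iff\<close> the levels sent to at most
  \<open>x\<close> form the interval from 0 to \<open>I1 f x\<close>, and half-lines determine the
  measure.\<close>

lemma height_measure_eq_distr:
  "height_measure f = distr (density lborel (indicator (quantile_dom f))) borel (quantile f)"
proof (rule measure_eqI_generator_eq[of "range atMost" UNIV _ _ "\<lambda>n. {..real n}"])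
  show "Int_stable (range (atMost :: real \<Rightarrow> _))" by (auto simp: Int_stable_def intro: exI[of _ "min _ _"])
  show "sets (height_measure f) = sigma_sets UNIV (range atMost)"
    by (simp add: height_measure_def borel_eq_atMost)
  show "sets (distr (density lborel (indicator (quantile_dom f))) borel (quantile f)) = sigma_sets UNIV (range atMost)"
    by (simp add: borel_eq_atMost)
  show "(\<Union>n. {..real n}) = UNIV" by (auto simp: real_arch_simple)
  show "emeasure (height_measure f) {..real n} \<noteq> \<infinity>" for n by (simp add: emeasure_height_measure_atMost)
  fix X :: "real set" assume "X \<in> range atMost"
  then obtain x where X: "X = {..x}" by auto
  have "emeasure (distr (density lborel (indicator (quantile_dom f))) borel (quantile f)) X
      = emeasure (density lborel (indicator (quantile_dom f))) (quantile f -` X)"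
    using quantile_measurable by (subst emeasure_distr) (auto simp: X)
  also have "\<dots> = emeasure lborel (quantile_dom f \<inter> quantile f -` X)"
  proof -
    have "quantile f -` X \<in> sets borel" using measurable_sets[OF quantile_measurable, of X] by (simp add: X)
    then show ?thesis
      using quantile_dom_borel by (subst emeasure_density) (auto simp: indicator_inter_arith[symmetric] nn_integral_indicator)
  qed
  also have "quantile_dom f \<inter> quantile f -` X = {0<..I1 f x}"
  proof (intro set_eqI)
    fix u
    have "u \<in> {0<..I1 f x} \<Longrightarrow> u \<in> quantile_dom f" by (auto simp: quantile_dom_def)
    moreover have "u \<in> quantile_dom f \<Longrightarrow> 0 < u" by (simp add: quantile_dom_def)
    ultimately show "u \<in> quantile_dom f \<inter> quantile f -` X \<longleftrightarrow> u \<in> {0<..I1 f x}"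
      using quantile_le_iff[of u x] by (auto simp: X)
  qed
  also have "emeasure lborel {0<..I1 f x} = ennreal (I1 f x)" using I1_nonneg by simp
  finally show "emeasure (height_measure f) X = emeasure (distr (density lborel (indicator (quantile_dom f))) borel (quantile f)) X"
    by (simp add: X emeasure_height_measure_atMost)
qed auto

lemma quantile_lift_measurable: "quantile_lift f \<in> measurable borel (borel :: ('a::euclidean_space \<times> real) measure)"
proof -
  have "(\<lambda>p :: 'a \<times> real. quantile f (snd p)) \<in> borel_measurable borel"
    by (rule measurable_compose[OF _ quantile_measurable]) (intro borel_measurable_continuous_onI continuous_intros)
  moreover have "fst \<in> measurable (borel :: ('a \<times> real) measure) borel"
    by (intro borel_measurable_continuous_onI continuous_intros)
  ultimately show ?thesis unfolding quantile_lift_def[abs_def] by (rule borel_measurable_Pair[rotated])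
qed

lemma quantile_lift_dom_borel: "{p :: 'a::euclidean_space \<times> real. snd p \<in> quantile_dom f} \<in> sets borel"
proof -
  have "snd \<in> measurable (borel :: ('a \<times> real) measure) borel"
    by (intro borel_measurable_continuous_onI continuous_intros)
  from measurable_sets[OF this quantile_dom_borel] show ?thesis by (simp add: vimage_def)
qed

text \<open>For each fixed \<open>v\<close> the sections are compared by
  \<open>height_measure_eq_distr\<close>; integrating over \<open>v\<close> gives the product
  statement.\<close>

lemma emeasure_height_intensity_lift:
  fixes B :: "('a::euclidean_space \<times> real) set"
  assumes B: "B \<in> sets borel"
  shows "{p. snd p \<in> quantile_dom f} \<inter> quantile_lift f -` B \<in> sets borel"
    "emeasure (height_intensity f) B = emeasure lborel ({p. snd p \<in> quantile_dom f} \<inter> quantile_lift f -` B)"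
proof -
  have "quantile_lift f -` B \<in> sets borel" using measurable_sets[OF quantile_lift_measurable B] by simp
  then show S: "{p. snd p \<in> quantile_dom f} \<inter> quantile_lift f -` B \<in> sets borel" using quantile_lift_dom_borel by auto
  have "emeasure (height_intensity f) B =
      (\<integral>\<^sup>+v. (\<integral>\<^sup>+h\<in>{0<..}. ennreal (f h) * indicator B (v, h) \<partial>lebesgue) \<partial>lborel)"
    by (rule emeasure_height_intensity[OF f B])
  also have "\<dots> = (\<integral>\<^sup>+v. emeasure lborel (Pair v -` ({p. snd p \<in> quantile_dom f} \<inter> quantile_lift f -` B)) \<partial>lborel)"
  proof (rule nn_integral_cong)
    fix v :: 'a
    have "Pair v -` B \<in> sets (borel :: real measure)"
    proof -
      have "Pair v \<in> measurable (borel :: real measure) (borel :: ('a \<times> real) measure)"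
        by (intro borel_measurable_continuous_onI continuous_intros)
      from measurable_sets[OF this B] show ?thesis by simp
    qed
    note P = this
    have "(\<integral>\<^sup>+h\<in>{0<..}. ennreal (f h) * indicator B (v, h) \<partial>lebesgue)
        = (\<integral>\<^sup>+h. ennreal (zero_ext f h) * indicator (Pair v -` B) h \<partial>lebesgue)"
      by (intro nn_integral_cong) (auto simp: zero_ext_def indicator_def)
    also have "\<dots> = emeasure (distr (density lborel (indicator (quantile_dom f))) borel (quantile f)) (Pair v -` B)"
      using emeasure_height_measure[OF P] by (simp add: height_measure_eq_distr)
    also have "\<dots> = emeasure (density lborel (indicator (quantile_dom f))) (quantile f -` Pair v -` B)"
      using quantile_measurable P by (subst emeasure_distr) auto
    also have "\<dots> = emeasure lborel (quantile_dom f \<inter> quantile f -` Pair v -` B)"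
    proof -
      have "quantile f -` Pair v -` B \<in> sets borel" using measurable_sets[OF quantile_measurable P] by simp
      then show ?thesis
        using quantile_dom_borel by (subst emeasure_density) (auto simp: indicator_inter_arith[symmetric] nn_integral_indicator)
    qed
    also have "quantile_dom f \<inter> quantile f -` Pair v -` B = Pair v -` ({p. snd p \<in> quantile_dom f} \<inter> quantile_lift f -` B)"
      by (auto simp: quantile_lift_def)
    finally show "(\<integral>\<^sup>+h\<in>{0<..}. ennreal (f h) * indicator B (v, h) \<partial>lebesgue)
        = emeasure lborel (Pair v -` ({p. snd p \<in> quantile_dom f} \<inter> quantile_lift f -` B))" .
  qed
  also have "\<dots> = emeasure (lborel \<Otimes>\<^sub>M lborel) ({p. snd p \<in> quantile_dom f} \<inter> quantile_lift f -` B)"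
    by (rule lborel.emeasure_pair_measure_alt[symmetric]) (use S in \<open>simp only: lborel_prod sets_lborel\<close>)
  also have "\<dots> = emeasure lborel ({p. snd p \<in> quantile_dom f} \<inter> quantile_lift f -` B)" by (simp add: lborel_prod)
  finally show "emeasure (height_intensity f) B = emeasure lborel ({p. snd p \<in> quantile_dom f} \<inter> quantile_lift f -` B)" .
qed

lemma height_intensity_lift:
  fixes B :: "('a::euclidean_space \<times> real) set"
  assumes B: "B \<in> sets borel" "bounded B"
  shows "{p. snd p \<in> quantile_dom f} \<inter> quantile_lift f -` B \<in> sets borel \<and> bounded ({p. snd p \<in> quantile_dom f} \<inter> quantile_lift f -` B) \<and>
    measure (height_intensity f) B = measure upper_lebesgue ({p. snd p \<in> quantile_dom f} \<inter> quantile_lift f -` B)"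
proof (intro conjI)
  let ?C = "{p. snd p \<in> quantile_dom f} \<inter> quantile_lift f -` B"
  show C: "?C \<in> sets borel" by (rule emeasure_height_intensity_lift[OF B(1)])
  obtain r where r: "B \<subseteq> ball 0 r" using bounded_subset_ballD[OF B(2)] by blast
  \<comment> \<open>A height of at most \<open>r\<close> bounds the level by \<open>I1 f r\<close>,
    so bounded sets have bounded preimages.\<close>
  have "?C \<subseteq> cball 0 r \<times> {0..I1 f r}"
  proof
    fix p assume p: "p \<in> ?C"
    then have n: "norm (fst p, quantile f (snd p)) < r" using r by (auto simp: quantile_lift_def)
    have "norm (fst p) \<le> r" using n norm_fst_le[of "fst p" "quantile f (snd p)"] by simp
    moreover have "quantile f (snd p) \<le> r" using n norm_snd_le[of "quantile f (snd p)" "fst p"] by simp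
    then have "snd p \<le> I1 f r" "0 < snd p" using quantile_le_iff[of "snd p" r] p by (auto simp: quantile_dom_def)
    ultimately show "p \<in> cball 0 r \<times> {0..I1 f r}" by (cases p) auto
  qed
  then show "bounded ?C" by (rule bounded_subset[rotated]) (intro bounded_Times; simp)
  have "?C \<inter> {p. 0 < snd p} = ?C" by (auto simp: quantile_dom_def)
  then show "measure (height_intensity f) B = measure upper_lebesgue ?C"
    using measure_upper_lebesgue[OF C] emeasure_height_intensity_lift(2)[OF B(1)] by (simp add: measure_def)
qed

lemma ex_I1_pos:
  assumes "emeasure (height_intensity f :: ('a::euclidean_space \<times> real) measure) UNIV \<noteq> 0"
  shows "\<exists>x. 0 < I1 f x"
proof (rule ccontr)
  assume "\<not> ?thesis"
  then have "quantile_dom f = {}" unfolding quantile_dom_def using less_le_trans by blast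
  then have "emeasure (height_intensity f :: ('a \<times> real) measure) UNIV = 0"
    by (subst emeasure_height_intensity_lift(2)) auto
  with assms show False by simp
qed

end

lemma homogeneous_intensity_slab:
  fixes B :: "'a::euclidean_space set"
  assumes B: "B \<in> sets borel" "bounded B" and \<gamma>: "0 < \<gamma>"
  shows "{p. 0 < snd p \<and> snd p < \<gamma>} \<inter> fst -` B \<in> sets borel \<and> bounded ({p. 0 < snd p \<and> snd p < \<gamma>} \<inter> fst -` B) \<and>
    measure (homogeneous_intensity \<gamma>) B = measure upper_lebesgue ({p :: 'a \<times> real. 0 < snd p \<and> snd p < \<gamma>} \<inter> fst -` B)"
proof -
  have eq: "{p. 0 < snd p \<and> snd p < \<gamma>} \<inter> fst -` B = B \<times> {0<..<\<gamma>}" by auto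
  have "B \<times> {0<..<\<gamma>} \<in> sets (borel \<Otimes>\<^sub>M borel)" using B(1) by (intro pair_measureI) auto
  then have S: "B \<times> {0<..<\<gamma>} \<in> sets borel" unfolding borel_prod .
  have "emeasure lborel (B \<times> {0<..<\<gamma>}) = emeasure (lborel \<Otimes>\<^sub>M lborel) (B \<times> {0<..<\<gamma>})" by (simp add: lborel_prod)
  also have "\<dots> = emeasure lborel B * ennreal \<gamma>"
    using B(1) \<gamma> by (subst lborel.emeasure_pair_measure_Times) auto
  also have "\<dots> = emeasure (homogeneous_intensity \<gamma>) B"
    unfolding homogeneous_intensity_def using B(1) by (simp add: emeasure_density_const mult.commute)
  finally have "measure (homogeneous_intensity \<gamma>) B = measure lborel (B \<times> {0<..<\<gamma>})" by (simp add: measure_def)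
  also have "\<dots> = measure upper_lebesgue (B \<times> {0<..<\<gamma>})"
  proof -
    have "B \<times> {0<..<\<gamma>} \<inter> {p. 0 < snd p} = B \<times> {0<..<\<gamma>}" by auto
    then show ?thesis using measure_upper_lebesgue[OF S] by simp
  qed
  finally show ?thesis unfolding eq using S B(2) by (auto intro: bounded_Times)
qed

section \<open>Convergence of the coupled skeletons\<close>

text \<open>No measurability of the events is needed: \<^const>\<open>measure\<close> is 0 on non-measurable sets.\<close>

lemma (in prob_space) prob_tendsto_0:
  assumes "\<And>x. x \<in> space M \<Longrightarrow> \<forall>\<^sub>F n in sequentially. \<not> E n x"
  shows "(\<lambda>n. prob {x\<in>space M. E n x}) \<longlonglongrightarrow> 0"
proof -
  define A where "A n = (if {x\<in>space M. E n x} \<in> sets M then {x\<in>space M. E n x} else {})" for n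
  have A: "A n \<in> sets M" "prob {x\<in>space M. E n x} = prob (A n)" for n
    by (auto simp: A_def measure_notin_sets)
  have "(\<lambda>n. prob (\<Union>m\<in>{n..}. A m)) \<longlonglongrightarrow> prob (\<Inter>n. \<Union>m\<in>{n..}. A m)"
  proof (rule finite_Lim_measure_decseq)
    show "range (\<lambda>n. \<Union>m\<in>{n..}. A m) \<subseteq> sets M" using A(1) by auto
    show "decseq (\<lambda>n. \<Union>m\<in>{n..}. A m)"
      unfolding decseq_def by (intro allI impI UN_mono) auto
  qed
  moreover have "(\<Inter>n. \<Union>m\<in>{n..}. A m) = {}"
  proof (rule equals0I)
    fix x assume x: "x \<in> (\<Inter>n. \<Union>m\<in>{n..}. A m)"
    then have "x \<in> space M" using A(1) sets.sets_into_space by blast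
    then obtain N where "\<And>n. n \<ge> N \<Longrightarrow> \<not> E n x" using assms unfolding eventually_sequentially by blast
    then show False using x by (auto simp: A_def split: if_splits)
  qed
  ultimately have lim: "(\<lambda>n. prob (\<Union>m\<in>{n..}. A m)) \<longlonglongrightarrow> 0" by simp
  have "prob (A n) \<le> prob (\<Union>m\<in>{n..}. A m)" for n
    using A(1) by (intro finite_measure_mono) auto
  then have "(\<lambda>n. prob (A n)) \<longlonglongrightarrow> 0"
    by (intro tendsto_sandwich[OF _ _ tendsto_const lim]) auto
  then show ?thesis by (simp add: A(2))
qed

lemma generic_subset: "generic X \<Longrightarrow> Y \<subseteq> X \<Longrightarrow> generic Y"
  unfolding generic_def by blast

lemma spread_mono:
  assumes "spread X" "X \<subseteq> Y"
  shows "spread Y"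
  unfolding spread_def
proof
  fix R
  obtain F where "F \<subseteq> X" "finite F" "\<forall>e. norm e = 1 \<longrightarrow> (\<exists>v\<in>F. R \<le> v \<bullet> e)"
    using assms(1) unfolding spread_def by blast
  then show "\<exists>F\<subseteq>Y. finite F \<and> (\<forall>e. norm e = 1 \<longrightarrow> (\<exists>v\<in>F. R \<le> v \<bullet> e))" using assms(2) by blast
qed

text \<open>A level below \<gamma> is eventually below \<open>I1 (f n) x\<close> for each positive
  \<open>x\<close>, so its quantile sinks to 0. A level above \<gamma> eventually exceeds
  \<open>I1 (f n) s\<close>, so its height passes the bound \<open>s\<close> or the point is
  dropped.\<close>

lemma laguerre_limit_quantile:
  fixes \<xi> :: "('a::euclidean_space \<times> real) set" and f :: "nat \<Rightarrow> real \<Rightarrow> real"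
  assumes f: "\<And>n. f n \<in> L1loc_plus" and \<gamma>: "0 < \<gamma>"
    and lim: "\<And>x. x > 0 \<Longrightarrow> (\<lambda>n. I1 (f n) x) \<longlonglongrightarrow> \<gamma>"
    and good: "good_config \<gamma> \<xi>" and lf: "locally_finite_set \<xi>"
    and wc: "\<And>n. weighted_config (quantile_lift (f n) ` (\<xi> \<inter> {p. snd p \<in> quantile_dom (f n)}))"
    and lfA: "locally_finite_set (fst ` (\<xi> \<inter> {p. 0 < snd p \<and> snd p < \<gamma>}))"
  shows "laguerre_limit (fst ` (\<xi> \<inter> {p. 0 < snd p \<and> snd p < \<gamma>}))
    (\<lambda>n. quantile_lift (f n) ` (\<xi> \<inter> {p. snd p \<in> quantile_dom (f n)})) (\<lambda>n v. quantile (f n) (THE u. (v, u) \<in> \<xi>))"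
proof
  let ?A = "fst ` (\<xi> \<inter> {p. 0 < snd p \<and> snd p < \<gamma>})"
  let ?An = "\<lambda>n. quantile_lift (f n) ` (\<xi> \<inter> {p. snd p \<in> quantile_dom (f n)})"
  let ?u = "\<lambda>v. THE u. (v, u) \<in> \<xi>"
  have pos: "0 < snd p" "snd p \<noteq> \<gamma>" if "p \<in> \<xi>" for p using good that by (auto simp: good_config_def)
  have inj: "inj_on fst \<xi>" using good by (simp add: good_config_def)
  have u: "(v, ?u v) \<in> \<xi>" "0 < ?u v" "?u v < \<gamma>" if v: "v \<in> ?A" for v
  proof -
    obtain u where u: "(v, u) \<in> \<xi>" "0 < u" "u < \<gamma>" using v by auto
    have "u' = u" if "(v, u') \<in> \<xi>" for u' using inj_onD[OF inj _ that u(1)] by simp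
    then have "?u v = u" using u(1) by blast
    then show "(v, ?u v) \<in> \<xi>" "0 < ?u v" "?u v < \<gamma>" using u by auto
  qed
  have ev_small: "\<forall>\<^sub>F n in sequentially. u \<in> quantile_dom (f n) \<and> quantile (f n) u \<le> x" if "0 < u" "u < \<gamma>" "0 < x" for u x
  proof -
    have "\<forall>\<^sub>F n in sequentially. u < I1 (f n) x" using order_tendstoD(1)[OF lim] that by blast
    then show ?thesis
    proof eventually_elim
      case (elim n)
      then have q: "u \<in> quantile_dom (f n)" using that by (auto simp: quantile_dom_def intro!: exI[of _ x])
      then show ?case using quantile_le_iff[OF f q] elim by simp
    qed
  qed
  show "weighted_config (?An n)" for n by (rule wc)
  show "locally_finite_set ?A" by (rule lfA)
  show "\<forall>\<^sub>F n in sequentially. (v, quantile (f n) (?u v)) \<in> ?An n" if "v \<in> ?A" for v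
    using ev_small[OF u(2,3)[OF that] zero_less_one]
  proof eventually_elim
    case (elim n)
    then have "(v, ?u v) \<in> \<xi> \<inter> {p. snd p \<in> quantile_dom (f n)}" using u(1)[OF that] by simp
    then show ?case by (rule rev_image_eqI) (simp add: quantile_lift_def)
  qed
  show "(\<lambda>n. quantile (f n) (?u v)) \<longlonglongrightarrow> 0" if "v \<in> ?A" for v
  proof (rule LIMSEQ_I)
    fix r :: real assume "r > 0"
    then have "\<forall>\<^sub>F n in sequentially. ?u v \<in> quantile_dom (f n) \<and> quantile (f n) (?u v) \<le> r / 2"
      by (intro ev_small u(2,3)[OF that]) simp
    then have "\<forall>\<^sub>F n in sequentially. norm (quantile (f n) (?u v) - 0) < r"
      by eventually_elim (use quantile_nonneg[OF f] \<open>r > 0\<close> in auto)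
    then show "\<exists>no. \<forall>n\<ge>no. norm (quantile (f n) (?u v) - 0) < r" by (simp add: eventually_sequentially)
  qed
  show "\<forall>\<^sub>F n in sequentially. \<forall>p\<in>?An n. norm (fst p) \<le> r \<longrightarrow> snd p \<le> r \<longrightarrow> fst p \<in> ?A" for r
  proof -
    \<comment> \<open>Convergence is given at positive arguments only, hence the maximum with
      1.\<close>
    define s where "s = max r 1"
    \<comment> \<open>Points of height at most \<open>s\<close> have levels up to
      \<open>I1 (f n) s\<close>, eventually below \<open>\<gamma> + 1\<close>. Only the finitely
      many points of \<open>W\<close> then need a common threshold for \<open>n\<close>.\<close>
    define W where "W = \<xi> \<inter> (cball 0 r \<times> {0..\<gamma> + 1})"
    have "finite W" using lf by (simp add: W_def locally_finite_set_def bounded_Times)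
    have s: "s > 0" by (simp add: s_def)
    have "\<forall>\<^sub>F n in sequentially. I1 (f n) s < snd p" if "p \<in> W" "\<gamma> < snd p" for p
      using order_tendstoD(2)[OF lim[OF s]] that by blast
    then have "\<forall>\<^sub>F n in sequentially. \<forall>p\<in>{p\<in>W. \<gamma> < snd p}. I1 (f n) s < snd p"
      using \<open>finite W\<close> by (intro eventually_ball_finite ballI) auto
    moreover have "\<forall>\<^sub>F n in sequentially. I1 (f n) s < \<gamma> + 1"
      by (rule order_tendstoD(2)[OF lim[OF s]]) simp
    ultimately show ?thesis
    proof eventually_elim
      case (elim n)
      show ?case
      proof (intro ballI impI)
        fix p assume "p \<in> ?An n" "norm (fst p) \<le> r" "snd p \<le> r"
        then obtain z where z: "z \<in> \<xi>" "snd z \<in> quantile_dom (f n)" "norm (fst z) \<le> r" "quantile (f n) (snd z) \<le> s" "fst p = fst z"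
          by (auto simp: quantile_lift_def s_def)
        have le: "snd z \<le> I1 (f n) s" using quantile_le_iff[OF f z(2)] z(4) by simp
        then have "z \<in> W" using z elim(2) pos(1)[OF z(1)] by (cases z) (auto simp: W_def)
        then have "\<gamma> < snd z \<Longrightarrow> I1 (f n) s < snd z" using elim(1) by blast
        then have "\<not> \<gamma> < snd z" using le by linarith
        then have "z \<in> \<xi> \<inter> {p. 0 < snd p \<and> snd p < \<gamma>}" using pos[OF z(1)] z(1) by auto
        then show "fst p \<in> ?A" using z(5) by auto
      qed
    qed
  qed
  have "spread {v. \<exists>u<\<gamma>. (v, u) \<in> \<xi>}" using good \<gamma> by (simp add: good_config_def)
  then show "spread ?A" by (rule spread_mono) (use pos(1) in force)
  have "generic (fst ` \<xi>)" using good by (simp add: good_config_def)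
  then show "generic ?A" by (rule generic_subset) auto
qed

theorem theorem3p6:
  fixes \<gamma> :: real
    and f :: "nat \<Rightarrow> real \<Rightarrow> real"
    and N :: "nat \<Rightarrow> 'w measure"
    and \<eta> :: "nat \<Rightarrow> 'w \<Rightarrow> ('a::euclidean_space \<times> real) set"
    and N\<^sub>\<gamma> :: "'u measure"
    and \<eta>\<^sub>\<gamma> :: "'u \<Rightarrow> 'a set"
  assumes dim: "DIM('a) \<ge> 2"
    and \<gamma>: "\<gamma> > 0"
    and f: "\<And>n. f n \<in> L1loc_plus"
    and nontrivial: "\<And>n. emeasure (height_intensity (f n) :: ('a \<times> real) measure) UNIV \<noteq> 0"
    and lim: "\<And>x. x > 0 \<Longrightarrow> (\<lambda>n. I1 (f n) x) \<longlonglongrightarrow> \<gamma>"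
    and \<eta>: "\<And>n. poisson_process (N n) (height_intensity (f n)) (\<eta> n)"
    and \<eta>\<^sub>\<gamma>: "poisson_process N\<^sub>\<gamma> (homogeneous_intensity \<gamma>) \<eta>\<^sub>\<gamma>"
  shows "\<exists>(M :: (nat \<Rightarrow> real) measure)
            (\<eta>' :: nat \<Rightarrow> (nat \<Rightarrow> real) \<Rightarrow> ('a \<times> real) set)
            (\<eta>\<^sub>\<gamma>' :: (nat \<Rightarrow> real) \<Rightarrow> 'a set).
      (\<forall>n. point_process M (\<eta>' n)) \<and> point_process M \<eta>\<^sub>\<gamma>' \<and>
      distr M config_space \<eta>\<^sub>\<gamma>' = distr N\<^sub>\<gamma> config_space \<eta>\<^sub>\<gamma> \<and>
      (\<forall>n. distr M config_space (\<eta>' n) = distr (N n) config_space (\<eta> n)) \<and>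
      converges_locally_whp M (\<lambda>n \<omega>. skel (laguerre_dual (\<eta>' n \<omega>)))
        (\<lambda>\<omega>. skel (laguerre_dual (at_height_0 (\<eta>\<^sub>\<gamma>' \<omega>)))) \<and>
      converges_in_prob M (\<lambda>n \<omega>. skel (laguerre (\<eta>' n \<omega>)))
        (\<lambda>\<omega>. skel (laguerre (at_height_0 (\<eta>\<^sub>\<gamma>' \<omega>))))"
  using ex_good_poisson_process[of \<gamma>, where 'a='a]
proof (elim exE conjE)
  fix M :: "(nat \<Rightarrow> real) measure" and Y :: "nat \<times> nat \<Rightarrow> (nat \<Rightarrow> real) \<Rightarrow> 'a \<times> real" and V
  assume Y: "\<forall>i. Y i \<in> borel_measurable M" and V: "\<forall>i. {x\<in>space M. V i x} \<in> sets M"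
    and pp: "poisson_process M upper_lebesgue (\<lambda>x. {Y i x | i. V i x})"
    and good0: "\<forall>x\<in>space M. good_config \<gamma> {Y i x | i. V i x}"
  note Y = spec[OF Y] and V = spec[OF V]
  interpret prob_space M using pp by (rule poisson_processD)
  define \<xi> where "\<xi> x = {Y i x | i. V i x}" for x
  have \<xi>: "poisson_process M upper_lebesgue \<xi>" using pp by (simp add: \<xi>_def[abs_def])
  have good: "good_config \<gamma> (\<xi> x)" if "x \<in> space M" for x using bspec[OF good0 that] by (simp add: \<xi>_def)
  have inj: "inj_on fst (\<xi> x)" and gen: "generic (fst ` \<xi> x)" and pos: "\<forall>p\<in>\<xi> x. 0 < snd p"
    and spr: "\<And>\<epsilon>. \<epsilon> > 0 \<Longrightarrow> spread {v. \<exists>u<\<epsilon>. (v, u) \<in> \<xi> x}" if "x \<in> space M" for x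
    using good[OF that] by (auto simp: good_config_def)
  \<comment> \<open>All processes are functions of the same \<xi> and keep its sites, which makes
    their skeletons comparable outcome by outcome.\<close>
  define \<eta>' where "\<eta>' n x = quantile_lift (f n) ` (\<xi> x \<inter> {p. snd p \<in> quantile_dom (f n)})" for n x
  define \<eta>\<^sub>\<gamma>' where "\<eta>\<^sub>\<gamma>' x = fst ` (\<xi> x \<inter> {p. 0 < snd p \<and> snd p < \<gamma>})" for x
  have P1: "poisson_process M (height_intensity (f n)) (\<eta>' n)" for n
    unfolding \<eta>'_def[abs_def]
  proof (rule poisson_process_map[OF \<xi> height_intensity_lift[OF f]])
    show "inj_on (quantile_lift (f n)) (\<xi> x \<inter> {p. snd p \<in> quantile_dom (f n)})" if "x \<in> space M" for x
      using inj[OF that] by (auto simp: inj_on_def quantile_lift_def)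
  qed
  have P2: "poisson_process M (homogeneous_intensity \<gamma>) \<eta>\<^sub>\<gamma>'"
    unfolding \<eta>\<^sub>\<gamma>'_def[abs_def]
  proof (rule poisson_process_map[OF \<xi> homogeneous_intensity_slab[OF _ _ \<gamma>]])
    show "inj_on fst (\<xi> x \<inter> {p. 0 < snd p \<and> snd p < \<gamma>})" if "x \<in> space M" for x
      using inj[OF that] by (rule inj_on_subset) auto
  qed
  have wc: "weighted_config (\<eta>' n x)" if x: "x \<in> space M" for n x
    unfolding weighted_config_def
  proof (intro conjI)
    show "locally_finite_set (\<eta>' n x)" by (rule poisson_processD(3)[OF P1 x])
    show "\<forall>p\<in>\<eta>' n x. 0 \<le> snd p" using quantile_nonneg[OF f] by (auto simp: \<eta>'_def quantile_lift_def)
    show "inj_on fst (\<eta>' n x)" using inj[OF x] by (auto simp: \<eta>'_def quantile_lift_def inj_on_def)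
  qed
  have wc0: "weighted_config (at_height_0 (\<eta>\<^sub>\<gamma>' x))" if x: "x \<in> space M" for x
    by (rule weighted_config_at_height_0[OF poisson_processD(3)[OF P2 x]])
  have fst\<eta>: "fst ` \<eta>' n x \<subseteq> fst ` \<xi> x" "fst ` at_height_0 (\<eta>\<^sub>\<gamma>' x) \<subseteq> fst ` \<xi> x" for n x
    by (auto simp: \<eta>'_def quantile_lift_def \<eta>\<^sub>\<gamma>'_def at_height_0_def image_image)
  have indep: "\<not> affine_dependent S" if "x \<in> space M" "S \<subseteq> fst ` \<xi> x" "card S = DIM('a) + 1" for S x
  proof -
    have "finite S" using that(3) card.infinite by fastforce
    then show ?thesis using gen[OF that(1)] that(2,3) unfolding generic_def by auto
  qed
  have fstY: "(\<lambda>x. fst (Y i x)) \<in> borel_measurable M" and sndY: "(\<lambda>x. snd (Y i x)) \<in> borel_measurable M" for i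
    by (rule measurable_compose[OF Y], intro borel_measurable_continuous_onI continuous_intros)+
  interpret E: enumerated_config M "\<lambda>i x. quantile_lift (f n) (Y i x)" "\<lambda>i x. V i x \<and> snd (Y i x) \<in> quantile_dom (f n)" "\<eta>' n" for n
  proof
    show "(\<lambda>x. quantile_lift (f n) (Y i x)) \<in> borel_measurable M" for i
      by (rule measurable_compose[OF Y quantile_lift_measurable[OF f]])
    show "{x \<in> space M. V i x \<and> snd (Y i x) \<in> quantile_dom (f n)} \<in> sets M" for i
    proof (intro sets.sets_Collect_conj V)
      show "{x \<in> space M. snd (Y i x) \<in> quantile_dom (f n)} \<in> sets M"
        using measurable_sets[OF sndY quantile_dom_borel[OF f]] by (simp add: vimage_def Int_def conj_commute)
    qed
    show "\<eta>' n x = {quantile_lift (f n) (Y i x) |i. V i x \<and> snd (Y i x) \<in> quantile_dom (f n)}" for x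
      unfolding \<eta>'_def \<xi>_def by blast
  qed (rule wc)
  interpret E0: enumerated_config M "\<lambda>i x. (fst (Y i x), 0)" "\<lambda>i x. V i x \<and> 0 < snd (Y i x) \<and> snd (Y i x) < \<gamma>"
    "\<lambda>x. at_height_0 (\<eta>\<^sub>\<gamma>' x)"
  proof
    show "(\<lambda>x. (fst (Y i x), 0 :: real)) \<in> borel_measurable M" for i
      by (intro borel_measurable_Pair fstY borel_measurable_const)
    show "{x \<in> space M. V i x \<and> 0 < snd (Y i x) \<and> snd (Y i x) < \<gamma>} \<in> sets M" for i
      using sndY by (intro sets.sets_Collect_conj V) auto
    show "at_height_0 (\<eta>\<^sub>\<gamma>' x) = {(fst (Y i x), 0) |i. V i x \<and> 0 < snd (Y i x) \<and> snd (Y i x) < \<gamma>}" for x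
    proof -
      have "\<xi> x \<inter> {p. 0 < snd p \<and> snd p < \<gamma>} = {Y i x |i. V i x \<and> 0 < snd (Y i x) \<and> snd (Y i x) < \<gamma>}"
        unfolding \<xi>_def by blast
      then show ?thesis unfolding \<eta>\<^sub>\<gamma>'_def at_height_0_def by (simp only: image_image image_Collect) blast
    qed
  qed (rule wc0)
  have rc1: "random_closed_set M (\<lambda>x. skel (laguerre_dual (\<eta>' n x)))" for n
  proof (rule E.random_closed_set_skel_laguerre_dual)
    show "\<not> affine_dependent S" if "x \<in> space M" "S \<subseteq> fst ` \<eta>' n x" "card S = DIM('a) + 1" for x S
      by (rule indep[OF that(1) order_trans[OF that(2) fst\<eta>(1)] that(3)])
    fix x assume x: "x \<in> space M"
    \<comment> \<open>Non-triviality enters here: levels below \<open>I1 (f n) a\<close> survive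
      with heights at most \<open>a\<close>, and good position makes this slab spread.\<close>
    obtain a where a: "0 < I1 (f n) a" using ex_I1_pos[OF f nontrivial[of n]] by (elim exE)
    have "{v. \<exists>u<I1 (f n) a. (v, u) \<in> \<xi> x} \<subseteq> {v. \<exists>h\<le>a. (v, h) \<in> \<eta>' n x}"
    proof clarify
      fix v u assume u: "u < I1 (f n) a" "(v, u) \<in> \<xi> x"
      have q: "u \<in> quantile_dom (f n)" using u pos[OF x] by (auto simp: quantile_dom_def intro!: exI[of _ a])
      have "(v, quantile (f n) u) \<in> \<eta>' n x"
        unfolding \<eta>'_def using u(2) q by (intro image_eqI[of _ _ "(v, u)"]) (auto simp: quantile_lift_def)
      then show "\<exists>h\<le>a. (v, h) \<in> \<eta>' n x" using quantile_le_iff[OF f q] u(1) by (intro exI[of _ "quantile (f n) u"]) auto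
    qed
    then show "\<exists>H. spread {v. \<exists>h\<le>H. (v, h) \<in> \<eta>' n x}" using spread_mono[OF spr[OF x a]] by blast
  qed
  have rc0: "random_closed_set M (\<lambda>x. skel (laguerre_dual (at_height_0 (\<eta>\<^sub>\<gamma>' x))))"
  proof (rule E0.random_closed_set_skel_laguerre_dual)
    show "\<not> affine_dependent S" if "x \<in> space M" "S \<subseteq> fst ` at_height_0 (\<eta>\<^sub>\<gamma>' x)" "card S = DIM('a) + 1" for x S
      by (rule indep[OF that(1) order_trans[OF that(2) fst\<eta>(2)] that(3)])
    fix x assume x: "x \<in> space M"
    have "{v. \<exists>u<\<gamma>. (v, u) \<in> \<xi> x} \<subseteq> {v. \<exists>h\<le>0. (v, h) \<in> at_height_0 (\<eta>\<^sub>\<gamma>' x)}"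
      using pos[OF x] by (force simp: at_height_0_def \<eta>\<^sub>\<gamma>'_def)
    then show "\<exists>H. spread {v. \<exists>h\<le>H. (v, h) \<in> at_height_0 (\<eta>\<^sub>\<gamma>' x)}" using spread_mono[OF spr[OF x \<gamma>]] by blast
  qed
  have L: "laguerre_limit (\<eta>\<^sub>\<gamma>' x) (\<lambda>n. \<eta>' n x) (\<lambda>n v. quantile (f n) (THE u. (v, u) \<in> \<xi> x))" if x: "x \<in> space M" for x
    unfolding \<eta>\<^sub>\<gamma>'_def \<eta>'_def
  proof (rule laguerre_limit_quantile[OF f \<gamma> lim good[OF x] poisson_processD(3)[OF \<xi> x]])
    show "weighted_config (quantile_lift (f n) ` (\<xi> x \<inter> {p. snd p \<in> quantile_dom (f n)}))" for n
      using wc[OF x] by (simp add: \<eta>'_def)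
    show "locally_finite_set (fst ` (\<xi> x \<inter> {p. 0 < snd p \<and> snd p < \<gamma>}))"
      using poisson_processD(3)[OF P2 x] by (simp add: \<eta>\<^sub>\<gamma>'_def)
  qed
  have C1: "converges_locally_whp M (\<lambda>n x. skel (laguerre_dual (\<eta>' n x))) (\<lambda>x. skel (laguerre_dual (at_height_0 (\<eta>\<^sub>\<gamma>' x))))"
    unfolding converges_locally_whp_def
  proof (intro conjI allI impI rc1 rc0 prob_tendsto_0)
    fix R :: real and x assume "x \<in> space M"
    then interpret laguerre_limit "\<eta>\<^sub>\<gamma>' x" "\<lambda>n. \<eta>' n x" "\<lambda>n v. quantile (f n) (THE u. (v, u) \<in> \<xi> x)" by (rule L)
    show "\<forall>\<^sub>F n in sequentially. \<not> skel (laguerre_dual (\<eta>' n x)) \<inter> cball 0 R \<noteq>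
        skel (laguerre_dual (at_height_0 (\<eta>\<^sub>\<gamma>' x))) \<inter> cball 0 R"
      using eventually_skel_dual by simp
  qed
  have C2: "converges_in_prob M (\<lambda>n x. skel (laguerre (\<eta>' n x))) (\<lambda>x. skel (laguerre (at_height_0 (\<eta>\<^sub>\<gamma>' x))))"
    unfolding converges_in_prob_def
  proof (intro conjI allI impI E.random_closed_set_skel_laguerre E0.random_closed_set_skel_laguerre prob_tendsto_0)
    fix \<epsilon> :: real and C :: "'a set" and x assume \<epsilon>: "0 < \<epsilon>" "compact C" and "x \<in> space M"
    then interpret laguerre_limit "\<eta>\<^sub>\<gamma>' x" "\<lambda>n. \<eta>' n x" "\<lambda>n v. quantile (f n) (THE u. (v, u) \<in> \<xi> x)" by (intro L)
    show "\<forall>\<^sub>F n in sequentially. \<not> (skel (laguerre (\<eta>' n x)) - open_nbhd \<epsilon> (skel (laguerre (at_height_0 (\<eta>\<^sub>\<gamma>' x)))) \<union>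
        (skel (laguerre (at_height_0 (\<eta>\<^sub>\<gamma>' x))) - open_nbhd \<epsilon> (skel (laguerre (\<eta>' n x))))) \<inter> C \<noteq> {}"
      using eventually_skel_upper[OF \<epsilon>] eventually_skel_lower[OF \<epsilon>]
      by eventually_elim (simp add: Int_Un_distrib2)
  qed
  have "point_process M (\<eta>' n)" "point_process M \<eta>\<^sub>\<gamma>'" for n
    using P1 P2 by (auto simp: poisson_process_def)
  then show ?thesis
    using poisson_process_unique[OF P2 \<eta>\<^sub>\<gamma>] poisson_process_unique[OF P1 \<eta>] C1 C2
    by (intro exI[of _ M] exI[of _ \<eta>'] exI[of _ \<eta>\<^sub>\<gamma>'] conjI allI) auto
qed

end
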